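(* Let $\mathcal{A}$ be a masa inside a type II$_1$ factor $\mathcal{M}$ and let $E:\mathcal M\to\mathcal A$ denote the trace preserving conditional expectation onto $\mathcal A$. Suppose that for every nonzero projection $P$ in $\mathcal{M}$, the restriction of $E$ to $P\mathcal{M}P$ has non-trivial kernel. Then there is a diffuse abelian von Neumann subalgebra $\mathcal{B}$ of $\mathcal{M}$ that is orthogonal to $\mathcal{A}$.
   Context: $\tau$ denotes the normalized trace of $\mathcal M$; a masa is a maximal abelian self-adjoint subalgebra. Two subalgebras $\mathcal{A}$ and $\mathcal{B}$ of $\mathcal M$ are orthogonal if $\tau(AB) = \tau(A)\,\tau(B)$ for every $A \in \mathcal{A}$ and $B \in \mathcal{B}$. Diffuse means having no minimal projections. *)

theory Defs
  imports "HOL-Analysis.Analysis"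
begin

section \<open>Complex Hilbert spaces\<close>

text \<open>
  The inner product is linear in its first argument. The last axiom says that the norm is the one
  induced by the inner product, and so subsumes positive definiteness; completeness is part of
  \<^class>\<open>banach\<close>.
\<close>

class complex_hilbert = banach +
  fixes scaleC :: "complex \<Rightarrow> 'a \<Rightarrow> 'a" (infixr "*\<^sub>C" 75)
    and cinner :: "'a \<Rightarrow> 'a \<Rightarrow> complex"
  assumes scaleC_add_right: "c *\<^sub>C (x + y) = c *\<^sub>C x + c *\<^sub>C y"
    and scaleC_add_left: "(c + d) *\<^sub>C x = c *\<^sub>C x + d *\<^sub>C x"
    and scaleC_scaleC: "c *\<^sub>C d *\<^sub>C x = (c * d) *\<^sub>C x"
    and scaleC_of_real: "complex_of_real r *\<^sub>C x = r *\<^sub>R x"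
    and cinner_commute: "cinner x y = cnj (cinner y x)"
    and cinner_add_left: "cinner (x + y) z = cinner x z + cinner y z"
    and cinner_scaleC_left: "cinner (c *\<^sub>C x) y = c * cinner x y"
    and cinner_self: "cinner x x = complex_of_real ((norm x)\<^sup>2)"

instantiation complex :: complex_hilbert
begin

definition scaleC_complex :: "complex \<Rightarrow> complex \<Rightarrow> complex"
  where "scaleC_complex c x = c * x"

definition cinner_complex :: "complex \<Rightarrow> complex \<Rightarrow> complex"
  where "cinner_complex x y = x * cnj y"

instance
  by standard
    (simp_all add: scaleC_complex_def cinner_complex_def algebra_simps scaleR_conv_of_real
      complex_norm_square flip: of_real_power)

end

lemma norm_scaleC: "norm (c *\<^sub>C x) = cmod c * norm (x :: 'a :: complex_hilbert)"
proof -
  have "cinner (c *\<^sub>C x) (c *\<^sub>C x) = c * cnj c * cinner x x"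
    by (metis cinner_commute cinner_scaleC_left complex_cnj_mult mult.assoc mult.commute)
  then have "complex_of_real ((norm (c *\<^sub>C x))\<^sup>2) = complex_of_real ((cmod c * norm x)\<^sup>2)"
    by (simp add: cinner_self complex_norm_square power_mult_distrib flip: of_real_power)
  then have "(norm (c *\<^sub>C x))\<^sup>2 = (cmod c * norm x)\<^sup>2"
    using of_real_eq_iff by blast
  then show ?thesis
    by simp
qed

section \<open>Bounded operators\<close>

text \<open>
  Library type \<open>'h \<Rightarrow>\<^sub>L 'h\<close> consists of the bounded real-linear maps; the bounded operators of
  the complex Hilbert space are the complex-linear ones among them.
\<close>

type_synonym 'h operator = "'h \<Rightarrow>\<^sub>L 'h"

definition bounded_operators :: "'h::complex_hilbert operator set"
  where "bounded_operators = {T. \<forall>c x. blinfun_apply T (c *\<^sub>C x) = c *\<^sub>C blinfun_apply T x}"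

lift_definition scale_operator ::
    "complex \<Rightarrow> 'h::complex_hilbert operator \<Rightarrow> 'h operator" (infixr "*\<^sub>O" 75)
  is "\<lambda>c T x. c *\<^sub>C T x"
proof -
  fix c :: complex and T :: "'h \<Rightarrow> 'h"
  assume "bounded_linear T"
  moreover have "bounded_linear (\<lambda>x :: 'h. c *\<^sub>C x)"
  proof (rule bounded_linear_intro)
    show "c *\<^sub>C (r *\<^sub>R x) = r *\<^sub>R (c *\<^sub>C x)" for r and x :: 'h
      by (simp add: scaleC_scaleC mult.commute flip: scaleC_of_real)
    show "norm (c *\<^sub>C x) \<le> norm x * cmod c" for x :: 'h
      by (simp add: norm_scaleC mult.commute)
  qed (rule scaleC_add_right)
  ultimately show "bounded_linear (\<lambda>x. c *\<^sub>C T x)"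
    by (rule bounded_linear_compose[rotated])
qed

definition adj :: "'h::complex_hilbert operator \<Rightarrow> 'h operator"
  where "adj T = (THE S. \<forall>x y. cinner (blinfun_apply T x) y = cinner x (blinfun_apply S y))"

definition positive_operator :: "'h::complex_hilbert operator \<Rightarrow> bool"
  where "positive_operator T \<longleftrightarrow>
    T \<in> bounded_operators \<and> (\<forall>x. cinner (blinfun_apply T x) x \<in> \<real>\<^sub>\<ge>\<^sub>0)"

definition le_operator :: "'h::complex_hilbert operator \<Rightarrow> 'h operator \<Rightarrow> bool" (infix "\<le>\<^sub>O" 50)
  where "S \<le>\<^sub>O T \<longleftrightarrow> positive_operator (T - S)"

definition is_projection :: "'h::complex_hilbert operator \<Rightarrow> bool"
  where "is_projection P \<longleftrightarrow> P \<in> bounded_operators \<and> P o\<^sub>L P = P \<and> adj P = P"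

section \<open>Algebras of operators\<close>

definition selfadjoint_subalgebra :: "'h::complex_hilbert operator set \<Rightarrow> bool"
  where "selfadjoint_subalgebra A \<longleftrightarrow>
    A \<subseteq> bounded_operators \<and> 0 \<in> A \<and>
    (\<forall>S\<in>A. \<forall>T\<in>A. S + T \<in> A \<and> S o\<^sub>L T \<in> A) \<and>
    (\<forall>c. \<forall>T\<in>A. c *\<^sub>O T \<in> A) \<and>
    (\<forall>T\<in>A. adj T \<in> A)"

definition abelian_algebra :: "'h::complex_hilbert operator set \<Rightarrow> bool"
  where "abelian_algebra A \<longleftrightarrow> (\<forall>S\<in>A. \<forall>T\<in>A. S o\<^sub>L T = T o\<^sub>L S)"

text \<open>
  Von Neumann algebras contain the identity operator of the Hilbert space. In particular, a von
  Neumann subalgebra has the same unit as the ambient algebra.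
\<close>

definition von_neumann_algebra :: "'h::complex_hilbert operator set \<Rightarrow> bool"
  where "von_neumann_algebra M \<longleftrightarrow>
    selfadjoint_subalgebra M \<and> id_blinfun \<in> M \<and> closedin strong_operator_topology M"

definition commutant :: "'h::complex_hilbert operator set \<Rightarrow> 'h operator set"
  where "commutant M = {T \<in> bounded_operators. \<forall>S\<in>M. T o\<^sub>L S = S o\<^sub>L T}"

definition factor :: "'h::complex_hilbert operator set \<Rightarrow> bool"
  where "factor M \<longleftrightarrow>
    von_neumann_algebra M \<and> (id_blinfun :: 'h operator) \<noteq> 0 \<and>
    M \<inter> commutant M = range (\<lambda>c. c *\<^sub>O id_blinfun)"

definition finite_algebra :: "'h::complex_hilbert operator set \<Rightarrow> bool"
  where "finite_algebra M \<longleftrightarrow>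
    (\<forall>V\<in>M. adj V o\<^sub>L V = id_blinfun \<longrightarrow> V o\<^sub>L adj V = id_blinfun)"

definition compression :: "'h::complex_hilbert operator \<Rightarrow> 'h operator set \<Rightarrow> 'h operator set"
  where "compression P M = {P o\<^sub>L T o\<^sub>L P | T. T \<in> M}"

definition abelian_projection :: "'h::complex_hilbert operator set \<Rightarrow> 'h operator \<Rightarrow> bool"
  where "abelian_projection M P \<longleftrightarrow>
    P \<in> M \<and> is_projection P \<and> abelian_algebra (compression P M)"

definition type_II1_factor :: "'h::complex_hilbert operator set \<Rightarrow> bool"
  where "type_II1_factor M \<longleftrightarrow>
    factor M \<and> finite_algebra M \<and> (\<forall>P. abelian_projection M P \<longrightarrow> P = 0)"

definition minimal_projection :: "'h::complex_hilbert operator set \<Rightarrow> 'h operator \<Rightarrow> bool"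
  where "minimal_projection M P \<longleftrightarrow>
    P \<in> M \<and> is_projection P \<and> P \<noteq> 0 \<and>
    (\<forall>Q\<in>M. is_projection Q \<and> Q \<le>\<^sub>O P \<longrightarrow> Q = 0 \<or> Q = P)"

definition diffuse :: "'h::complex_hilbert operator set \<Rightarrow> bool"
  where "diffuse M \<longleftrightarrow> (\<nexists>P. minimal_projection M P)"

definition masa :: "'h::complex_hilbert operator set \<Rightarrow> 'h operator set \<Rightarrow> bool"
  where "masa M A \<longleftrightarrow>
    A \<subseteq> M \<and> selfadjoint_subalgebra A \<and> abelian_algebra A \<and>
    (\<forall>C. A \<subseteq> C \<and> C \<subseteq> M \<and> selfadjoint_subalgebra C \<and> abelian_algebra C \<longrightarrow> C = A)"

section \<open>Trace and conditional expectation\<close>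

definition linear_on_algebra ::
    "'h::complex_hilbert operator set \<Rightarrow> (complex \<Rightarrow> 'b \<Rightarrow> 'b) \<Rightarrow> ('h operator \<Rightarrow> 'b::plus) \<Rightarrow> bool"
  where "linear_on_algebra M scl f \<longleftrightarrow>
    (\<forall>S\<in>M. \<forall>T\<in>M. f (S + T) = f S + f T) \<and> (\<forall>c. \<forall>T\<in>M. f (c *\<^sub>O T) = scl c (f T))"

definition least_upper_bound ::
    "'h::complex_hilbert operator set \<Rightarrow> 'h operator set \<Rightarrow> 'h operator \<Rightarrow> bool"
  where "least_upper_bound M D T \<longleftrightarrow>
    T \<in> M \<and> (\<forall>S\<in>D. S \<le>\<^sub>O T) \<and> (\<forall>R\<in>M. (\<forall>S\<in>D. S \<le>\<^sub>O R) \<longrightarrow> T \<le>\<^sub>O R)"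

text \<open>
  Normality: the functional preserves suprema of bounded upward directed sets (equivalently,
  increasing nets) of positive elements. It is only used for positive functionals, whose values
  on positive elements are real.
\<close>

definition normal_functional ::
    "'h::complex_hilbert operator set \<Rightarrow> ('h operator \<Rightarrow> complex) \<Rightarrow> bool"
  where "normal_functional M \<tau> \<longleftrightarrow>
    (\<forall>D T. D \<noteq> {} \<and> D \<subseteq> M \<and> (\<forall>S\<in>D. positive_operator S) \<and>
       (\<forall>R\<in>D. \<forall>S\<in>D. \<exists>U\<in>D. R \<le>\<^sub>O U \<and> S \<le>\<^sub>O U) \<and> least_upper_bound M D T \<longrightarrow>
       Re (\<tau> T) = (SUP S\<in>D. Re (\<tau> S)))"

text \<open>
  On a type II\<open>\<^sub>1\<close> factor there is exactly one functional with this property. Its values outside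
  \<open>M\<close> are irrelevant; the same applies to conditional expectations below.
\<close>

definition normalized_trace ::
    "'h::complex_hilbert operator set \<Rightarrow> ('h operator \<Rightarrow> complex) \<Rightarrow> bool"
  where "normalized_trace M \<tau> \<longleftrightarrow>
    linear_on_algebra M (*) \<tau> \<and>
    \<tau> id_blinfun = 1 \<and>
    (\<forall>T\<in>M. positive_operator T \<longrightarrow> \<tau> T \<in> \<real>\<^sub>\<ge>\<^sub>0) \<and>
    (\<forall>S\<in>M. \<forall>T\<in>M. \<tau> (S o\<^sub>L T) = \<tau> (T o\<^sub>L S)) \<and>
    (\<forall>T\<in>M. positive_operator T \<and> \<tau> T = 0 \<longrightarrow> T = 0) \<and>
    normal_functional M \<tau>"

definition conditional_expectation ::
    "'h::complex_hilbert operator set \<Rightarrow> 'h operator set \<Rightarrow> ('h operator \<Rightarrow> 'h operator) \<Rightarrow> bool"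
  where "conditional_expectation M A E \<longleftrightarrow>
    linear_on_algebra M (*\<^sub>O) E \<and>
    (\<forall>T\<in>M. E T \<in> A) \<and>
    (\<forall>T\<in>A. E T = T) \<and>
    (\<forall>T\<in>M. positive_operator T \<longrightarrow> positive_operator (E T)) \<and>
    (\<forall>R\<in>A. \<forall>S\<in>A. \<forall>T\<in>M. E (R o\<^sub>L T o\<^sub>L S) = R o\<^sub>L E T o\<^sub>L S)"

definition trace_preserving ::
    "'h::complex_hilbert operator set \<Rightarrow> ('h operator \<Rightarrow> complex) \<Rightarrow> ('h operator \<Rightarrow> 'h operator) \<Rightarrow> bool"
  where "trace_preserving M \<tau> E \<longleftrightarrow> (\<forall>T\<in>M. \<tau> (E T) = \<tau> T)"

definition orthogonal_algebras ::
    "('h::complex_hilbert operator \<Rightarrow> complex) \<Rightarrow> 'h operator set \<Rightarrow> 'h operator set \<Rightarrow> bool"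
  where "orthogonal_algebras \<tau> A B \<longleftrightarrow> (\<forall>S\<in>A. \<forall>T\<in>B. \<tau> (S o\<^sub>L T) = \<tau> S * \<tau> T)"

end

theory Submission
  imports Defs
begin

text \<open>
  For a projection \<open>p\<close> whose conditional expectation is a constant \<open>c\<close>, the set \<open>K\<close> of all
  \<open>0 \<le> x \<le> p\<close> in \<open>M\<close> with expectation \<open>c / 2\<close> is convex, bounded and complete in the 2-norm
  \<open>sqrt (\<tau> (x\<^sup>* x))\<close>, and so it has an extreme point \<open>x\<close>. If \<open>x\<close> were not a projection, then
  \<open>x - x\<^sup>2\<close> would dominate a multiple of a nonzero projection \<open>P\<close>, and adding to \<open>x\<close> plus or
  minus a small selfadjoint element of \<open>P M P\<close> in the kernel of the expectation would contradict
  extremality. Halving repeatedly gives a dyadic tree of projections with expectations \<open>2\<^sup>-\<^sup>n\<close>.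
  They span an abelian algebra orthogonal to \<open>A\<close>; its 2-norm closure in \<open>M\<close> is strongly closed
  and has no minimal projection.

  Completeness of bounded sets in the 2-norm comes from normality of the trace, and takes the
  place of weak compactness throughout.
\<close>

text \<open>The obstacle is that \<open>M\<close> acts on an arbitrary Hilbert space, possibly
  nonseparable, whose vectors are tied to \<tau> only by faithfulness and normality. The bridge is a
  Borel-Cantelli argument: positive contractions with traces at most \<open>(1/2)^k\<close> have
  quadratic forms tending to 0 at every vector, since their tails decrease to a positive operator of
  trace 0. Hence 2-norm convergence of a norm-bounded sequence implies strong convergence.
  Functional calculus is done with the inverses of 1 + z for positive z alone: they provide kernel
  and spectral projections, and bounded substitutes for suprema of unbounded sums. Strong closedness
  of the final algebra is harder than completeness, because strong approximants of T come without
  norm bounds. Kaplansky density is replaced by passing to the inverse of 1 + T^* T: the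
  corresponding inverses for the approximants are contractions, and commutativity makes them
  converge.\<close>

text \<open>Evaluate at the minimiser l = - cnj b / c; if c = 0, the expression is affine in l and
  bounded below only for b = 0. The Cauchy-Schwarz inequalities \<open>cmod_cinner_le\<close>,
  \<open>positive_cauchy_schwarz\<close> and \<open>tr_cauchy_schwarz\<close> all come from
  this.\<close>

lemma complex_discriminant:
  fixes a c :: real and b :: complex
  assumes "\<And>l. a + 2 * Re (l * b) + (cmod l)\<^sup>2 * c \<ge> 0" and "c \<ge> 0"
  shows "(cmod b)\<^sup>2 \<le> a * c"
proof (cases "c = 0")
  case False
  then have c: "c > 0" using assms(2) by simp
  have "- (cnj b / of_real c) * b = - of_real ((cmod b)\<^sup>2 / c)"
    by (simp add: complex_norm_square mult.commute del: of_real_power)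
  then have "Re (- (cnj b / of_real c) * b) = - ((cmod b)\<^sup>2 / c)"
    by (simp only: uminus_complex.sel Re_complex_of_real)
  moreover have "(cmod (- (cnj b / of_real c)))\<^sup>2 * c = (cmod b)\<^sup>2 / c"
    using c by (simp add: norm_divide power_divide power2_eq_square)
  ultimately have "a - (cmod b)\<^sup>2 / c \<ge> 0"
    using assms(1)[of "- (cnj b / of_real c)"] by linarith
  then show ?thesis using c by (simp add: field_simps)
next
  case True
  have "b = 0"
  proof (rule ccontr)
    assume "b \<noteq> 0"
    \<comment> \<open>Large enough that the value at - t cnj b is a - 2 (|a| + 1) < 0.\<close>
    define t where "t = (\<bar>a\<bar> + 1) / (cmod b)\<^sup>2"
    have "- (of_real t * cnj b) * b = - of_real (t * (cmod b)\<^sup>2)"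
      by (simp add: complex_norm_square mult_ac del: of_real_power)
    then have "Re (- (of_real t * cnj b) * b) = - (t * (cmod b)\<^sup>2)"
      by (simp only: uminus_complex.sel Re_complex_of_real)
    moreover have "t * (cmod b)\<^sup>2 = \<bar>a\<bar> + 1" using \<open>b \<noteq> 0\<close> by (simp add: t_def)
    ultimately show False using assms(1)[of "- (of_real t * cnj b)"] True by simp
  qed
  with True show ?thesis by simp
qed

lemma square_le_mult_imp_le:
  fixes a b :: real
  assumes "a\<^sup>2 \<le> b * a" "0 \<le> b" shows "a \<le> b"
proof (rule ccontr)
  assume "\<not> a \<le> b"
  then have "b * a < a * a" using assms(2) by (intro mult_strict_right_mono) auto
  then show False using assms(1) by (simp add: power2_eq_square)
qed

text \<open>Minimisation by the parallelogram law bounds squared distances in terms of the smaller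
  index; this turns such a bound into a Cauchy condition, for vectors and for \<open>n2\<close>
  alike.\<close>

lemma small_tails:
  fixes d :: "nat \<Rightarrow> nat \<Rightarrow> real"
  assumes d: "\<And>m n. n \<le> m \<Longrightarrow> (d m n)\<^sup>2 \<le> f n" and f: "f \<longlonglongrightarrow> 0"
    and sym: "\<And>m n. d m n = d n m" and e: "e > 0"
  shows "\<exists>N. \<forall>m\<ge>N. \<forall>n\<ge>N. d m n < e"
proof -
  have "\<forall>\<^sub>F n in sequentially. f n < e\<^sup>2" using f e by (intro order_tendstoD) auto
  then obtain N where N: "\<And>n. n \<ge> N \<Longrightarrow> f n < e\<^sup>2" unfolding eventually_sequentially by blast
  have *: "d m n < e" if "N \<le> n" "n \<le> m" for m n
  proof (rule power_less_imp_less_base)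
    show "(d m n)\<^sup>2 < e\<^sup>2" using d[OF that(2)] N[OF that(1)] by linarith
  qed (use e in simp)
  show ?thesis by (rule exI[of _ N]) (metis * sym nle_le)
qed

section \<open>Hilbert space geometry\<close>

lemma scaleR_scaleC: "r *\<^sub>R x = complex_of_real r *\<^sub>C (x::'h::complex_hilbert)"
  by (simp add: scaleC_of_real)

lemma cinner_add_right: "cinner x (y + z) = cinner x y + cinner (x::'h::complex_hilbert) z"
  by (metis cinner_add_left cinner_commute complex_cnj_add)

lemma cinner_scaleC_right: "cinner x (c *\<^sub>C y) = cnj c * cinner (x::'h::complex_hilbert) y"
  by (metis cinner_commute cinner_scaleC_left complex_cnj_mult)

lemma Re_cinner_self: "Re (cinner x x) = (norm (x::'h::complex_hilbert))\<^sup>2"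
  by (simp add: cinner_self)

lemma norm_add_scaleC_square:
  fixes x y :: "'h::complex_hilbert"
  shows "(norm (x + l *\<^sub>C y))\<^sup>2 = (norm x)\<^sup>2 + 2 * Re (l * cinner y x) + (cmod l)\<^sup>2 * (norm y)\<^sup>2"
proof -
  have "cinner x (l *\<^sub>C y) = cnj (l * cinner y x)"
    by (subst cinner_commute) (simp add: cinner_scaleC_left)
  moreover have "cinner (l *\<^sub>C y) (l *\<^sub>C y) = of_real ((cmod l)\<^sup>2 * (norm y)\<^sup>2)"
    by (simp add: cinner_self norm_scaleC power_mult_distrib)
  ultimately have "Re (cinner (x + l *\<^sub>C y) (x + l *\<^sub>C y)) =
      Re (cinner x x) + 2 * Re (l * cinner y x) + (cmod l)\<^sup>2 * (norm y)\<^sup>2"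
    by (simp add: cinner_add_left cinner_add_right cinner_scaleC_left)
  then show ?thesis by (simp only: Re_cinner_self)
qed

lemma cmod_cinner_le: "cmod (cinner x y) \<le> norm x * norm (y::'h::complex_hilbert)"
proof -
  have "(cmod (cinner y x))\<^sup>2 \<le> (norm x)\<^sup>2 * (norm y)\<^sup>2"
    by (rule complex_discriminant) (metis norm_add_scaleC_square zero_le_power2)+
  then have "cmod (cinner y x) \<le> norm x * norm y"
    by (metis abs_le_square_iff abs_of_nonneg mult_nonneg_nonneg norm_ge_zero power_mult_distrib)
  then show ?thesis by (metis cinner_commute complex_mod_cnj)
qed

interpretation cinner: bounded_bilinear "cinner :: 'h::complex_hilbert \<Rightarrow> 'h \<Rightarrow> complex"
proof
  fix a a' b b' :: 'h and r :: real
  show "cinner (a + a') b = cinner a b + cinner a' b" by (rule cinner_add_left)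
  show "cinner a (b + b') = cinner a b + cinner a b'" by (rule cinner_add_right)
  show "cinner (r *\<^sub>R a) b = r *\<^sub>R cinner a b"
    by (simp add: scaleR_scaleC[of r a] cinner_scaleC_left scaleR_conv_of_real)
  show "cinner a (r *\<^sub>R b) = r *\<^sub>R cinner a b"
    by (simp add: scaleR_scaleC[of r b] cinner_scaleC_right scaleR_conv_of_real)
  show "\<exists>K. \<forall>a b. cmod (cinner (a::'h) b) \<le> norm a * norm b * K"
    by (rule exI[of _ 1]) (simp add: cmod_cinner_le)
qed

lemmas cinner_simps = cinner.add_left cinner.add_right cinner.diff_left cinner.diff_right
  cinner.minus_left cinner.minus_right cinner.scaleR_left cinner.scaleR_right cinner.zero_left cinner.zero_right
  cinner_scaleC_left cinner_scaleC_right

lemma parallelogram: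
  fixes x y :: "'h::complex_hilbert"
  shows "(norm (x - y))\<^sup>2 = 2 * (norm x)\<^sup>2 + 2 * (norm y)\<^sup>2 - 4 * (norm ((1/2) *\<^sub>R (x + y)))\<^sup>2"
proof -
  have "Re (cinner (x - y) (x - y)) = 2 * Re (cinner x x) + 2 * Re (cinner y y)
     - 4 * Re (cinner ((1/2) *\<^sub>R (x + y)) ((1/2) *\<^sub>R (x + y)))"
    by (simp add: cinner_simps field_simps)
  then show ?thesis by (simp only: Re_cinner_self)
qed

lemma cinner_left_eqI: "(\<And>x. cinner x u = cinner x v) \<Longrightarrow> u = (v::'h::complex_hilbert)"
  by (metis cinner.diff_right cinner_self eq_iff_diff_eq_0 norm_eq_zero of_real_eq_0_iff
      zero_eq_power2)

text \<open>The representing vector is a multiple of the point v of least norm on the affine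
  hyperplane f = 1; the midpoint form of the parallelogram law makes a minimising sequence
  Cauchy.\<close>

lemma riesz_representation:
  fixes f :: "'h::complex_hilbert \<Rightarrow> complex"
  assumes f: "bounded_linear f" and fc: "\<And>c x. f (c *\<^sub>C x) = c * f x"
  obtains u where "\<And>x. f x = cinner x u"
proof (cases "\<forall>x. f x = 0")
  case True
  then show ?thesis using that[of 0] by (simp add: cinner_simps)
next
  case False
  then obtain v0 where "f v0 \<noteq> 0" by auto
  then have S_ne: "f ((1 / f v0) *\<^sub>C v0) = 1" by (simp add: fc)
  define S where "S = {u. f u = 1}"
  define d where "d = Inf ((\<lambda>u. (norm u)\<^sup>2) ` S)"
  have ne: "S \<noteq> {}" using S_ne S_def by blast
  have bdd: "bdd_below ((\<lambda>u. (norm u)\<^sup>2) ` S)" by (rule bdd_belowI2[of _ 0]) simp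
  have d_le: "d \<le> (norm u)\<^sup>2" if "u \<in> S" for u
    unfolding d_def by (rule cINF_lower[OF bdd that])
  have "\<exists>u\<in>S. (norm u)\<^sup>2 < d + (1/2)^n" for n :: nat
    using cINF_less_iff[OF ne bdd, of "d + (1/2)^n"] d_def by auto
  then obtain u where uS: "\<And>n. u n \<in> S" and ud: "\<And>n. (norm (u n))\<^sup>2 < d + (1/2)^n"
    by metis
  interpret f: bounded_linear f by (rule f)
  have close: "(norm (u m - u n))\<^sup>2 < 4 * (1/2)^n" if "n \<le> m" for m n
  proof -
    have "(1/2) *\<^sub>R (u m + u n) \<in> S"
      using uS[of m] uS[of n] by (simp add: S_def f.scaleR f.add scaleR_conv_of_real)
    moreover have "(1/2::real)^m \<le> (1/2)^n" using that by (simp add: power_decreasing)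
    ultimately show ?thesis
      using parallelogram[of "u m" "u n"] ud[of m] ud[of n] d_le[of "(1/2) *\<^sub>R (u m + u n)"]
      by linarith
  qed
  have "Cauchy u"
    unfolding Cauchy_def dist_norm
  proof (intro allI impI)
    fix e :: real assume "e > 0"
    have "(\<lambda>n. 4 * (1/2::real)^n) \<longlonglongrightarrow> 0" by (intro tendsto_mult_right_zero LIMSEQ_power_zero) simp
    from small_tails[OF less_imp_le[OF close] this norm_minus_commute \<open>e > 0\<close>]
    show "\<exists>N. \<forall>m\<ge>N. \<forall>n\<ge>N. norm (u m - u n) < e" .
  qed
  then obtain v where v: "u \<longlonglongrightarrow> v" using Cauchy_convergent convergentD by blast
  have "(\<lambda>n. f (u n)) \<longlonglongrightarrow> f v" by (rule f.tendsto[OF v])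
  then have fv: "f v = 1" using uS by (simp add: S_def LIMSEQ_const_iff)
  have "(\<lambda>n. (norm (u n))\<^sup>2) \<longlonglongrightarrow> (norm v)\<^sup>2" by (intro tendsto_intros v)
  moreover have "(\<lambda>n. d + (1/2)^n) \<longlonglongrightarrow> d + 0"
    by (intro tendsto_intros LIMSEQ_power_zero) auto
  ultimately have vd: "(norm v)\<^sup>2 \<le> d" using ud
    by (metis (no_types, lifting) LIMSEQ_le add_0_right less_imp_le)
  \<comment> \<open>Moving along the kernel stays in \<open>S\<close>, so minimality of v makes a
    quadratic with constant term 0 nonnegative; its discriminant forces orthogonality.\<close>
  have orth: "cinner h v = 0" if "f h = 0" for h
  proof -
    have "(cmod (cinner h v))\<^sup>2 \<le> 0 * (norm h)\<^sup>2"
    proof (rule complex_discriminant)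
      fix l
      have "v + l *\<^sub>C h \<in> S" using fv that by (simp add: S_def f.add fc)
      then have "(norm v)\<^sup>2 \<le> (norm (v + l *\<^sub>C h))\<^sup>2" using d_le[of "v + l *\<^sub>C h"] vd by linarith
      then show "0 + 2 * Re (l * cinner h v) + (cmod l)\<^sup>2 * (norm h)\<^sup>2 \<ge> 0"
        by (simp add: norm_add_scaleC_square)
    qed simp
    then show ?thesis by simp
  qed
  have "v \<noteq> 0" using fv f.zero by auto
  show ?thesis
  proof (rule that[of "(1 / of_real ((norm v)\<^sup>2)) *\<^sub>C v"])
    fix x
    have "f (x - f x *\<^sub>C v) = 0" by (simp add: f.diff fc fv)
    from orth[OF this] have "cinner x v = f x * of_real ((norm v)\<^sup>2)"
      by (simp add: cinner_simps cinner_self)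
    then show "f x = cinner x ((1 / of_real ((norm v)\<^sup>2)) *\<^sub>C v)"
      using \<open>v \<noteq> 0\<close> by (simp add: cinner_simps)
  qed
qed

section \<open>Adjoints\<close>

lemma comp_assoc: "(R o\<^sub>L S) o\<^sub>L T = R o\<^sub>L (S o\<^sub>L T)"
  by (rule blinfun_eqI) simp

lemma bop_scaleC: "T \<in> bounded_operators \<Longrightarrow> T (c *\<^sub>C x) = c *\<^sub>C T x"
  by (simp add: bounded_operators_def)

lemma scale_operator_apply [simp]: "(c *\<^sub>O T) x = c *\<^sub>C T x"
  by transfer simp

lemma scaleR_scale_operator: "r *\<^sub>R T = complex_of_real r *\<^sub>O T"
  by (rule blinfun_eqI) (simp add: scaleR_blinfun.rep_eq scaleC_of_real)

lemmas op_simps = blinfun.bilinear_simps blinfun_apply_blinfun_compose id_blinfun.rep_eq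

lemma scaleC_diff_right: "c *\<^sub>C (x - y) = c *\<^sub>C x - c *\<^sub>C (y::'h::complex_hilbert)"
  by (metis add_diff_cancel_left' diff_add_cancel scaleC_add_right add.commute)

lemma scaleC_zero_right [simp]: "c *\<^sub>C (0::'h::complex_hilbert) = 0"
  using scaleC_add_right[of c 0 0] by simp

lemma scaleC_minus_right: "c *\<^sub>C (- x) = - (c *\<^sub>C (x::'h::complex_hilbert))"
  using scaleC_diff_right[of c 0 x] by simp

lemma scaleC_zero_left [simp]: "0 *\<^sub>C (x::'h::complex_hilbert) = 0"
  using scaleC_of_real[of 0 x] by simp

lemma scaleC_one [simp]: "1 *\<^sub>C (x::'h::complex_hilbert) = x"
  using scaleC_of_real[of 1 x] by simp

lemma scaleC_minus_left: "(- c) *\<^sub>C (x::'h::complex_hilbert) = - (c *\<^sub>C x)"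
  using scaleC_add_left[of c "- c" x] by (simp add: add_eq_0_iff)

lemma bop_zero [simp, intro]: "0 \<in> bounded_operators"
  by (simp add: bounded_operators_def)

lemma bop_add [simp, intro]: "S \<in> bounded_operators \<Longrightarrow> T \<in> bounded_operators \<Longrightarrow> S + T \<in> bounded_operators"
  by (simp add: bounded_operators_def op_simps scaleC_add_right)

lemma bop_minus [simp, intro]: "T \<in> bounded_operators \<Longrightarrow> - T \<in> bounded_operators"
  by (simp add: bounded_operators_def op_simps scaleC_minus_right)

lemma bop_diff [simp, intro]: "S \<in> bounded_operators \<Longrightarrow> T \<in> bounded_operators \<Longrightarrow> S - T \<in> bounded_operators"
  by (simp add: bounded_operators_def op_simps scaleC_diff_right)

lemma bop_comp [simp, intro]: "S \<in> bounded_operators \<Longrightarrow> T \<in> bounded_operators \<Longrightarrow> S o\<^sub>L T \<in> bounded_operators"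
  by (simp add: bounded_operators_def op_simps)

lemma bop_id [simp, intro]: "id_blinfun \<in> bounded_operators"
  by (simp add: bounded_operators_def op_simps)

lemma bop_scale [simp, intro]: "T \<in> bounded_operators \<Longrightarrow> c *\<^sub>O T \<in> bounded_operators"
  by (simp add: bounded_operators_def scaleC_scaleC mult.commute)

lemma bop_scaleR [simp, intro]: "T \<in> bounded_operators \<Longrightarrow> r *\<^sub>R T \<in> bounded_operators"
  by (simp add: scaleR_scale_operator)

lemma adj_eqI:
  fixes S T :: "'h::complex_hilbert operator"
  assumes "\<And>x y. cinner (T x) y = cinner x (S y)"
  shows "adj T = S"
  unfolding adj_def
proof (rule the_equality)
  show "\<forall>x y. cinner (T x) y = cinner x (S y)" using assms by simp
  fix R :: "'h operator"
  assume "\<forall>x y. cinner (T x) y = cinner x (R y)"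
  then show "R = S" using assms by (intro blinfun_eqI) (rule cinner_left_eqI, metis)
qed

text \<open>\<open>adj\<close> is a definite description, so every fact about it rests on this
  existence. Riesz gives the value at each y, and nondegeneracy of the inner product makes these
  values linear in y.\<close>

lemma adjoint_exists:
  assumes T: "T \<in> bounded_operators"
  obtains S where "S \<in> bounded_operators" "\<And>x y. cinner (T x) y = cinner x (S y)"
proof -
  have "\<exists>u. \<forall>x. cinner (T x) y = cinner x u" for y
  proof -
    have "bounded_linear (\<lambda>x. cinner (T x) y)"
      by (rule bounded_linear_compose[OF cinner.bounded_linear_left blinfun.bounded_linear_right])
    moreover have "cinner (T (c *\<^sub>C x)) y = c * cinner (T x) y" for c x
      by (simp add: bop_scaleC[OF T] cinner_simps)
    ultimately obtain u where "\<And>x. cinner (T x) y = cinner x u"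
      by (rule riesz_representation) blast
    then show ?thesis by blast
  qed
  then obtain s where s: "\<And>x y. cinner (T x) y = cinner x (s y)" by metis
  have bl: "bounded_linear s"
  proof (rule bounded_linear_intro[where K = "norm T"])
    show "s (x + y) = s x + s y" for x y
      by (rule cinner_left_eqI) (simp add: cinner_simps flip: s)
    show "s (r *\<^sub>R x) = r *\<^sub>R s x" for r x
      by (rule cinner_left_eqI) (simp add: cinner_simps flip: s)
    show "norm (s x) \<le> norm x * norm T" for x
    proof -
      have "(norm (s x))\<^sup>2 = cmod (cinner (T (s x)) x)"
        by (simp add: s cinner_self norm_power)
      also have "\<dots> \<le> norm (T (s x)) * norm x" by (rule cmod_cinner_le)
      also have "\<dots> \<le> norm T * norm (s x) * norm x"
        by (intro mult_right_mono norm_blinfun) simp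
      finally have "(norm (s x))\<^sup>2 \<le> (norm x * norm T) * norm (s x)" by (simp add: mult_ac)
      then show ?thesis by (rule square_le_mult_imp_le) simp
    qed
  qed
  have "s (c *\<^sub>C x) = c *\<^sub>C s x" for c x
    by (rule cinner_left_eqI) (simp add: cinner_simps flip: s)
  then have "Blinfun s \<in> bounded_operators"
    by (simp add: bounded_operators_def bounded_linear_Blinfun_apply[OF bl])
  with that[of "Blinfun s"] show ?thesis
    by (simp add: bounded_linear_Blinfun_apply[OF bl] s)
qed

lemma cinner_adj: "T \<in> bounded_operators \<Longrightarrow> cinner (T x) y = cinner x (adj T y)"
  by (metis adjoint_exists adj_eqI)

lemma bop_adj [simp, intro]: "T \<in> bounded_operators \<Longrightarrow> adj T \<in> bounded_operators"
  by (metis adjoint_exists adj_eqI)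

lemma cinner_adj': "T \<in> bounded_operators \<Longrightarrow> cinner (adj T x) y = cinner x (T y)"
  by (metis cinner_adj cinner_commute)

lemma adj_adj: "T \<in> bounded_operators \<Longrightarrow> adj (adj T) = T"
  by (rule adj_eqI) (simp add: cinner_adj')

lemma adj_comp: "S \<in> bounded_operators \<Longrightarrow> T \<in> bounded_operators \<Longrightarrow> adj (S o\<^sub>L T) = adj T o\<^sub>L adj S"
  by (rule adj_eqI) (simp add: op_simps cinner_adj)

lemma adj_add: "S \<in> bounded_operators \<Longrightarrow> T \<in> bounded_operators \<Longrightarrow> adj (S + T) = adj S + adj T"
  by (rule adj_eqI) (simp add: op_simps cinner_simps cinner_adj)

lemma adj_diff: "S \<in> bounded_operators \<Longrightarrow> T \<in> bounded_operators \<Longrightarrow> adj (S - T) = adj S - adj T"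
  by (rule adj_eqI) (simp add: op_simps cinner_simps cinner_adj)

lemma adj_scale: "T \<in> bounded_operators \<Longrightarrow> adj (c *\<^sub>O T) = cnj c *\<^sub>O adj T"
  by (rule adj_eqI) (simp add: cinner_simps cinner_adj)

lemma adj_scaleR: "T \<in> bounded_operators \<Longrightarrow> adj (r *\<^sub>R T) = r *\<^sub>R adj T"
  by (simp add: scaleR_scale_operator adj_scale)

lemma adj_id [simp]: "adj id_blinfun = id_blinfun"
  by (rule adj_eqI) (simp add: op_simps)

lemma adj_zero [simp]: "adj 0 = 0"
  by (rule adj_eqI) (simp add: cinner_simps)

lemma norm_adj_le: assumes "T \<in> bounded_operators" shows "norm (adj T) \<le> norm T"
proof (rule norm_blinfun_bound)
  fix x
  have "(norm (adj T x))\<^sup>2 = cmod (cinner (T (adj T x)) x)"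
    by (simp add: cinner_adj[OF assms] cinner_self norm_power)
  also have "\<dots> \<le> norm (T (adj T x)) * norm x" by (rule cmod_cinner_le)
  also have "\<dots> \<le> norm T * norm (adj T x) * norm x"
    by (intro mult_right_mono norm_blinfun) simp
  finally have "(norm (adj T x))\<^sup>2 \<le> (norm T * norm x) * norm (adj T x)" by (simp add: mult_ac)
  then show "norm (adj T x) \<le> norm T * norm x" by (rule square_le_mult_imp_le) simp
qed simp

section \<open>Positive operators\<close>

text \<open>Polarization: the form at x + y gives the imaginary part of the symmetry identity, the
  form at x + i y its real part.\<close>

lemma selfadjoint_if_real_form:
  assumes T: "T \<in> bounded_operators" and r: "\<And>x. Im (cinner (T x) x) = 0"
  shows "adj T = T"
proof (rule adj_eqI)
  fix x y
  have 1: "Im (cinner (T x) y) + Im (cinner (T y) x) = 0"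
    using r[of "x + y"] r[of x] r[of y] by (simp add: op_simps cinner_simps)
  have 2: "Re (cinner (T y) x) - Re (cinner (T x) y) = 0"
    using r[of "x + \<i> *\<^sub>C y"] r[of x] r[of y]
    by (simp add: op_simps cinner_simps bop_scaleC[OF T])
  have "cinner (T x) y = cnj (cinner (T y) x)"
    using 1 2 by (simp add: complex_eq_iff)
  then show "cinner (T x) y = cinner x (T y)" by (metis cinner_commute)
qed

text \<open>On self-adjoint operators \<open>\<le>\<^sub>O\<close> is the pointwise order of these
  real forms (\<open>le_iff\<close>), which reduces most operator inequalities below to real
  ones.\<close>

definition qform :: "'h::complex_hilbert operator \<Rightarrow> 'h \<Rightarrow> real"
  where "qform T x = Re (cinner (T x) x)"

lemma qform_simps: "qform (S + T) x = qform S x + qform T x" "qform (S - T) x = qform S x - qform T x"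
  "qform (r *\<^sub>R T) x = r * qform T x" "qform (- T) x = - qform T x" "qform 0 x = 0"
  "qform id_blinfun x = (norm x)\<^sup>2"
  by (simp_all add: qform_def op_simps cinner_simps Re_cinner_self)

definition selfadj :: "'h::complex_hilbert operator \<Rightarrow> bool"
  where "selfadj T \<longleftrightarrow> T \<in> bounded_operators \<and> adj T = T"

lemma selfadj_bop: "selfadj T \<Longrightarrow> T \<in> bounded_operators"
  by (simp add: selfadj_def)

lemma selfadj_cinner: "selfadj T \<Longrightarrow> cinner (T x) y = cinner x (T y)"
  by (metis selfadj_def cinner_adj)

lemma selfadj_intros [simp, intro]: "selfadj 0" "selfadj id_blinfun" "selfadj S \<Longrightarrow> selfadj T \<Longrightarrow> selfadj (S + T)"
  "selfadj S \<Longrightarrow> selfadj T \<Longrightarrow> selfadj (S - T)" "selfadj T \<Longrightarrow> selfadj (r *\<^sub>R T)"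
  "selfadj S \<Longrightarrow> T \<in> bounded_operators \<Longrightarrow> selfadj (adj T o\<^sub>L S o\<^sub>L T)"
  by (auto simp: selfadj_def adj_add adj_diff adj_scaleR adj_comp adj_adj comp_assoc)

lemma selfadj_comp: "selfadj S \<Longrightarrow> selfadj T \<Longrightarrow> S o\<^sub>L T = T o\<^sub>L S \<Longrightarrow> selfadj (S o\<^sub>L T)"
  by (simp add: selfadj_def adj_comp)

lemma selfadj_adj_comp: "T \<in> bounded_operators \<Longrightarrow> selfadj (adj T o\<^sub>L T)"
  by (simp add: selfadj_def adj_comp adj_adj)

lemma selfadj_Im: assumes "selfadj T" shows "Im (cinner (T x) x) = 0"
proof -
  have "cinner (T x) x = cnj (cinner (T x) x)" by (metis assms selfadj_cinner cinner_commute)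
  then show ?thesis by (metis cnj.simps(2) equal_neg_zero)
qed

lemma selfadj_sandwich: "selfadj S \<Longrightarrow> selfadj T \<Longrightarrow> selfadj (S o\<^sub>L T o\<^sub>L S)"
  using selfadj_intros(6)[of T S] by (simp add: selfadj_def)

lemma positive_iff: "positive_operator T \<longleftrightarrow> selfadj T \<and> (\<forall>x. qform T x \<ge> 0)"
proof
  assume p: "positive_operator T"
  then have b: "T \<in> bounded_operators" and n: "\<And>x. cinner (T x) x \<in> \<real>\<^sub>\<ge>\<^sub>0"
    by (auto simp: positive_operator_def)
  have "adj T = T" by (rule selfadjoint_if_real_form[OF b]) (use n in \<open>auto simp: complex_nonneg_Reals_iff\<close>)
  with b n show "selfadj T \<and> (\<forall>x. qform T x \<ge> 0)"
    by (auto simp: selfadj_def qform_def complex_nonneg_Reals_iff)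
next
  assume "selfadj T \<and> (\<forall>x. qform T x \<ge> 0)"
  then show "positive_operator T"
    by (auto simp: positive_operator_def selfadj_bop complex_nonneg_Reals_iff selfadj_Im qform_def)
qed

lemma positive_sa: "positive_operator T \<Longrightarrow> selfadj T"
  by (simp add: positive_iff)

lemma positive_qform: "positive_operator T \<Longrightarrow> qform T x \<ge> 0"
  by (simp add: positive_iff)

lemma le_iff: "selfadj S \<Longrightarrow> selfadj T \<Longrightarrow> S \<le>\<^sub>O T \<longleftrightarrow> (\<forall>x. qform S x \<le> qform T x)"
  by (simp add: le_operator_def positive_iff qform_simps)

lemma le_trans_op: "R \<le>\<^sub>O S \<Longrightarrow> S \<le>\<^sub>O T \<Longrightarrow> R \<le>\<^sub>O T"
proof -
  assume "R \<le>\<^sub>O S" "S \<le>\<^sub>O T"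
  moreover have "T - R = (T - S) + (S - R)" by simp
  ultimately show ?thesis
    unfolding le_operator_def positive_iff by (metis qform_simps(1) add_nonneg_nonneg selfadj_intros(3))
qed

lemma positive_intros:
  "positive_operator 0" "positive_operator id_blinfun"
  "positive_operator S \<Longrightarrow> positive_operator T \<Longrightarrow> positive_operator (S + T)"
  "r \<ge> 0 \<Longrightarrow> positive_operator T \<Longrightarrow> positive_operator (r *\<^sub>R T)"
  by (auto simp: positive_iff qform_simps)

lemma qform_adj_comp: "T \<in> bounded_operators \<Longrightarrow> qform (adj T o\<^sub>L T) x = (norm (T x))\<^sup>2"
  by (simp add: qform_def op_simps cinner_adj' Re_cinner_self)

lemma positive_adj_comp: "T \<in> bounded_operators \<Longrightarrow> positive_operator (adj T o\<^sub>L T)"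
  by (simp add: positive_iff selfadj_adj_comp qform_adj_comp)

lemma qform_sandwich: "selfadj S \<Longrightarrow> qform (S o\<^sub>L T o\<^sub>L S) x = qform T (S x)"
  by (simp add: qform_def op_simps selfadj_cinner)

lemma positive_sandwich: "selfadj S \<Longrightarrow> positive_operator T \<Longrightarrow> positive_operator (S o\<^sub>L T o\<^sub>L S)"
  by (auto simp: positive_iff qform_sandwich selfadj_sandwich)

lemma positive_square: "selfadj S \<Longrightarrow> positive_operator (S o\<^sub>L S)"
  using positive_adj_comp[of S] by (simp add: selfadj_def)

lemma abs_qform_le: "\<bar>qform T x\<bar> \<le> norm T * (norm x)\<^sup>2"
proof -
  have "\<bar>qform T x\<bar> \<le> cmod (cinner (T x) x)" unfolding qform_def by (rule abs_Re_le_cmod)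
  also have "\<dots> \<le> norm (T x) * norm x" by (rule cmod_cinner_le)
  also have "\<dots> \<le> norm T * norm x * norm x" by (intro mult_right_mono norm_blinfun) simp
  finally show ?thesis by (simp add: power2_eq_square mult_ac)
qed

lemma positive_cauchy_schwarz:
  assumes "positive_operator T"
  shows "(cmod (cinner (T x) y))\<^sup>2 \<le> qform T x * qform T y"
proof -
  have s: "selfadj T" and b: "T \<in> bounded_operators" using assms by (auto intro: positive_sa selfadj_bop)
  have "(cmod (cinner (T y) x))\<^sup>2 \<le> qform T x * qform T y"
  proof (rule complex_discriminant)
    fix l
    have "cinner (T x) (l *\<^sub>C y) = cnj (l * cinner (T y) x)"
      by (metis b bop_scaleC cinner_commute cinner_scaleC_left s selfadj_cinner)
    moreover have "cinner (T (l *\<^sub>C y)) (l *\<^sub>C y) = of_real ((cmod l)\<^sup>2) * cinner (T y) y"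
      by (simp add: bop_scaleC[OF b] cinner_simps complex_norm_square mult_ac del: of_real_power)
    ultimately have "cinner (T (x + l *\<^sub>C y)) (x + l *\<^sub>C y) =
        cinner (T x) x + (cnj (l * cinner (T y) x) + l * cinner (T y) x) + of_real ((cmod l)\<^sup>2) * cinner (T y) y"
      by (simp add: op_simps cinner_add_left cinner_add_right bop_scaleC[OF b] cinner_scaleC_left
          del: of_real_power)
    then have "qform T (x + l *\<^sub>C y) = qform T x + 2 * Re (l * cinner (T y) x) + (cmod l)\<^sup>2 * qform T y"
      unfolding qform_def by (simp del: of_real_power)
    then show "0 \<le> qform T x + 2 * Re (l * cinner (T y) x) + (cmod l)\<^sup>2 * qform T y"
      using positive_qform[OF assms, of "x + l *\<^sub>C y"] by simp
  qed (rule positive_qform[OF assms])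
  then show ?thesis by (metis s selfadj_cinner cinner_commute complex_mod_cnj)
qed

text \<open>In operator terms T^2 <= r T. It is Cauchy-Schwarz for the form of T at x and T x, and
  it spares square roots of operators.\<close>

lemma positive_norm_square_le:
  assumes T: "positive_operator T" and r: "\<And>y. qform T y \<le> r * (norm y)\<^sup>2"
  shows "(norm (T x))\<^sup>2 \<le> r * qform T x"
proof (cases "T x = 0")
  case True
  then have "qform T x = 0" by (simp add: qform_def cinner_simps)
  then show ?thesis using True by simp
next
  case False
  have "cmod (cinner (T x) (T x)) = (norm (T x))\<^sup>2" by (simp add: cinner_self norm_power)
  then have "((norm (T x))\<^sup>2)\<^sup>2 \<le> qform T x * qform T (T x)"
    using positive_cauchy_schwarz[OF T, of x "T x"] by simp
  also have "\<dots> \<le> qform T x * (r * (norm (T x))\<^sup>2)"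
    by (intro mult_left_mono r positive_qform[OF T])
  finally have "(norm (T x))\<^sup>2 * (norm (T x))\<^sup>2 \<le> (r * qform T x) * (norm (T x))\<^sup>2"
    by (simp add: power2_eq_square mult_ac)
  moreover have "0 < (norm (T x))\<^sup>2" using False by simp
  ultimately show ?thesis by (rule mult_right_le_imp_le)
qed

lemma norm_le_of_qform:
  assumes T: "positive_operator T" and r: "\<And>y. qform T y \<le> r * (norm y)\<^sup>2" "r \<ge> 0"
  shows "norm T \<le> r"
proof (rule norm_blinfun_bound)
  fix x
  have "(norm (T x))\<^sup>2 \<le> r * qform T x" by (rule positive_norm_square_le[OF T r(1)])
  also have "\<dots> \<le> r * (r * (norm x)\<^sup>2)" by (intro mult_left_mono r)
  also have "\<dots> = (r * norm x)\<^sup>2" by (simp add: power2_eq_square mult_ac)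
  finally show "norm (T x) \<le> r * norm x"
    using r(2) by (meson mult_nonneg_nonneg norm_ge_zero power2_le_imp_le)
qed (use r in simp)

lemma selfadj_qform_eqI: "selfadj S \<Longrightarrow> selfadj T \<Longrightarrow> (\<And>x. qform S x = qform T x) \<Longrightarrow> S = T"
proof -
  assume s: "selfadj S" "selfadj T" and q: "\<And>x. qform S x = qform T x"
  have "positive_operator (S - T)" using s q by (simp add: positive_iff qform_simps)
  then have "norm (S - T) \<le> 0" by (rule norm_le_of_qform) (simp_all add: qform_simps q)
  then show "S = T" by simp
qed

section \<open>Strong limits\<close>

definition strong_tendsto :: "(nat \<Rightarrow> 'h::complex_hilbert operator) \<Rightarrow> 'h operator \<Rightarrow> bool"
  where "strong_tendsto X T \<longleftrightarrow> (\<forall>x. (\<lambda>n. X n x) \<longlonglongrightarrow> T x)"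

lemma strong_tendstoD: "strong_tendsto X T \<Longrightarrow> (\<lambda>n. X n x) \<longlonglongrightarrow> T x"
  by (simp add: strong_tendsto_def)

lemma strong_tendsto_unique: "strong_tendsto X S \<Longrightarrow> strong_tendsto X T \<Longrightarrow> S = T"
  unfolding strong_tendsto_def by (blast intro: blinfun_eqI LIMSEQ_unique)

lemma strong_limit_exists:
  fixes X :: "nat \<Rightarrow> 'h::complex_hilbert operator"
  assumes R: "\<And>n. norm (X n) \<le> R" and C: "\<And>x. Cauchy (\<lambda>n. X n x)"
  obtains T where "strong_tendsto X T"
proof -
  define f where "f x = lim (\<lambda>n. X n x)" for x
  have f: "(\<lambda>n. X n x) \<longlonglongrightarrow> f x" for x
    unfolding f_def using C Cauchy_convergent convergent_LIMSEQ_iff by blast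
  have "bounded_linear f"
  proof (rule bounded_linear_intro[where K = R])
    show "f (x + y) = f x + f y" for x y
      using LIMSEQ_unique[OF f[of "x + y"]] tendsto_add[OF f[of x] f[of y]]
      by (simp add: op_simps)
    show "f (r *\<^sub>R x) = r *\<^sub>R f x" for r x
      using LIMSEQ_unique[OF f[of "r *\<^sub>R x"]] tendsto_scaleR[OF tendsto_const[of r] f[of x]]
      by (simp add: op_simps)
    show "norm (f x) \<le> norm x * R" for x
    proof (rule LIMSEQ_le_const2[OF tendsto_norm[OF f[of x]]])
      have "norm (X n x) \<le> norm x * R" for n
        using norm_blinfun[of "X n" x] mult_right_mono[OF R[of n] norm_ge_zero[of x]]
        by (simp add: mult.commute)
      then show "\<exists>N. \<forall>n\<ge>N. norm (X n x) \<le> norm x * R" by blast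
    qed
  qed
  then have "strong_tendsto X (Blinfun f)"
    by (simp add: strong_tendsto_def bounded_linear_Blinfun_apply f)
  then show ?thesis by (rule that)
qed

lemma tendsto_scaleC: "(f \<longlongrightarrow> (x::'h::complex_hilbert)) F \<Longrightarrow> ((\<lambda>n. c *\<^sub>C f n) \<longlongrightarrow> c *\<^sub>C x) F"
proof -
  have "bounded_linear (\<lambda>x::'h. c *\<^sub>C x)"
    by (rule bounded_linear_intro[where K = "cmod c"])
      (simp_all add: scaleC_add_right scaleR_scaleC scaleC_scaleC norm_scaleC mult.commute)
  then show "(f \<longlongrightarrow> x) F \<Longrightarrow> ((\<lambda>n. c *\<^sub>C f n) \<longlongrightarrow> c *\<^sub>C x) F"
    by (rule bounded_linear.tendsto)
qed

lemma strong_tendsto_bop: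
  assumes X: "strong_tendsto X T" and b: "\<And>n. X n \<in> bounded_operators"
  shows "T \<in> bounded_operators"
proof -
  have "T (c *\<^sub>C x) = c *\<^sub>C T x" for c x
    using LIMSEQ_unique[OF strong_tendstoD[OF X, of "c *\<^sub>C x"]]
      tendsto_scaleC[OF strong_tendstoD[OF X, of x], of c] by (simp add: bop_scaleC[OF b])
  then show ?thesis by (simp add: bounded_operators_def)
qed

lemma strong_tendsto_const: "strong_tendsto (\<lambda>_. T) T"
  by (simp add: strong_tendsto_def)

lemma strong_tendsto_add: "strong_tendsto X S \<Longrightarrow> strong_tendsto Y T \<Longrightarrow> strong_tendsto (\<lambda>n. X n + Y n) (S + T)"
  by (auto simp: strong_tendsto_def op_simps intro: tendsto_add)

lemma strong_tendsto_diff: "strong_tendsto X S \<Longrightarrow> strong_tendsto Y T \<Longrightarrow> strong_tendsto (\<lambda>n. X n - Y n) (S - T)"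
  by (auto simp: strong_tendsto_def op_simps intro: tendsto_diff)

lemma strong_tendsto_Suc: "strong_tendsto X S \<Longrightarrow> strong_tendsto (\<lambda>n. X (Suc n)) S"
  unfolding strong_tendsto_def using LIMSEQ_Suc by blast

lemma strong_tendsto_comp_left: "strong_tendsto X S \<Longrightarrow> strong_tendsto (\<lambda>n. A o\<^sub>L X n) (A o\<^sub>L S)"
  by (auto simp: strong_tendsto_def op_simps intro: blinfun.tendsto)

lemma strong_tendsto_comp_right: "strong_tendsto X S \<Longrightarrow> strong_tendsto (\<lambda>n. X n o\<^sub>L A) (S o\<^sub>L A)"
  by (auto simp: strong_tendsto_def op_simps)

text \<open>Multiplication is not jointly strongly continuous in general. The bound on the left
  factors controls X n applied to the error Y n x - T x.\<close>

lemma strong_tendsto_comp: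
  assumes X: "strong_tendsto X S" and Y: "strong_tendsto Y T" and R: "\<And>n. norm (X n) \<le> R"
  shows "strong_tendsto (\<lambda>n. X n o\<^sub>L Y n) (S o\<^sub>L T)"
  unfolding strong_tendsto_def
proof
  fix x
  have "(\<lambda>n. X n (Y n x - T x)) \<longlonglongrightarrow> 0"
  proof (rule tendsto_norm_zero_cancel, rule tendsto_sandwich[of "\<lambda>_. 0" _ _ "\<lambda>n. R * norm (Y n x - T x)"])
    show "\<forall>\<^sub>F n in sequentially. norm (X n (Y n x - T x)) \<le> R * norm (Y n x - T x)"
      by (intro always_eventually allI order.trans[OF norm_blinfun] mult_right_mono R) simp
    have "(\<lambda>n. norm (Y n x - T x)) \<longlonglongrightarrow> 0"
      using strong_tendstoD[OF Y] by (simp add: LIM_zero tendsto_norm_zero)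
    from tendsto_mult_right_zero[OF this] show "(\<lambda>n. R * norm (Y n x - T x)) \<longlonglongrightarrow> 0" by simp
  qed simp_all
  from tendsto_add[OF this strong_tendstoD[OF X, of "T x"]]
  show "(\<lambda>n. (X n o\<^sub>L Y n) x) \<longlonglongrightarrow> (S o\<^sub>L T) x" by (simp add: op_simps)
qed

lemma qform_tendsto: "strong_tendsto X S \<Longrightarrow> (\<lambda>n. qform (X n) x) \<longlonglongrightarrow> qform S x"
  unfolding qform_def by (intro tendsto_Re cinner.tendsto tendsto_const strong_tendstoD)

lemma strong_tendsto_sa:
  assumes X: "strong_tendsto X S" and s: "\<And>n. selfadj (X n)"
  shows "selfadj S"
proof -
  have "adj S = S"
  proof (rule adj_eqI)
    fix x y
    have "(\<lambda>n. cinner (X n x) y) \<longlonglongrightarrow> cinner (S x) y"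
      by (intro cinner.tendsto tendsto_const strong_tendstoD X)
    moreover have "(\<lambda>n. cinner (X n x) y) \<longlonglongrightarrow> cinner x (S y)"
      unfolding selfadj_cinner[OF s] by (intro cinner.tendsto tendsto_const strong_tendstoD X)
    ultimately show "cinner (S x) y = cinner x (S y)" by (rule LIMSEQ_unique)
  qed
  then show ?thesis using strong_tendsto_bop[OF X selfadj_bop[OF s]] by (simp add: selfadj_def)
qed

lemma strong_tendsto_positive:
  assumes X: "strong_tendsto X S" and s: "\<And>n. positive_operator (X n)"
  shows "positive_operator S"
  unfolding positive_iff
proof
  show "selfadj S" by (rule strong_tendsto_sa[OF X positive_sa[OF s]])
  show "\<forall>x. 0 \<le> qform S x"
    using LIMSEQ_le_const[OF qform_tendsto[OF X]] positive_qform[OF s] by blast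
qed

lemma strong_tendsto_le:
  assumes X: "strong_tendsto X S" and s: "\<And>n. X n \<le>\<^sub>O T"
  shows "S \<le>\<^sub>O T"
  using strong_tendsto_positive[OF strong_tendsto_diff[OF strong_tendsto_const X]] s
  by (simp add: le_operator_def)

lemma strong_tendsto_ge:
  assumes X: "strong_tendsto X S" and s: "\<And>n. T \<le>\<^sub>O X n"
  shows "T \<le>\<^sub>O S"
  using strong_tendsto_positive[OF strong_tendsto_diff[OF X strong_tendsto_const]] s
  by (simp add: le_operator_def)

text \<open>The real forms increase and are bounded, hence Cauchy;
  \<open>positive_norm_square_le\<close> with r = 1 for the differences upgrades this to norm
  convergence at each vector.\<close>

lemma monotone_strong_limit:
  assumes p: "\<And>n. positive_operator (X n)" and i: "\<And>n. X n \<le>\<^sub>O id_blinfun"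
    and mono: "\<And>n. X n \<le>\<^sub>O X (Suc n)"
  obtains T where "strong_tendsto X T" "\<And>n. X n \<le>\<^sub>O T"
proof -
  have selfadj: "selfadj (X n)" for n by (rule positive_sa[OF p])
  have i': "qform (X n) x \<le> (norm x)\<^sup>2" for n x
    using i[of n] by (simp add: le_iff selfadj qform_simps)
  have mono': "qform (X m) x \<le> qform (X n) x" if "m \<le> n" for m n x
    by (rule lift_Suc_mono_le[OF _ that]) (use mono in \<open>simp add: le_iff selfadj\<close>)
  have close: "(norm (X n x - X m x))\<^sup>2 \<le> qform (X n) x - qform (X m) x" if "m \<le> n" for m n x
  proof -
    have "positive_operator (X n - X m)" by (simp add: positive_iff selfadj qform_simps mono' that)
    moreover have "qform (X n - X m) y \<le> 1 * (norm y)\<^sup>2" for y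
      using i'[of n y] positive_qform[OF p, of m y] by (simp add: qform_simps)
    ultimately have "(norm ((X n - X m) x))\<^sup>2 \<le> 1 * qform (X n - X m) x"
      by (rule positive_norm_square_le)
    then show ?thesis by (simp add: op_simps qform_simps)
  qed
  have C: "Cauchy (\<lambda>n. X n x)" for x
  proof (rule metric_CauchyI)
    fix e :: real assume "e > 0"
    have "incseq (\<lambda>n. qform (X n) x)" by (rule incseq_SucI) (simp add: mono')
    then have "convergent (\<lambda>n. qform (X n) x)"
      by (metis i' incseq_convergent convergentI)
    then have "Cauchy (\<lambda>n. qform (X n) x)" by (rule convergent_Cauchy)
    then obtain N where N: "\<And>m n. m \<ge> N \<Longrightarrow> n \<ge> N \<Longrightarrow> dist (qform (X m) x) (qform (X n) x) < e\<^sup>2"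
      using \<open>e > 0\<close> by (metis metric_CauchyD zero_less_power)
    have *: "dist (X m x) (X n x) < e" if "N \<le> n" "n \<le> m" for m n
    proof -
      have "(norm (X m x - X n x))\<^sup>2 \<le> qform (X m) x - qform (X n) x" by (rule close) fact
      also have "\<dots> < e\<^sup>2" using N[of m n] that by (simp add: dist_real_def)
      finally show ?thesis using \<open>e > 0\<close> by (simp add: dist_norm power_less_imp_less_base)
    qed
    show "\<exists>N. \<forall>m\<ge>N. \<forall>n\<ge>N. dist (X m x) (X n x) < e"
      by (rule exI[of _ N]) (metis * dist_commute nle_le)
  qed
  have "norm (X n) \<le> 1" for n
    by (rule norm_le_of_qform[OF p]) (simp_all add: i')
  from strong_limit_exists[OF this C] obtain T where T: "strong_tendsto X T" by blast
  have "X n \<le>\<^sub>O T" for n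
  proof (rule strong_tendsto_ge)
    show "strong_tendsto (\<lambda>m. X (m + n)) T"
      unfolding strong_tendsto_def
      using LIMSEQ_ignore_initial_segment[OF strong_tendstoD[OF T], where k = n] by simp
    show "X n \<le>\<^sub>O X (m + n)" for m by (simp add: le_iff selfadj mono')
  qed
  with T show ?thesis by (rule that)
qed

section \<open>Algebras of operators\<close>

lemma algD:
  assumes "selfadjoint_subalgebra M"
  shows "S \<in> M \<Longrightarrow> S \<in> bounded_operators" "0 \<in> M" "S \<in> M \<Longrightarrow> T \<in> M \<Longrightarrow> S + T \<in> M"
    "S \<in> M \<Longrightarrow> T \<in> M \<Longrightarrow> S o\<^sub>L T \<in> M" "T \<in> M \<Longrightarrow> c *\<^sub>O T \<in> M" "T \<in> M \<Longrightarrow> adj T \<in> M"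
    "T \<in> M \<Longrightarrow> r *\<^sub>R T \<in> M" "S \<in> M \<Longrightarrow> T \<in> M \<Longrightarrow> S - T \<in> M" "T \<in> M \<Longrightarrow> - T \<in> M"
proof -
  have neg: "- T \<in> M" if "T \<in> M" for T
  proof -
    have "- T = (- 1) *\<^sub>O T" by (rule blinfun_eqI) (simp add: op_simps scaleC_minus_left)
    then show ?thesis using assms that by (simp add: selfadjoint_subalgebra_def)
  qed
  then show "T \<in> M \<Longrightarrow> - T \<in> M" .
  show "S \<in> M \<Longrightarrow> T \<in> M \<Longrightarrow> S - T \<in> M"
    using assms neg[of T] unfolding selfadjoint_subalgebra_def by (metis diff_conv_add_uminus)
qed (use assms in \<open>auto simp: selfadjoint_subalgebra_def scaleR_scale_operator\<close>)

lemma alg_sum: "selfadjoint_subalgebra M \<Longrightarrow> (\<And>i. i \<in> I \<Longrightarrow> f i \<in> M) \<Longrightarrow> sum f I \<in> M"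
  by (induction I rule: infinite_finite_induct) (auto simp: algD)

lemma vnD: "von_neumann_algebra M \<Longrightarrow> selfadjoint_subalgebra M" "von_neumann_algebra M \<Longrightarrow> id_blinfun \<in> M"
  by (simp_all add: von_neumann_algebra_def)

lemma vn_strong_limit:
  assumes M: "von_neumann_algebra M" and X: "strong_tendsto X T" and XM: "\<And>n. X n \<in> M"
  shows "T \<in> M"
proof (rule ccontr)
  assume "T \<notin> M"
  moreover have "openin strong_operator_topology (UNIV - M)"
    using M by (auto simp: von_neumann_algebra_def closedin_def strong_operator_topology_topspace)
  then obtain V where V: "open V" "UNIV - M = blinfun_apply -` V"
    unfolding strong_operator_topology_def by (auto simp: openin_pullback_topology)
  ultimately have "blinfun_apply T \<in> V" by auto
  moreover have "limitin euclidean (\<lambda>n. blinfun_apply (X n)) (blinfun_apply T) sequentially"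
    unfolding euclidean_product_topology[symmetric] limitin_componentwise
    using X by (simp add: strong_tendsto_def)
  then have "(\<lambda>n. blinfun_apply (X n)) \<longlonglongrightarrow> blinfun_apply T" by simp
  ultimately have "\<forall>\<^sub>F n in sequentially. blinfun_apply (X n) \<in> V"
    using V(1) topological_tendstoD by blast
  then obtain n where "blinfun_apply (X n) \<in> V" using eventually_sequentially by auto
  then show False using V XM[of n] by auto
qed

lemma vn_closed:
  assumes M: "von_neumann_algebra M" shows "closed M"
  unfolding closed_sequential_limits
proof (intro allI impI)
  fix X T assume a: "(\<forall>n. X n \<in> M) \<and> X \<longlonglongrightarrow> T"
  then have "strong_tendsto X T"
    unfolding strong_tendsto_def by (auto intro!: blinfun.tendsto)
  with a show "T \<in> M" using vn_strong_limit[OF M] by blast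
qed

lemma bop_alg: "selfadjoint_subalgebra (bounded_operators :: 'h::complex_hilbert operator set)"
  by (auto simp: selfadjoint_subalgebra_def)

lemma bop_closed: "closed (bounded_operators :: 'h::complex_hilbert operator set)"
  unfolding closed_sequential_limits
proof (intro allI impI)
  fix X and T :: "'h operator" assume a: "(\<forall>n. X n \<in> bounded_operators) \<and> X \<longlonglongrightarrow> T"
  then have "strong_tendsto X T"
    unfolding strong_tendsto_def by (auto intro!: blinfun.tendsto)
  with a show "T \<in> bounded_operators" using strong_tendsto_bop by blast
qed

interpretation comp: bounded_bilinear "(o\<^sub>L) :: 'h::complex_hilbert operator \<Rightarrow> 'h operator \<Rightarrow> 'h operator"
  by (rule bounded_bilinear_blinfun_compose)

lemma comp_id_left [simp]: "id_blinfun o\<^sub>L T = T" and comp_id_right [simp]: "T o\<^sub>L id_blinfun = T"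
  by (auto intro!: blinfun_eqI)

lemmas comp_simps = comp.add_left comp.add_right comp.diff_left comp.diff_right comp.scaleR_left
  comp.scaleR_right comp.minus_left comp.minus_right comp.zero_left comp.zero_right

section \<open>Inverses\<close>

text \<open>Up to the factor 1/s the inverse is the fixed point of a = 1 + w a. Banach's theorem is
  applied inside the complete set \<open>N\<close>, so the inverse is found in \<open>N\<close>
  itself.\<close>

lemma inverse_in_algebra:
  fixes N :: "'h::complex_hilbert operator set"
  assumes N: "selfadjoint_subalgebra N" "id_blinfun \<in> N" "closed N"
    and y: "y \<in> N" "selfadj y" and r: "r > 0" "\<And>x. qform y x \<ge> r * (norm x)\<^sup>2"
  obtains c where "c \<in> N" "c o\<^sub>L y = id_blinfun" "y o\<^sub>L c = id_blinfun" "positive_operator c"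
    "\<And>x. r * (norm (c x))\<^sup>2 \<le> qform c x"
proof -
  \<comment> \<open>At this scale y / s lies between r / s and 1, so w is positive with norm at most
    1 - r / s < 1.\<close>
  define s where "s = norm y + r"
  have s: "s > 0" "r \<le> s" using r(1) by (auto simp: s_def add_nonneg_pos)
  define w where "w = id_blinfun - (1/s) *\<^sub>R y"
  have wN: "w \<in> N" using N y by (simp add: w_def algD)
  have q: "0 \<le> 1 - r / s" "1 - r / s < 1" using s r(1) by simp_all
  have "norm w \<le> 1 - r / s"
  proof (rule norm_le_of_qform)
    have "qform y x / s \<le> (norm x)\<^sup>2" for x
    proof -
      have "qform y x \<le> norm y * (norm x)\<^sup>2" using abs_qform_le[of y x] by simp
      also have "\<dots> \<le> s * (norm x)\<^sup>2" using r(1) by (intro mult_right_mono) (simp_all add: s_def)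
      finally show ?thesis using s by (simp add: field_simps)
    qed
    then show "positive_operator w" using y(2) by (simp add: w_def positive_iff qform_simps)
    show "qform w x \<le> (1 - r / s) * (norm x)\<^sup>2" for x
      using r(2)[of x] s by (simp add: w_def qform_simps field_simps)
  qed (rule q)
  then have "dist (id_blinfun + (w o\<^sub>L a)) (id_blinfun + (w o\<^sub>L b)) \<le> (1 - r / s) * dist a b" for a b
    using norm_blinfun_compose[of w "a - b"] mult_right_mono[OF _ norm_ge_zero[of "a - b"]]
    by (fastforce simp: dist_norm comp_simps)
  moreover have "(\<lambda>a. id_blinfun + (w o\<^sub>L a)) ` N \<subseteq> N" using N wN by (auto simp: algD)
  ultimately obtain a where a: "a \<in> N" "id_blinfun + (w o\<^sub>L a) = a"
    using Banach_fix[of N "1 - r / s" "\<lambda>a. id_blinfun + (w o\<^sub>L a)"] N q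
    by (auto simp: complete_eq_closed)
  define c where "c = (1/s) *\<^sub>R a"
  have cN: "c \<in> N" using N a by (simp add: c_def algD)
  have yc: "y o\<^sub>L c = id_blinfun"
    using a(2) by (simp add: c_def w_def comp_simps algebra_simps)
  \<comment> \<open>The fixed point only gives a right inverse; its adjoint is a left inverse, and
    the two must agree.\<close>
  have cy': "adj c o\<^sub>L y = id_blinfun"
    using arg_cong[OF yc, of adj] y(2) cN N by (simp add: adj_comp algD selfadj_def)
  then have "adj c = adj c o\<^sub>L (y o\<^sub>L c)" by (simp add: yc)
  also have "\<dots> = c" using cy' by (simp flip: comp_assoc)
  finally have sac: "selfadj c" "c o\<^sub>L y = id_blinfun" using cN N cy' by (auto simp: selfadj_def algD)
  have "qform c x = qform y (c x)" for x
    using selfadj_cinner[OF sac(1), of x x] arg_cong[OF yc, of "\<lambda>T. T x"] cinner_commute[of "c x" x]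
    by (simp add: qform_def op_simps selfadj_cinner[OF sac(1)])
  then have lower: "r * (norm (c x))\<^sup>2 \<le> qform c x" for x using r(2) by simp
  have "positive_operator c"
    using sac lower r(1) unfolding positive_iff
    by (meson less_imp_le mult_nonneg_nonneg order.trans zero_le_power2)
  with that cN sac yc lower show ?thesis by blast
qed

text \<open>The inverse of 1 + z, described among all operators and hence independent of the algebra
  in which it is computed. The bounded increasing function z / (1 + z) is then 1 -
  \<open>resolvent z\<close>.\<close>

definition resolvent :: "'h::complex_hilbert operator \<Rightarrow> 'h operator"
  where "resolvent z = (THE c. c o\<^sub>L (id_blinfun + z) = id_blinfun \<and> (id_blinfun + z) o\<^sub>L c = id_blinfun)"

lemma two_sided_inverse_unique:
  assumes "c o\<^sub>L y = id_blinfun" "y o\<^sub>L d = id_blinfun" shows "c = d"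
  by (metis assms comp_assoc comp_id_left comp_id_right)

lemma resolvent_in_algebra:
  fixes N :: "'h::complex_hilbert operator set"
  assumes N: "selfadjoint_subalgebra N" "id_blinfun \<in> N" "closed N"
    and z: "z \<in> N" "positive_operator z"
  shows "resolvent z \<in> N \<and> resolvent z o\<^sub>L (id_blinfun + z) = id_blinfun \<and>
    (id_blinfun + z) o\<^sub>L resolvent z = id_blinfun \<and> positive_operator (resolvent z) \<and>
    (\<forall>x. (norm (resolvent z x))\<^sup>2 \<le> qform (resolvent z) x)"
proof -
  have 1: "qform (id_blinfun + z) x \<ge> 1 * (norm x)\<^sup>2" for x
    using positive_qform[OF z(2)] by (simp add: qform_simps)
  have 2: "selfadj (id_blinfun + z)" using z(2) by (simp add: positive_sa)
  have 3: "id_blinfun + z \<in> N" using N z by (simp add: algD)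
  from inverse_in_algebra[OF N 3 2 zero_less_one 1] obtain c where c: "c \<in> N" "c o\<^sub>L (id_blinfun + z) = id_blinfun"
    "(id_blinfun + z) o\<^sub>L c = id_blinfun" "positive_operator c" "\<And>x. 1 * (norm (c x))\<^sup>2 \<le> qform c x"
    by blast
  have "resolvent z = c" unfolding resolvent_def
    by (rule the_equality) (use c two_sided_inverse_unique in blast)+
  with c show ?thesis by simp
qed

lemma resolvent:
  assumes z: "positive_operator z"
  shows "resolvent z o\<^sub>L (id_blinfun + z) = id_blinfun" "(id_blinfun + z) o\<^sub>L resolvent z = id_blinfun"
    "positive_operator (resolvent z)" "(norm (resolvent z x))\<^sup>2 \<le> qform (resolvent z) x"
    "resolvent z \<in> bounded_operators" "selfadj (resolvent z)"
  using resolvent_in_algebra[OF bop_alg bop_id bop_closed selfadj_bop[OF positive_sa[OF z]] z] positive_sa by blast+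

lemma resolvent_apply:
  assumes z: "positive_operator z"
  shows "resolvent z x + z (resolvent z x) = x"
  using arg_cong[OF resolvent(2)[OF z], of "\<lambda>T. T x"] by (simp add: op_simps)

lemma norm_resolvent_apply:
  assumes z: "positive_operator z" shows "norm (resolvent z x) \<le> norm x"
proof -
  have "(norm (resolvent z x))\<^sup>2 \<le> norm x * norm (resolvent z x)"
    using resolvent(4)[OF z, of x] cmod_cinner_le[of "resolvent z x" x]
      abs_Re_le_cmod[of "cinner (resolvent z x) x"] by (simp add: qform_def mult.commute)
  then show ?thesis by (rule square_le_mult_imp_le) simp
qed

lemma norm_resolvent: "positive_operator z \<Longrightarrow> norm (resolvent z) \<le> 1"
  by (rule norm_blinfun_bound) (auto simp: norm_resolvent_apply)

lemma resolvent_le_id: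
  assumes z: "positive_operator z" shows "resolvent z \<le>\<^sub>O id_blinfun"
proof -
  have "qform (resolvent z) x \<le> (norm x)\<^sup>2" for x
    using abs_qform_le[of "resolvent z" x] mult_right_mono[OF norm_resolvent[OF z] zero_le_power2[of "norm x"]]
    by simp
  then show ?thesis by (simp add: le_iff resolvent[OF z] qform_simps)
qed

text \<open>Cauchy-Schwarz for the form of 1 + z between the two solutions v of (1 + z) v = x and u
  of (1 + z') u = x. The inner product of x and u is the form of \<open>resolvent z'\<close>, which
  cancels once from both sides.\<close>

lemma resolvent_antimono:
  assumes z: "positive_operator z" "positive_operator z'" and le: "z \<le>\<^sub>O z'"
  shows "resolvent z' \<le>\<^sub>O resolvent z"
proof -
  have "qform (resolvent z') x \<le> qform (resolvent z) x" for x
  proof -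
    define u v where "u = resolvent z' x" and "v = resolvent z x"
    have Y: "positive_operator (id_blinfun + z)" using z by (intro positive_intros)
    have v: "(id_blinfun + z) v = x" and u: "(id_blinfun + z') u = x"
      using resolvent_apply[OF z(1), of x] resolvent_apply[OF z(2), of x] by (simp_all add: u_def v_def op_simps)
    have b: "qform (id_blinfun + z) v = qform (resolvent z) x"
      unfolding qform_def v using cinner_commute[of x v] by (simp add: v_def)
    have a: "qform (id_blinfun + z') u = qform (resolvent z') x"
      unfolding qform_def u using cinner_commute[of x u] by (simp add: u_def)
    have "qform (resolvent z') x \<ge> 0" "qform (resolvent z) x \<ge> 0"
      by (rule positive_qform[OF resolvent(3)[OF z(2)]]) (rule positive_qform[OF resolvent(3)[OF z(1)]])
    have "(cmod (cinner ((id_blinfun + z) v) u))\<^sup>2 \<le> qform (id_blinfun + z) v * qform (id_blinfun + z) u"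
      by (rule positive_cauchy_schwarz[OF Y])
    moreover have "cmod (cinner ((id_blinfun + z) v) u) \<ge> qform (resolvent z') x"
      unfolding v qform_def u_def
      by (metis complex_Re_le_cmod complex_mod_cnj cinner_commute)
    then have "(qform (resolvent z') x)\<^sup>2 \<le> (cmod (cinner ((id_blinfun + z) v) u))\<^sup>2"
      by (rule power_mono) fact
    moreover have "qform (id_blinfun + z) u \<le> qform (id_blinfun + z') u"
      using le z by (simp add: le_iff positive_sa qform_simps)
    then have "qform (id_blinfun + z) v * qform (id_blinfun + z) u \<le> qform (resolvent z) x * qform (resolvent z') x"
      unfolding a b by (rule mult_left_mono) fact
    ultimately have "(qform (resolvent z') x)\<^sup>2 \<le> qform (resolvent z) x * qform (resolvent z') x"
      by linarith
    then show ?thesis by (rule square_le_mult_imp_le) fact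
  qed
  then show ?thesis by (simp add: le_iff resolvent z)
qed

lemma resolvent_commute:
  assumes z: "positive_operator z" and c: "T o\<^sub>L z = z o\<^sub>L T"
  shows "T o\<^sub>L resolvent z = resolvent z o\<^sub>L T"
proof -
  have "resolvent z o\<^sub>L T = resolvent z o\<^sub>L (T o\<^sub>L ((id_blinfun + z) o\<^sub>L resolvent z))"
    by (simp add: resolvent[OF z])
  also have "\<dots> = resolvent z o\<^sub>L (((id_blinfun + z) o\<^sub>L T) o\<^sub>L resolvent z)"
    using c by (simp add: comp_simps flip: comp_assoc)
  also have "\<dots> = (resolvent z o\<^sub>L (id_blinfun + z)) o\<^sub>L (T o\<^sub>L resolvent z)" by (simp add: comp_assoc)
  finally show ?thesis by (simp add: resolvent[OF z])
qed

text \<open>The \<open>z n\<close> may grow without bound; their resolvents decrease between 0 and 1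
  and therefore always converge.\<close>

lemma resolvent_limit:
  assumes M: "von_neumann_algebra M" and zM: "\<And>n. z n \<in> M" and z: "\<And>n. positive_operator (z n)"
    and mono: "\<And>n. z n \<le>\<^sub>O z (Suc n)"
  obtains k where "k \<in> M" "strong_tendsto (\<lambda>n. resolvent (z n)) k" "positive_operator k"
    "\<And>n. k \<le>\<^sub>O resolvent (z n)" "k \<le>\<^sub>O id_blinfun"
proof -
  have rM: "resolvent (z n) \<in> M" for n
    using resolvent_in_algebra[OF vnD[OF M] vn_closed[OF M] zM z] by blast
  have X: "positive_operator (id_blinfun - resolvent (z n))" for n
    using resolvent_le_id[OF z] by (simp add: le_operator_def)
  have "id_blinfun - resolvent (z n) \<le>\<^sub>O id_blinfun" for n
    by (simp add: le_operator_def resolvent z)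
  moreover have "id_blinfun - resolvent (z n) \<le>\<^sub>O id_blinfun - resolvent (z (Suc n))" for n
    using resolvent_antimono[OF z z mono] by (simp add: le_operator_def)
  ultimately obtain T where T: "strong_tendsto (\<lambda>n. id_blinfun - resolvent (z n)) T"
    "\<And>n. id_blinfun - resolvent (z n) \<le>\<^sub>O T"
    using monotone_strong_limit[of "\<lambda>n. id_blinfun - resolvent (z n)", OF X] by blast
  define k where "k = id_blinfun - T"
  have k: "strong_tendsto (\<lambda>n. resolvent (z n)) k"
    using strong_tendsto_diff[OF strong_tendsto_const[of id_blinfun] T(1)] by (simp add: k_def)
  have 1: "k \<le>\<^sub>O resolvent (z n)" for n
    using T(2)[of n] by (simp add: le_operator_def k_def algebra_simps)
  from that[OF vn_strong_limit[OF M k rM] k strong_tendsto_positive[OF k resolvent(3)[OF z]] 1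
    le_trans_op[OF 1[of 0] resolvent_le_id[OF z]]]
  show ?thesis .
qed

section \<open>Spectral projections\<close>

lemma projD:
  assumes "is_projection P"
  shows "P \<in> bounded_operators" "P o\<^sub>L P = P" "selfadj P" "P (P x) = P x" "qform P x = (norm (P x))\<^sup>2" "positive_operator P"
proof -
  show 1: "P \<in> bounded_operators" "P o\<^sub>L P = P" "selfadj P" using assms by (auto simp: is_projection_def selfadj_def)
  show 2: "P (P x) = P x" for x using arg_cong[OF 1(2), of "\<lambda>T. T x"] by simp
  show 3: "qform P x = (norm (P x))\<^sup>2" for x using qform_sandwich[OF 1(3), of id_blinfun x] by (simp add: 1 qform_simps)
  show "positive_operator P" by (simp add: positive_iff 1 3)
qed

lemma is_projectionI: "selfadj P \<Longrightarrow> P o\<^sub>L P = P \<Longrightarrow> is_projection P"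
  by (auto simp: is_projection_def selfadj_def)

text \<open>P is the limit of the inverses of 1 + m k: in scalars, 1 / (1 + m t) tends to 1 at t = 0
  and to 0 for t > 0. The property about R expresses that P is the whole kernel projection.\<close>

lemma kernel_projection:
  fixes M :: "'h::complex_hilbert operator set"
  assumes M: "von_neumann_algebra M" and k: "k \<in> M" "positive_operator k"
  obtains P where "P \<in> M" "is_projection P" "k o\<^sub>L P = 0"
    "\<And>R :: 'h operator. R o\<^sub>L k = 0 \<Longrightarrow> R o\<^sub>L P = R"
    "\<And>T. T o\<^sub>L k = k o\<^sub>L T \<Longrightarrow> T o\<^sub>L P = P o\<^sub>L T"
proof -
  define z where "z m = real m *\<^sub>R k" for m
  have z: "positive_operator (z m)" for m using k by (simp add: z_def positive_intros)
  have zM: "z m \<in> M" for m using k M by (simp add: z_def algD vnD)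
  have zmono: "z m \<le>\<^sub>O z (Suc m)" for m
    using k(2) by (simp add: le_operator_def z_def algebra_simps)
  obtain P where P: "P \<in> M" "strong_tendsto (\<lambda>n. resolvent (z n)) P" "positive_operator P"
    by (rule resolvent_limit[where z = z, OF M zM z zmono])
  have kP: "k o\<^sub>L P = 0"
  proof (rule strong_tendsto_unique[OF strong_tendsto_comp_left[OF P(2), of k]])
    \<comment> \<open>From (1 + n k) u = x one gets n k u = x - u, whose norm is at most twice that
      of x.\<close>
    have bd: "norm (k (resolvent (z n) x)) \<le> 2 * norm x * inverse (real n)" if "n > 0" for n x
    proof -
      have "real n *\<^sub>R k (resolvent (z n) x) = x - resolvent (z n) x"
        using resolvent_apply[OF z, of n x] by (simp add: z_def op_simps algebra_simps)
      then have "real n * norm (k (resolvent (z n) x)) = norm (x - resolvent (z n) x)"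
        by (metis norm_scaleR abs_of_nat)
      also have "\<dots> \<le> norm x + norm x"
        using norm_triangle_ineq4[of x "resolvent (z n) x"] norm_resolvent_apply[OF z, of n x] by linarith
      finally show ?thesis using that by (simp add: field_simps)
    qed
    have "(\<lambda>n. k (resolvent (z n) x)) \<longlonglongrightarrow> 0" for x
    proof (rule Lim_null_comparison)
      show "\<forall>\<^sub>F n in sequentially. norm (k (resolvent (z n) x)) \<le> 2 * norm x * inverse (real n)"
        unfolding eventually_sequentially using bd by (intro exI[of _ 1]) auto
      show "(\<lambda>n. 2 * norm x * inverse (real n)) \<longlonglongrightarrow> 0"
        by (rule tendsto_mult_right_zero) (rule lim_inverse_n)
    qed
    then show "strong_tendsto (\<lambda>n. k o\<^sub>L resolvent (z n)) 0"
      by (simp add: strong_tendsto_def)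
  qed
  \<comment> \<open>Since k kills the range of P, every resolvent fixes P; in the limit P is
    idempotent.\<close>
  have "resolvent (z n) o\<^sub>L P = P" for n
  proof -
    have "(id_blinfun + z n) o\<^sub>L P = P" using kP by (simp add: z_def comp_simps)
    then have "resolvent (z n) o\<^sub>L P = (resolvent (z n) o\<^sub>L (id_blinfun + z n)) o\<^sub>L P"
      by (simp add: comp_assoc)
    then show ?thesis by (simp add: resolvent[OF z])
  qed
  then have "P o\<^sub>L P = P"
    using strong_tendsto_unique[OF strong_tendsto_comp_right[OF P(2), of P], of P] strong_tendsto_const[of P] by simp
  then have proj: "is_projection P" by (rule is_projectionI[OF positive_sa[OF P(3)]])
  have abs: "R o\<^sub>L P = R" if "R o\<^sub>L k = 0" for R :: "'h operator"
  proof -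
    have "R o\<^sub>L resolvent (z n) = R" for n
    proof -
      have "R o\<^sub>L (id_blinfun + z n) = R" using that by (simp add: z_def comp_simps)
      then have "R o\<^sub>L resolvent (z n) = R o\<^sub>L ((id_blinfun + z n) o\<^sub>L resolvent (z n))"
        by (simp flip: comp_assoc)
      then show ?thesis by (simp add: resolvent[OF z])
    qed
    then show ?thesis
      using strong_tendsto_unique[OF strong_tendsto_comp_left[OF P(2), of R]] strong_tendsto_const[of R] by simp
  qed
  have "T o\<^sub>L P = P o\<^sub>L T" if "T o\<^sub>L k = k o\<^sub>L T" for T
  proof (rule strong_tendsto_unique[OF strong_tendsto_comp_left[OF P(2), of T]])
    have "T o\<^sub>L resolvent (z n) = resolvent (z n) o\<^sub>L T" for n
      by (rule resolvent_commute[OF z]) (simp add: z_def comp_simps that)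
    then show "strong_tendsto (\<lambda>n. T o\<^sub>L resolvent (z n)) (P o\<^sub>L T)"
      using strong_tendsto_comp_right[OF P(2), of T] by simp
  qed
  with that P(1) proj kP abs show ?thesis by blast
qed

section \<open>Powers, geometric sums and spectral projections\<close>

primrec op_power :: "'h::complex_hilbert operator \<Rightarrow> nat \<Rightarrow> 'h operator"
  where "op_power S 0 = id_blinfun" | "op_power S (Suc n) = S o\<^sub>L op_power S n"

lemma op_power_add: "op_power S (m + n) = op_power S m o\<^sub>L op_power S n"
  by (induction m) (simp_all add: comp_assoc)

lemma op_power_commute: "op_power S n o\<^sub>L S = S o\<^sub>L op_power S n"
  by (induction n) (simp_all add: comp_assoc)

text \<open>Induction in steps of two: S^(n + 2) is S^n sandwiched between two copies of S.\<close>

lemma op_power_positive: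
  assumes S: "positive_operator S" shows "positive_operator (op_power S n)"
proof (induction n rule: induct_nat_012)
  case (ge2 n)
  have "op_power S (Suc (Suc n)) = S o\<^sub>L op_power S n o\<^sub>L S"
    by (simp add: op_power_commute comp_assoc)
  then show ?case using positive_sandwich[OF positive_sa[OF S] ge2(1)] by simp
qed (use S positive_intros in simp_all)

definition op_geometric :: "'h::complex_hilbert operator \<Rightarrow> nat \<Rightarrow> 'h operator"
  where "op_geometric S N = (\<Sum>n\<le>N. op_power S n)"

lemma positive_sum: "(\<And>i. i \<in> I \<Longrightarrow> positive_operator (f i)) \<Longrightarrow> positive_operator (sum f I)"
  by (induction I rule: infinite_finite_induct) (auto intro: positive_intros)

lemma op_geometric_rec: "S o\<^sub>L op_geometric S N = op_geometric S (Suc N) - id_blinfun"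
  by (induction N) (simp_all add: op_geometric_def comp_simps algebra_simps)

lemma op_geometric_commute: "op_geometric S N o\<^sub>L S = S o\<^sub>L op_geometric S N"
  by (induction N) (simp_all add: op_geometric_def comp_simps op_power_commute del: op_power.simps)

lemma square_le_self:
  assumes k: "positive_operator k" "k \<le>\<^sub>O id_blinfun"
  shows "(norm (k x))\<^sup>2 \<le> qform k x"
  using positive_norm_square_le[OF k(1), of 1] k by (simp add: le_iff positive_sa qform_simps)

text \<open>
  The operators \<open>(1 + \<Sum>n\<le>N. S\<^sup>n)\<inverse>\<close> decrease to \<open>k = f(S)\<close> where \<open>f\<close> vanishes exactly on \<open>[1, \<infinity>)\<close>,
  so the projection onto the kernel of \<open>k\<close> is the spectral projection of \<open>S\<close> for that interval.
\<close>

lemma spectral_projection_above_one: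
  assumes M: "von_neumann_algebra M" and S: "S \<in> M" "positive_operator S"
    and big: "qform S x0 > (norm x0)\<^sup>2"
  obtains P where "P \<in> M" "is_projection P" "P \<noteq> 0" "P \<le>\<^sub>O S"
proof -
  let ?I = "id_blinfun :: 'a operator"
  define z where "z = op_geometric S"
  define c where "c = (\<lambda>N. resolvent (z N))"
  have pM: "op_power S n \<in> M" for n using S M by (induction n) (simp_all add: algD vnD)
  have zM: "z N \<in> M" for N unfolding z_def op_geometric_def using M pM by (intro alg_sum vnD)
  have zp: "positive_operator (z N)" for N
    unfolding z_def op_geometric_def by (intro positive_sum op_power_positive S)
  have zmono: "z N \<le>\<^sub>O z (Suc N)" for N
    unfolding z_def op_geometric_def le_operator_def using op_power_positive[OF S(2), of "Suc N"] by simp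
  obtain k where k: "k \<in> M" "strong_tendsto c k" "positive_operator k" "\<And>n. k \<le>\<^sub>O c n" "k \<le>\<^sub>O ?I"
    unfolding c_def by (rule resolvent_limit[where z = z, OF M zM zp zmono]) blast
  have c1: "(?I + z N) o\<^sub>L c N = ?I" and c2: "c N o\<^sub>L (?I + z N) = ?I" for N
    unfolding c_def by (rule resolvent[OF zp])+
  have csa: "selfadj (c N)" for N unfolding c_def by (rule resolvent[OF zp])
  have cS: "S o\<^sub>L c N = c N o\<^sub>L S" for N
    unfolding c_def by (rule resolvent_commute[OF zp]) (simp add: z_def op_geometric_commute)
  have kS: "S o\<^sub>L k = k o\<^sub>L S"
    using strong_tendsto_unique[OF strong_tendsto_comp_left[OF k(2), of S]]
      strong_tendsto_comp_right[OF k(2), of S] by (simp add: cS)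
  have Ssa: "selfadj S" and ksa: "selfadj k" using S k by (simp_all add: positive_sa)
  \<comment> \<open>In scalars k is (1 - t) / (2 - t) for t < 1 and 0 for t >= 1, so t - 1 - (t - 2)
    k = max (t - 1) 0: \<open>R\<close> is the positive part of S - 1.\<close>
  define R where "R = S - ?I - ((S - 2 *\<^sub>R ?I) o\<^sub>L k)"
  have R_pos: "positive_operator R"
  proof (rule strong_tendsto_positive)
    show "strong_tendsto (\<lambda>N. S - ?I - ((S - 2 *\<^sub>R ?I) o\<^sub>L c N)) R"
      unfolding R_def by (intro strong_tendsto_diff strong_tendsto_const strong_tendsto_comp_left k)
    fix N
    let ?Q = "op_power S (Suc N)"
    have "(S - ?I) o\<^sub>L (?I + z N) = (S - 2 *\<^sub>R ?I) + ?Q"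
      using op_geometric_rec[of S N]
      by (simp add: comp_simps z_def scaleR_2 op_geometric_def algebra_simps)
    then have "((S - ?I) o\<^sub>L (?I + z N)) o\<^sub>L c N = ((S - 2 *\<^sub>R ?I) o\<^sub>L c N) + (?Q o\<^sub>L c N)"
      by (simp only: comp.add_left)
    then have "S - ?I - ((S - 2 *\<^sub>R ?I) o\<^sub>L c N) = ?Q o\<^sub>L c N"
      by (simp add: comp_assoc c1)
    \<comment> \<open>The product becomes a sandwich by c N whose middle factor is a sum of powers
      of S, so positivity can be read off.\<close>
    also have "\<dots> = c N o\<^sub>L ((?I + z N) o\<^sub>L ?Q) o\<^sub>L c N"
      using c2[of N] by (simp flip: comp_assoc)
    finally have eq: "S - ?I - ((S - 2 *\<^sub>R ?I) o\<^sub>L c N) = c N o\<^sub>L ((?I + z N) o\<^sub>L ?Q) o\<^sub>L c N" .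
    have "(?I + z N) o\<^sub>L ?Q = ?Q + (\<Sum>n\<le>N. op_power S (n + Suc N))"
      by (simp only: z_def op_geometric_def comp.add_left comp_id_left comp.sum_left op_power_add)
    then have "positive_operator ((?I + z N) o\<^sub>L ?Q)"
      by (simp only:) (intro positive_intros(3) positive_sum op_power_positive S)
    then show "positive_operator (S - ?I - ((S - 2 *\<^sub>R ?I) o\<^sub>L c N))"
      unfolding eq by (rule positive_sandwich[OF csa])
  qed
  have Rk: "R o\<^sub>L k = 0"
  proof -
    \<comment> \<open>From z (N + 1) = 1 + S z N. In the limit it reads k = k (2 - S) k + k S, which
      is k R = 0.\<close>
    have rec: "c N = (c (Suc N) o\<^sub>L ((2 *\<^sub>R ?I - S) o\<^sub>L c N)) + (c (Suc N) o\<^sub>L S)" for N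
    proof -
      have "?I + z (Suc N) = (2 *\<^sub>R ?I - S) + (S o\<^sub>L (?I + z N))"
        using op_geometric_rec[of S N] by (simp add: comp_simps z_def scaleR_2)
      moreover have "(S o\<^sub>L (?I + z N)) o\<^sub>L c N = S" by (simp add: comp_assoc c1)
      ultimately have "(?I + z (Suc N)) o\<^sub>L c N = ((2 *\<^sub>R ?I - S) o\<^sub>L c N) + S"
        by (simp only: comp.add_left[of "2 *\<^sub>R ?I - S"])
      then have "c (Suc N) o\<^sub>L ((?I + z (Suc N)) o\<^sub>L c N) = c (Suc N) o\<^sub>L (((2 *\<^sub>R ?I - S) o\<^sub>L c N) + S)"
        by simp
      moreover have "c (Suc N) o\<^sub>L ((?I + z (Suc N)) o\<^sub>L c N) = c N"
        by (simp only: c2 comp_id_left flip: comp_assoc)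
      ultimately show ?thesis by (simp only: comp.add_right[of "c (Suc N)" "(2 *\<^sub>R ?I - S) o\<^sub>L c N"])
    qed
    note c' = strong_tendsto_Suc[OF k(2)]
    have "strong_tendsto (\<lambda>N. (c (Suc N) o\<^sub>L ((2 *\<^sub>R ?I - S) o\<^sub>L c N)) + (c (Suc N) o\<^sub>L S))
        ((k o\<^sub>L ((2 *\<^sub>R ?I - S) o\<^sub>L k)) + (k o\<^sub>L S))"
      by (rule strong_tendsto_add[OF strong_tendsto_comp[OF c' strong_tendsto_comp_left[OF k(2)], of 1]
            strong_tendsto_comp_right[OF c']])
        (simp add: c_def norm_resolvent zp)
    then have "strong_tendsto c ((k o\<^sub>L ((2 *\<^sub>R ?I - S) o\<^sub>L k)) + (k o\<^sub>L S))"
      by (simp only: rec[symmetric])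
    from strong_tendsto_unique[OF k(2) this]
    have "k = (k o\<^sub>L ((2 *\<^sub>R ?I - S) o\<^sub>L k)) + (k o\<^sub>L S)" .
    then have "k o\<^sub>L R = 0" unfolding R_def
      by (simp add: comp_simps algebra_simps)
    then have "adj (k o\<^sub>L R) = 0" by simp
    then show ?thesis using positive_sa[OF R_pos] ksa by (simp add: adj_comp selfadj_def)
  qed
  obtain P where P: "P \<in> M" "is_projection P" "k o\<^sub>L P = 0"
    "\<And>Q :: 'a operator. Q o\<^sub>L k = 0 \<Longrightarrow> Q o\<^sub>L P = Q" "\<And>T. T o\<^sub>L k = k o\<^sub>L T \<Longrightarrow> T o\<^sub>L P = P o\<^sub>L T"
    by (rule kernel_projection[OF M k(1,3)]) blast
  have SP: "S o\<^sub>L P = P o\<^sub>L S" by (rule P(5)[OF kS])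
  \<comment> \<open>If P = 0, then R = R P = 0, which amounts to (1 - k)(1 - S) = k. As 1 - k is
    invertible, 1 - S is positive, against \<open>big\<close>.\<close>
  have "P \<noteq> 0"
  proof
    assume "P = 0"
    then have "R = 0" using P(4)[OF Rk] by (simp add: comp_simps)
    then have eq: "?I - S = 2 *\<^sub>R k - (S o\<^sub>L k)"
      by (simp add: R_def comp_simps algebra_simps)
    \<comment> \<open>k lies below its first approximant c 0, which is 1/2 because z 0 = 1.\<close>
    have half: "k \<le>\<^sub>O (1/2) *\<^sub>R ?I"
    proof -
      have "c 0 = (1/2) *\<^sub>R ?I"
      proof (rule two_sided_inverse_unique[OF c2])
        show "(?I + z 0) o\<^sub>L ((1 / 2) *\<^sub>R ?I) = ?I"
          by (simp add: z_def op_geometric_def comp_simps flip: scaleR_add_left)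
      qed
      then show ?thesis using k(4)[of 0] by simp
    qed
    have sa1: "selfadj (?I - k)" using ksa by simp
    have "qform (?I - k) x \<ge> (1/2) * (norm x)\<^sup>2" for x
      using half by (simp add: le_iff ksa qform_simps)
    from inverse_in_algebra[OF bop_alg bop_id bop_closed selfadj_bop[OF sa1] sa1 half_gt_zero[OF zero_less_one] this]
    obtain d where d: "d o\<^sub>L (?I - k) = ?I" "(?I - k) o\<^sub>L d = ?I" "positive_operator d" by metis
    have "(?I - k) o\<^sub>L (?I - S) = k"
      using eq kS by (simp add: comp_simps algebra_simps scaleR_2)
    then have "d o\<^sub>L ((?I - k) o\<^sub>L (?I - S)) = d o\<^sub>L k" by simp
    then have "?I - S = d o\<^sub>L k" using d(1) by (simp flip: comp_assoc)
    \<comment> \<open>Again a sandwich, now with middle factor k - k^2, positive since 0 <= k <=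
      1.\<close>
    also have "d o\<^sub>L k = d o\<^sub>L (k - (k o\<^sub>L k)) o\<^sub>L d"
    proof -
      have "k - (k o\<^sub>L k) = k o\<^sub>L (?I - k)" by (simp add: comp_simps)
      then show ?thesis using d(2) by (simp add: comp_assoc)
    qed
    finally have "qform (?I - S) x0 = qform (k - (k o\<^sub>L k)) (d x0)"
      using positive_sa[OF d(3)] by (simp add: qform_sandwich)
    also have "\<dots> \<ge> 0"
      using square_le_self[OF k(3,5)] qform_sandwich[OF ksa, of ?I] by (simp add: qform_simps)
    finally show False using big by (simp add: qform_simps)
  qed
  \<comment> \<open>k P = 0 turns R >= 0 into S >= 1 on the range of P. As P commutes with S, the
    cross terms vanish, and the complement only adds a nonnegative term.\<close>
  moreover have "P \<le>\<^sub>O S"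
  proof -
    have Psa: "selfadj P" by (rule projD[OF P(2)])
    have "qform P x \<le> qform S x" for x
    proof -
      have "R o\<^sub>L P = (S - ?I) o\<^sub>L P" unfolding R_def using P(3) by (simp add: comp_simps comp_assoc)
      then have "qform R (P x) = qform (S - ?I) (P x)"
        using projD(4)[OF P(2)] unfolding qform_def by (metis blinfun_apply_blinfun_compose)
      then have 1: "qform S (P x) \<ge> (norm (P x))\<^sup>2"
        using positive_qform[OF R_pos, of "P x"] by (simp add: qform_simps)
      have "cinner (S (P x)) (x - P x) = cinner (P (S x)) (x - P x)"
        using arg_cong[OF SP, of "\<lambda>T. T x"] by simp
      then have 2: "cinner (S (P x)) (x - P x) = 0"
        by (simp add: selfadj_cinner[OF Psa] op_simps projD(4)[OF P(2)])
      then have 3: "cinner (S (x - P x)) (P x) = 0"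
        by (metis selfadj_cinner[OF Ssa] cinner_commute complex_cnj_zero)
      have "qform S (P x + (x - P x)) = qform S (P x) + qform S (x - P x)"
        unfolding qform_def using 2 3
        by (simp only: blinfun.add_right cinner.add_left cinner.add_right) simp
      then have "qform S x = qform S (P x) + qform S (x - P x)" by simp
      then show ?thesis
        using 1 positive_qform[OF S(2), of "x - P x"] by (simp add: projD(5)[OF P(2)])
    qed
    then show ?thesis by (simp add: le_iff Ssa Psa)
  qed
  ultimately show ?thesis using that P by blast
qed

lemma positive_dominates_projection:
  assumes M: "von_neumann_algebra M" and g: "g \<in> M" "positive_operator g" "g \<noteq> 0"
  obtains P e where "P \<in> M" "is_projection P" "P \<noteq> 0" "e > 0" "e *\<^sub>R P \<le>\<^sub>O g"
proof -
  obtain x where x: "qform g x > 0"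
    using selfadj_qform_eqI[of g 0] g positive_qform[OF g(2)]
    by (metis less_eq_real_def positive_sa qform_simps(5) selfadj_intros(1))
  then have "x \<noteq> 0" by (auto simp: qform_def cinner_simps)
  \<comment> \<open>Chosen so that the form of g / e at x is twice the squared norm of x, beyond the
    threshold 1.\<close>
  define e where "e = qform g x / (2 * (norm x)\<^sup>2)"
  have e: "e > 0" using x \<open>x \<noteq> 0\<close> by (simp add: e_def)
  have "qform ((1/e) *\<^sub>R g) x > (norm x)\<^sup>2"
    using x \<open>x \<noteq> 0\<close> by (simp add: qform_simps e_def)
  moreover have "(1/e) *\<^sub>R g \<in> M" "positive_operator ((1/e) *\<^sub>R g)"
    using M g e by (simp_all add: algD vnD positive_intros)
  ultimately obtain P where P: "P \<in> M" "is_projection P" "P \<noteq> 0" "P \<le>\<^sub>O (1/e) *\<^sub>R g"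
    using spectral_projection_above_one[OF M] by blast
  have "e *\<^sub>R P \<le>\<^sub>O g"
    using P(4) e projD(3)[OF P(2)] positive_sa[OF g(2)]
    by (simp add: le_iff qform_simps field_simps)
  with that P e show ?thesis by blast
qed

section \<open>Tracial von Neumann algebras\<close>

locale tracial_algebra =
  fixes M :: "'h::complex_hilbert operator set" and \<tau> :: "'h operator \<Rightarrow> complex"
  assumes vn: "von_neumann_algebra M" and trace: "normalized_trace M \<tau>"
begin

lemmas alg = vnD(1)[OF vn]

lemmas M_intros [simp, intro] = algD(2-)[OF alg] vnD(2)[OF vn]
lemmas M_bop [simp, intro] = algD(1)[OF alg]

abbreviation rtr :: "'h operator \<Rightarrow> real" where "rtr T \<equiv> Re (\<tau> T)"

lemma tr_add: "S \<in> M \<Longrightarrow> T \<in> M \<Longrightarrow> \<tau> (S + T) = \<tau> S + \<tau> T"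
  and tr_scale: "T \<in> M \<Longrightarrow> \<tau> (c *\<^sub>O T) = c * \<tau> T"
  and tr_id: "\<tau> id_blinfun = 1"
  and tr_commute: "S \<in> M \<Longrightarrow> T \<in> M \<Longrightarrow> \<tau> (S o\<^sub>L T) = \<tau> (T o\<^sub>L S)"
  using trace unfolding normalized_trace_def linear_on_algebra_def by auto

lemma tr_scaleR: "T \<in> M \<Longrightarrow> \<tau> (r *\<^sub>R T) = of_real r * \<tau> T"
  by (simp add: scaleR_scale_operator tr_scale)

lemma tr_minus: "T \<in> M \<Longrightarrow> \<tau> (- T) = - \<tau> T"
  using tr_scaleR[of T "-1"] by simp

lemma tr_diff: "S \<in> M \<Longrightarrow> T \<in> M \<Longrightarrow> \<tau> (S - T) = \<tau> S - \<tau> T"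
  using tr_add[of S "- T"] by (simp add: tr_minus)

lemma tr_zero: "\<tau> 0 = 0"
  using tr_add[of 0 0] by simp

lemma tr_sum: "(\<And>i. i \<in> I \<Longrightarrow> f i \<in> M) \<Longrightarrow> \<tau> (sum f I) = (\<Sum>i\<in>I. \<tau> (f i))"
  by (induction I rule: infinite_finite_induct) (auto simp: tr_zero tr_add alg_sum[OF alg])

lemma tr_positive: assumes "T \<in> M" "positive_operator T" shows "rtr T \<ge> 0" "Im (\<tau> T) = 0"
  using assms trace by (auto simp: normalized_trace_def complex_nonneg_Reals_iff)

lemma tr_faithful: "T \<in> M \<Longrightarrow> positive_operator T \<Longrightarrow> rtr T \<le> 0 \<Longrightarrow> T = 0"
  using trace tr_positive[of T] by (auto simp: normalized_trace_def complex_eq_iff)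

lemma tr_sa: assumes "T \<in> M" "selfadj T" shows "Im (\<tau> T) = 0"
proof -
  have "positive_operator (norm T *\<^sub>R id_blinfun + T)"
    using assms(2) abs_qform_le[of T] by (auto simp: positive_iff qform_simps abs_le_iff) (metis add.commute diff_minus_eq_add le_diff_eq minus_le_iff add_0)
  then have "Im (\<tau> (norm T *\<^sub>R id_blinfun + T)) = 0" by (intro tr_positive) (simp_all add: assms)
  then show ?thesis using assms(1) by (simp add: tr_add tr_scaleR tr_id)
qed

lemma tr_adj: assumes T: "T \<in> M" shows "\<tau> (adj T) = cnj (\<tau> T)"
proof -
  have "selfadj (T + adj T)" using T by (simp add: selfadj_def adj_add adj_adj add.commute)
  then have 1: "Im (\<tau> (T + adj T)) = 0" using T by (intro tr_sa) auto
  have "selfadj (\<i> *\<^sub>O (T - adj T))"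
    using T by (simp add: selfadj_def adj_diff adj_adj adj_scale)
      (rule blinfun_eqI, simp add: op_simps scaleC_diff_right scaleC_minus_left)
  then have 2: "Im (\<tau> (\<i> *\<^sub>O (T - adj T))) = 0" using T by (intro tr_sa) auto
  show ?thesis using 1 2 T by (simp add: tr_add tr_scale tr_diff complex_eq_iff)
qed

lemma tr_mono: assumes "S \<in> M" "T \<in> M" "S \<le>\<^sub>O T" shows "rtr S \<le> rtr T"
  using tr_positive(1)[of "T - S"] assms by (simp add: le_operator_def tr_diff)

text \<open>The only place where normality of the trace enters. The range of the sequence is the
  directed set, and the strong limit is its least upper bound in \<open>M\<close>.\<close>

lemma tr_normal:
  assumes XM: "\<And>n. X n \<in> M" and Xp: "\<And>n. positive_operator (X n)"
    and mono: "\<And>n. X n \<le>\<^sub>O X (Suc n)" and lim: "strong_tendsto X T" and ub: "\<And>n. X n \<le>\<^sub>O T"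
    and e: "\<And>n. rtr (X n) \<le> e"
  shows "rtr T \<le> e"
proof -
  have refl: "S \<le>\<^sub>O S" for S :: "'h operator" by (simp add: le_operator_def positive_intros)
  have mono': "X i \<le>\<^sub>O X j" if "i \<le> j" for i j
    using that by (induction rule: dec_induct) (auto intro: refl le_trans_op mono)
  have dir: "\<exists>U\<in>range X. R \<le>\<^sub>O U \<and> S \<le>\<^sub>O U" if "R \<in> range X" "S \<in> range X" for R S
    using that mono' by (metis max.cobounded1 max.cobounded2 rangeE rangeI)
  have lub: "least_upper_bound M (range X) T"
    unfolding least_upper_bound_def
    using vn_strong_limit[OF vn lim XM] ub strong_tendsto_le[OF lim] by auto
  have "normal_functional M \<tau>" using trace by (simp add: normalized_trace_def)
  then have "rtr T = (SUP S\<in>range X. rtr S)"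
    unfolding normal_functional_def
    by (elim allE[of _ "range X"] allE[of _ T] impE) (use dir lub XM Xp in auto)
  also have "\<dots> \<le> e" by (rule cSUP_least) (use e in auto)
  finally show ?thesis .
qed

subsection \<open>The 2-norm\<close>

definition n2 :: "'h operator \<Rightarrow> real" where "n2 T = sqrt (rtr (adj T o\<^sub>L T))"

lemma n2_sq: "T \<in> M \<Longrightarrow> (n2 T)\<^sup>2 = rtr (adj T o\<^sub>L T)"
  unfolding n2_def by (intro real_sqrt_pow2 tr_positive positive_adj_comp) auto

lemma n2_nonneg [simp]: "T \<in> M \<Longrightarrow> n2 T \<ge> 0"
  unfolding n2_def by (intro real_sqrt_ge_zero tr_positive positive_adj_comp) auto

lemma tr_adj_comp: "T \<in> M \<Longrightarrow> \<tau> (adj T o\<^sub>L T) = of_real ((n2 T)\<^sup>2)"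
  by (simp add: n2_sq complex_eq_iff tr_positive positive_adj_comp del: of_real_power)

lemma scale_operator_comp: "S \<in> bounded_operators \<Longrightarrow> S o\<^sub>L (c *\<^sub>O T) = c *\<^sub>O (S o\<^sub>L T)"
  "(c *\<^sub>O S) o\<^sub>L T = c *\<^sub>O (S o\<^sub>L T)"
  by (auto intro!: blinfun_eqI simp: bop_scaleC)

lemma tr_cauchy_schwarz:
  assumes S: "S \<in> M" and T: "T \<in> M"
  shows "cmod (\<tau> (adj S o\<^sub>L T)) \<le> n2 S * n2 T"
proof -
  have "(cmod (\<tau> (adj S o\<^sub>L T)))\<^sup>2 \<le> (n2 S)\<^sup>2 * (n2 T)\<^sup>2"
  proof (rule complex_discriminant)
    fix l
    have TS: "\<tau> (adj T o\<^sub>L S) = cnj (\<tau> (adj S o\<^sub>L T))"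
      using S T by (simp add: adj_comp adj_adj flip: tr_adj)
    have "adj (S + l *\<^sub>O T) o\<^sub>L (S + l *\<^sub>O T) = (adj S o\<^sub>L S) + l *\<^sub>O (adj S o\<^sub>L T)
       + cnj l *\<^sub>O (adj T o\<^sub>L S) + cnj l *\<^sub>O l *\<^sub>O (adj T o\<^sub>L T)"
      using S T by (simp add: adj_add adj_scale comp_simps scale_operator_comp algebra_simps)
    then have "rtr (adj (S + l *\<^sub>O T) o\<^sub>L (S + l *\<^sub>O T)) =
        Re (\<tau> (adj S o\<^sub>L S) + (l * \<tau> (adj S o\<^sub>L T) + cnj (l * \<tau> (adj S o\<^sub>L T))) + (l * cnj l) * \<tau> (adj T o\<^sub>L T))"
      using S T by (simp add: tr_add tr_scale TS algebra_simps)
    also have "\<dots> = (n2 S)\<^sup>2 + 2 * Re (l * \<tau> (adj S o\<^sub>L T)) + (cmod l)\<^sup>2 * (n2 T)\<^sup>2"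
      by (simp only: complex_norm_square[symmetric] tr_adj_comp[OF S] tr_adj_comp[OF T] complex_add_cnj)
        (simp flip: of_real_power of_real_mult del: times_complex.sel)
    finally show "0 \<le> (n2 S)\<^sup>2 + 2 * Re (l * \<tau> (adj S o\<^sub>L T)) + (cmod l)\<^sup>2 * (n2 T)\<^sup>2"
      using tr_positive(1)[of "adj (S + l *\<^sub>O T) o\<^sub>L (S + l *\<^sub>O T)"] positive_adj_comp[of "S + l *\<^sub>O T"] S T
      by simp
  qed simp
  then show ?thesis using S T
    by (metis abs_le_square_iff abs_of_nonneg mult_nonneg_nonneg n2_nonneg norm_ge_zero power_mult_distrib)
qed

lemma n2_sq_add:
  assumes S: "S \<in> M" and T: "T \<in> M"
  shows "(n2 (S + T))\<^sup>2 = (n2 S)\<^sup>2 + (n2 T)\<^sup>2 + 2 * rtr (adj S o\<^sub>L T)"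
proof -
  have TS: "\<tau> (adj T o\<^sub>L S) = cnj (\<tau> (adj S o\<^sub>L T))"
    using S T by (simp add: adj_comp adj_adj flip: tr_adj)
  have "adj (S + T) o\<^sub>L (S + T) = (adj S o\<^sub>L S) + (adj S o\<^sub>L T) + (adj T o\<^sub>L S) + (adj T o\<^sub>L T)"
    using S T by (simp add: adj_add comp_simps)
  then have "rtr (adj (S + T) o\<^sub>L (S + T)) = rtr (adj S o\<^sub>L S) + rtr (adj T o\<^sub>L T) + 2 * rtr (adj S o\<^sub>L T)"
    using S T by (simp add: tr_add TS)
  then show ?thesis using S T by (simp add: n2_sq)
qed

lemma n2_triangle:
  assumes S: "S \<in> M" and T: "T \<in> M" shows "n2 (S + T) \<le> n2 S + n2 T"
proof (rule power2_le_imp_le)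
  have "rtr (adj S o\<^sub>L T) \<le> n2 S * n2 T"
    using tr_cauchy_schwarz[OF S T] complex_Re_le_cmod order.trans by blast
  then show "(n2 (S + T))\<^sup>2 \<le> (n2 S + n2 T)\<^sup>2" using n2_sq_add[OF S T] by (simp add: power2_sum)
qed (use S T in simp)

lemma n2_scaleR: assumes T: "T \<in> M" shows "n2 (r *\<^sub>R T) = \<bar>r\<bar> * n2 T"
proof -
  have "adj (r *\<^sub>R T) o\<^sub>L (r *\<^sub>R T) = (r * r) *\<^sub>R (adj T o\<^sub>L T)" using T by (simp add: adj_scaleR comp_simps)
  then show ?thesis unfolding n2_def using T by (simp add: tr_scaleR real_sqrt_mult)
qed

lemma n2_minus: "T \<in> M \<Longrightarrow> n2 (- T) = n2 T"
  using n2_scaleR[of T "-1"] by simp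

lemma n2_commute: "S \<in> M \<Longrightarrow> T \<in> M \<Longrightarrow> n2 (S - T) = n2 (T - S)"
  using n2_minus[of "S - T"] by simp

lemma n2_triangle_diff: "R \<in> M \<Longrightarrow> S \<in> M \<Longrightarrow> T \<in> M \<Longrightarrow> n2 (R - T) \<le> n2 (R - S) + n2 (S - T)"
  using n2_triangle[of "R - S" "S - T"] by simp

lemma n2_parallelogram:
  assumes S: "S \<in> M" and T: "T \<in> M"
  shows "(n2 (S - T))\<^sup>2 = 2 * (n2 S)\<^sup>2 + 2 * (n2 T)\<^sup>2 - 4 * (n2 ((1/2) *\<^sub>R (S + T)))\<^sup>2"
proof -
  have "(n2 ((1/2) *\<^sub>R (S + T)))\<^sup>2 = (n2 (S + T))\<^sup>2 / 4"
    using S T by (simp only: n2_scaleR M_intros) (simp add: power_divide)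
  then show ?thesis
    using n2_sq_add[OF S T] n2_sq_add[OF S, of "- T"] S T
    by (simp add: n2_minus comp_simps tr_minus)
qed

lemma n2_adj: assumes T: "T \<in> M" shows "n2 (adj T) = n2 T"
  unfolding n2_def using T tr_commute[of T "adj T"] by (simp add: adj_adj)

lemma n2_comp_left:
  assumes S: "S \<in> M" and T: "T \<in> M" shows "n2 (S o\<^sub>L T) \<le> norm S * n2 T"
proof -
  have "(n2 (S o\<^sub>L T))\<^sup>2 \<le> ((norm S)\<^sup>2 * (n2 T)\<^sup>2)"
  proof -
    have "adj (S o\<^sub>L T) o\<^sub>L (S o\<^sub>L T) \<le>\<^sub>O (norm S)\<^sup>2 *\<^sub>R (adj T o\<^sub>L T)"
    proof -
      have "qform (adj (S o\<^sub>L T) o\<^sub>L (S o\<^sub>L T)) x \<le> qform ((norm S)\<^sup>2 *\<^sub>R (adj T o\<^sub>L T)) x" for x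
        using power_mono[OF norm_blinfun[of S "T x"], of 2] S T
        by (simp add: qform_adj_comp qform_simps power_mult_distrib)
      moreover have "selfadj ((norm S)\<^sup>2 *\<^sub>R (adj T o\<^sub>L T))" "selfadj (adj (S o\<^sub>L T) o\<^sub>L (S o\<^sub>L T))"
        using S T by (intro selfadj_intros selfadj_adj_comp; simp)+
      ultimately show ?thesis by (simp add: le_iff)
    qed
    then have "rtr (adj (S o\<^sub>L T) o\<^sub>L (S o\<^sub>L T)) \<le> rtr ((norm S)\<^sup>2 *\<^sub>R (adj T o\<^sub>L T))"
      using S T by (intro tr_mono) auto
    then show ?thesis using S T by (simp add: n2_sq tr_scaleR)
  qed
  then have "(n2 (S o\<^sub>L T))\<^sup>2 \<le> (norm S * n2 T)\<^sup>2" by (simp only: power_mult_distrib)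
  then show ?thesis by (rule power2_le_imp_le) (simp add: T)
qed

text \<open>Traciality, through \<open>n2_adj\<close>, carries the left estimate over to the right.
  Both sides are needed for 2-norm closures to be closed under products.\<close>

lemma n2_comp_right:
  assumes S: "S \<in> M" and T: "T \<in> M" shows "n2 (T o\<^sub>L S) \<le> norm S * n2 T"
proof -
  have "n2 (T o\<^sub>L S) = n2 (adj S o\<^sub>L adj T)" using n2_adj[of "T o\<^sub>L S"] S T by (simp add: adj_comp)
  also have "\<dots> \<le> norm (adj S) * n2 (adj T)" using S T by (intro n2_comp_left) auto
  also have "\<dots> \<le> norm S * n2 T"
    using S T norm_adj_le[of S] by (simp add: n2_adj mult_right_mono)
  finally show ?thesis .
qed

lemma n2_id: "n2 id_blinfun = 1" by (simp add: n2_def tr_id)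

lemma n2_zero: "n2 0 = 0" by (simp add: n2_def tr_zero comp_simps)

lemma n2_le_norm: "T \<in> M \<Longrightarrow> n2 T \<le> norm T"
  using n2_comp_left[of T id_blinfun] by (simp add: n2_id)

lemma tr_le_n2: "T \<in> M \<Longrightarrow> cmod (\<tau> T) \<le> n2 T"
  using tr_cauchy_schwarz[of id_blinfun T] by (simp add: n2_id)

lemma n2_eq_zero: assumes T: "T \<in> M" "n2 T = 0" shows "T = 0"
proof -
  have "adj T o\<^sub>L T = 0" using n2_sq[OF T(1)] T by (intro tr_faithful positive_adj_comp) auto
  then have "norm (T x) = 0" for x using qform_adj_comp[of T x] T by (simp add: qform_simps)
  then show ?thesis by (intro blinfun_eqI) simp
qed

subsection \<open>Completeness of bounded sets in the 2-norm\<close>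

text \<open>In scalars, y / 2 <= y / (1 + y) for 0 <= y <= 1. With x = (1 + y) u it becomes a
  comparison of forms at u, namely y^3 <= y^2 <= y.\<close>

lemma half_le_one_minus_resolvent:
  assumes y: "positive_operator y" "y \<le>\<^sub>O id_blinfun"
  shows "(1/2) *\<^sub>R y \<le>\<^sub>O id_blinfun - resolvent y"
proof -
  have "qform ((1/2) *\<^sub>R y) x \<le> qform (id_blinfun - resolvent y) x" for x
  proof -
    define u where "u = resolvent y x"
    have x: "x = u + y u" using resolvent_apply[OF y(1), of x] by (simp add: u_def)
    have s: "selfadj y" by (rule positive_sa[OF y(1)])
    have yy: "Re (cinner (y (y u)) (y u)) \<le> (norm (y u))\<^sup>2"
      using y(2) by (simp add: le_iff s qform_simps) (simp add: qform_def)
    have "x - u = y u" by (metis x add_diff_cancel_left')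
    then have "(id_blinfun - resolvent y) x = y u" by (simp add: op_simps u_def)
    then have "qform (id_blinfun - resolvent y) x = qform y u + (norm (y u))\<^sup>2"
      unfolding qform_def by (metis x cinner.add_right plus_complex.sel(1) Re_cinner_self)
    moreover have "qform y x = qform y u + 2 * (norm (y u))\<^sup>2 + Re (cinner (y (y u)) (y u))"
      unfolding qform_def x
      by (simp add: op_simps cinner_simps selfadj_cinner[OF s, of "y u" u] Re_cinner_self)
    ultimately show ?thesis using square_le_self[OF y, of u] yy by (simp add: qform_simps)
  qed
  then show ?thesis by (simp add: le_iff positive_sa resolvent y(1))
qed

text \<open>
  Sums of positive elements of small trace may be unbounded, but \<open>1 - (1 + v)\<inverse>\<close> still dominates
  every contraction below \<open>v\<close> up to a factor 2 and its trace is at most that of \<open>v\<close>.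
\<close>

lemma truncated_supremum:
  assumes vM: "\<And>n. v n \<in> M" and vp: "\<And>n. positive_operator (v n)"
    and mono: "\<And>n. v n \<le>\<^sub>O v (Suc n)" and e: "\<And>n. rtr (v n) \<le> e"
  obtains k where "k \<in> M" "strong_tendsto (\<lambda>n. resolvent (v n)) k" "positive_operator k" "k \<le>\<^sub>O id_blinfun"
    "rtr (id_blinfun - k) \<le> e"
    "\<And>y n. positive_operator y \<Longrightarrow> y \<le>\<^sub>O id_blinfun \<Longrightarrow> y \<le>\<^sub>O v n \<Longrightarrow> (1/2) *\<^sub>R y \<le>\<^sub>O id_blinfun - k"
proof -
  obtain k where k: "k \<in> M" "strong_tendsto (\<lambda>n. resolvent (v n)) k" "positive_operator k"
    "\<And>n. k \<le>\<^sub>O resolvent (v n)" "k \<le>\<^sub>O id_blinfun"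
    by (rule resolvent_limit[where z = v, OF vn vM vp mono]) blast
  have rM: "resolvent (v n) \<in> M" for n
    using resolvent_in_algebra[OF vnD[OF vn] vn_closed[OF vn] vM vp] by blast
  have anti: "id_blinfun - S \<le>\<^sub>O id_blinfun - R" if "R \<le>\<^sub>O S" for R S :: "'h operator"
    using that by (simp add: le_operator_def)
  have "rtr (id_blinfun - k) \<le> e"
  proof (rule tr_normal[where X = "\<lambda>n. id_blinfun - resolvent (v n)"])
    fix n
    show "id_blinfun - resolvent (v n) \<in> M" using rM by simp
    show "positive_operator (id_blinfun - resolvent (v n))"
      using resolvent_le_id[OF vp] by (simp add: le_operator_def)
    show "id_blinfun - resolvent (v n) \<le>\<^sub>O id_blinfun - resolvent (v (Suc n))"
      by (intro anti resolvent_antimono vp mono)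
    show "id_blinfun - resolvent (v n) \<le>\<^sub>O id_blinfun - k" by (intro anti k)
    have 1: "v n o\<^sub>L resolvent (v n) = id_blinfun - resolvent (v n)"
      using resolvent(2)[OF vp, of n] by (simp add: comp_simps algebra_simps)
    have 2: "resolvent (v n) o\<^sub>L v n = id_blinfun - resolvent (v n)"
      using resolvent(1)[OF vp, of n] by (simp add: comp_simps algebra_simps)
    \<comment> \<open>In scalars v - v / (1 + v) = v^2 / (1 + v), visibly positive as a
      sandwich.\<close>
    have "v n - (id_blinfun - resolvent (v n)) = v n o\<^sub>L resolvent (v n) o\<^sub>L v n"
      by (simp only: 1 comp.diff_left 2 comp_id_left)
    then have "id_blinfun - resolvent (v n) \<le>\<^sub>O v n"
      unfolding le_operator_def using positive_sandwich[OF positive_sa[OF vp] resolvent(3)[OF vp]] by simp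
    from tr_mono[OF _ vM this] e[of n] show "rtr (id_blinfun - resolvent (v n)) \<le> e" using rM by simp
  qed (intro strong_tendsto_diff strong_tendsto_const k)
  moreover have "(1/2) *\<^sub>R y \<le>\<^sub>O id_blinfun - k"
    if "positive_operator y" "y \<le>\<^sub>O id_blinfun" "y \<le>\<^sub>O v n" for y n
    using half_le_one_minus_resolvent[OF that(1,2)] anti[OF resolvent_antimono[OF that(1) vp that(3)]]
      anti[OF k(4)[of n]] le_trans_op by blast
  ultimately show ?thesis using that k by blast
qed

text \<open>Borel-Cantelli. The truncated supremum 1 - K n of the tail from n dominates y n / 2 and
  has trace at most \<open>2 * (1/2)^n\<close>. These suprema decrease to 1 - L, which has trace 0
  and vanishes by faithfulness.\<close>

lemma tr_absolutely_continuous_seq: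
  assumes yM: "\<And>k. y k \<in> M" and yp: "\<And>k. positive_operator (y k)" and y1: "\<And>k. y k \<le>\<^sub>O id_blinfun"
    and yt: "\<And>k. rtr (y k) \<le> (1/2)^k"
  shows "(\<lambda>k. qform (y k) x) \<longlonglongrightarrow> 0"
proof -
  define v where "v n N = sum y {n..n + N}" for n N
  have vM: "v n N \<in> M" for n N unfolding v_def by (intro alg_sum[OF alg] yM)
  have vp: "positive_operator (v n N)" for n N unfolding v_def by (intro positive_sum yp)
  have vSuc: "v n (Suc N) = v n N + y (Suc (n + N))" for n N by (simp add: v_def)
  have vmono: "v n N \<le>\<^sub>O v n (Suc N)" for n N by (simp add: vSuc le_operator_def yp)
  have vshift: "v (Suc n) N \<le>\<^sub>O v n (Suc N)" for n N
    by (simp add: v_def le_operator_def sum.atLeast_Suc_atMost[of n] yp)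
  \<comment> \<open>The subtracted last term of the geometric series is what lets the induction
    close.\<close>
  have "rtr (v n N) \<le> 2 * (1/2)^n - (1/2)^(n + N)" for n N
  proof (induction N)
    case (Suc N)
    then show ?case using yt[of "Suc (n + N)"] by (simp add: vSuc tr_add vM yM)
  qed (use yt[of n] in \<open>simp add: v_def\<close>)
  then have vt: "rtr (v n N) \<le> 2 * (1/2)^n" for n N
    by (smt (verit) zero_le_power divide_nonneg_nonneg)
  have "\<exists>k. k \<in> M \<and> strong_tendsto (\<lambda>N. resolvent (v n N)) k \<and> positive_operator k \<and> k \<le>\<^sub>O id_blinfun \<and>
    rtr (id_blinfun - k) \<le> 2 * (1/2)^n \<and> (1/2) *\<^sub>R y n \<le>\<^sub>O id_blinfun - k" for n
  proof -
    have "y n \<le>\<^sub>O v n 0" by (simp add: v_def le_operator_def positive_intros)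
    then show ?thesis
      using truncated_supremum[where v = "v n", OF vM vp vmono vt] yp y1 by metis
  qed
  then obtain K where K: "\<And>n. K n \<in> M" "\<And>n. strong_tendsto (\<lambda>N. resolvent (v n N)) (K n)"
    "\<And>n. positive_operator (K n)" "\<And>n. K n \<le>\<^sub>O id_blinfun"
    "\<And>n. rtr (id_blinfun - K n) \<le> 2 * (1/2)^n" "\<And>n. (1/2) *\<^sub>R y n \<le>\<^sub>O id_blinfun - K n"
    by metis
  \<comment> \<open>A finite tail from n + 1 is contained in the tail from n with the same last
    index.\<close>
  have "K n \<le>\<^sub>O K (Suc n)" for n
  proof -
    have "strong_tendsto (\<lambda>N. resolvent (v (Suc n) N) - resolvent (v n (Suc N))) (K (Suc n) - K n)"
      by (intro strong_tendsto_diff strong_tendsto_Suc[OF K(2)] K(2))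
    moreover have "positive_operator (resolvent (v (Suc n) N) - resolvent (v n (Suc N)))" for N
      using resolvent_antimono[OF vp vp vshift] by (simp add: le_operator_def)
    ultimately show ?thesis unfolding le_operator_def by (rule strong_tendsto_positive)
  qed
  from monotone_strong_limit[where X = K, OF K(3,4) this]
  obtain L where L: "strong_tendsto K L" "\<And>n. K n \<le>\<^sub>O L" by blast
  have LM: "L \<in> M" by (rule vn_strong_limit[OF vn L(1) K(1)])
  have "rtr (id_blinfun - L) \<le> 2 * (1/2)^n" for n
  proof -
    have "id_blinfun - L \<le>\<^sub>O id_blinfun - K n" using L(2)[of n] by (simp add: le_operator_def)
    from tr_mono[OF _ _ this] K(5)[of n] K(1) LM show ?thesis by simp
  qed
  moreover have "(\<lambda>n. 2 * (1/2::real)^n) \<longlonglongrightarrow> 2 * 0"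
    by (intro tendsto_intros LIMSEQ_power_zero) simp
  ultimately have "rtr (id_blinfun - L) \<le> 0" by (metis LIMSEQ_le_const mult_zero_right)
  moreover have "positive_operator (id_blinfun - L)"
    using strong_tendsto_le[OF L(1) K(4)] by (simp add: le_operator_def)
  ultimately have "id_blinfun - L = 0" using LM by (intro tr_faithful) auto
  then have "(\<lambda>n. qform (id_blinfun - K n) x) \<longlonglongrightarrow> qform 0 x"
    using qform_tendsto[OF strong_tendsto_diff[OF strong_tendsto_const[of id_blinfun] L(1)], of x] by simp
  then have "(\<lambda>n. qform (id_blinfun - K n) x) \<longlonglongrightarrow> 0" by (simp only: qform_simps(5))
  from tendsto_mult_right_zero[OF this, of 2]
  have lim: "(\<lambda>n. 2 * qform (id_blinfun - K n) x) \<longlonglongrightarrow> 0" .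
  show ?thesis
  proof (rule tendsto_sandwich[OF _ _ tendsto_const lim])
    show "\<forall>\<^sub>F n in sequentially. 0 \<le> qform (y n) x" using yp by (simp add: positive_qform)
    have "qform (y n) x \<le> 2 * qform (id_blinfun - K n) x" for n
      using K(6)[of n] by (simp add: le_iff positive_sa yp K(3) qform_simps) (smt (verit))
    then show "\<forall>\<^sub>F n in sequentially. qform (y n) x \<le> 2 * qform (id_blinfun - K n) x" by simp
  qed
qed

text \<open>Every vector form is absolutely continuous with respect to the trace on positive
  contractions: counterexamples for all d = \<open>(1/2)^k\<close> would contradict the sequence
  version.\<close>

lemma tr_absolutely_continuous:
  assumes "e > 0"
  obtains d where "d > 0"
    "\<And>y. y \<in> M \<Longrightarrow> positive_operator y \<Longrightarrow> y \<le>\<^sub>O id_blinfun \<Longrightarrow> rtr y < d \<Longrightarrow> qform y x < e"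
proof -
  have "\<exists>d>0. \<forall>y. y \<in> M \<and> positive_operator y \<and> y \<le>\<^sub>O id_blinfun \<and> rtr y < d \<longrightarrow> qform y x < e"
  proof (rule ccontr)
    assume neg: "\<not> ?thesis"
    have "\<exists>y. y \<in> M \<and> positive_operator y \<and> y \<le>\<^sub>O id_blinfun \<and> rtr y < (1/2)^k \<and> \<not> qform y x < e" for k :: nat
      using neg zero_less_power[of "1/2::real" k] by simp
    then obtain y where y: "\<And>k::nat. y k \<in> M \<and> positive_operator (y k) \<and> y k \<le>\<^sub>O id_blinfun \<and>
        rtr (y k) < (1/2)^k \<and> \<not> qform (y k) x < e"
      by metis
    have "(\<lambda>k. qform (y k) x) \<longlonglongrightarrow> 0"
      by (rule tr_absolutely_continuous_seq) (use y less_imp_le in blast)+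
    then have "\<forall>\<^sub>F k in sequentially. qform (y k) x < e" using assms by (rule order_tendstoD)
    then show False using y by (auto simp: eventually_sequentially)
  qed
  then show ?thesis using that by blast
qed

text \<open>Absolute continuity is applied to the positive contraction T^* T / R^2, whose trace is
  the rescaled squared 2-norm and whose form at x is the rescaled squared norm of T x.\<close>

lemma n2_controls_strong:
  assumes "e > 0" "R > 0"
  obtains d where "d > 0" "\<And>T. T \<in> M \<Longrightarrow> norm T \<le> R \<Longrightarrow> n2 T < d \<Longrightarrow> norm (T x) < e"
proof -
  have "(e / R)\<^sup>2 > 0" using assms by simp
  then obtain d where d: "d > 0"
    "\<And>y. y \<in> M \<Longrightarrow> positive_operator y \<Longrightarrow> y \<le>\<^sub>O id_blinfun \<Longrightarrow> rtr y < d \<Longrightarrow> qform y x < (e / R)\<^sup>2"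
    by (rule tr_absolutely_continuous[of _ x]) blast
  show ?thesis
  proof (rule that[of "R * sqrt d"])
    show "R * sqrt d > 0" using d assms by simp
    fix T assume T: "T \<in> M" "norm T \<le> R" "n2 T < R * sqrt d"
    define y where "y = (1 / R\<^sup>2) *\<^sub>R (adj T o\<^sub>L T)"
    have "y \<in> M" using T by (simp add: y_def)
    have yp: "positive_operator y" using T unfolding y_def by (intro positive_intros positive_adj_comp) auto
    have "norm (T z) \<le> R * norm z" for z
      using norm_blinfun[of T z] mult_right_mono[OF T(2), of "norm z"] by simp
    then have "(norm (T z))\<^sup>2 \<le> R\<^sup>2 * (norm z)\<^sup>2" for z
      by (metis norm_ge_zero power_mono power_mult_distrib)
    then have "qform y z \<le> (norm z)\<^sup>2" for z
      using assms T by (simp add: y_def qform_simps qform_adj_comp field_simps)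
    then have "y \<le>\<^sub>O id_blinfun" by (simp add: le_iff positive_sa yp qform_simps)
    moreover have "(n2 T)\<^sup>2 < (R * sqrt d)\<^sup>2" using T by (intro power_strict_mono) auto
    then have "rtr y < d" using T d(1) assms by (simp add: y_def tr_scaleR n2_sq power_mult_distrib field_simps)
    ultimately have "qform y x < (e / R)\<^sup>2" using d(2) \<open>y \<in> M\<close> yp by blast
    then have "(norm (T x))\<^sup>2 / R\<^sup>2 < e\<^sup>2 / R\<^sup>2"
      using T by (simp add: y_def qform_simps qform_adj_comp power_divide)
    then have "(norm (T x))\<^sup>2 < e\<^sup>2"
      using assms(2) by (simp add: divide_less_cancel)
    then show "norm (T x) < e" using assms by (simp add: power_less_imp_less_base)
  qed
qed

lemma n2_tendsto_strong:
  assumes X: "\<And>n. X n \<in> M" "\<And>n. norm (X n) \<le> R" and "(\<lambda>n. n2 (X n)) \<longlonglongrightarrow> 0"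
  shows "(\<lambda>n. X n x) \<longlonglongrightarrow> 0"
proof (rule LIMSEQ_I)
  fix e :: real assume "e > 0"
  have R: "max R 1 > 0" "\<And>n. norm (X n) \<le> max R 1" using X by (auto simp: le_max_iff_disj)
  obtain d where d: "d > 0" "\<And>T. T \<in> M \<Longrightarrow> norm T \<le> max R 1 \<Longrightarrow> n2 T < d \<Longrightarrow> norm (T x) < e"
    by (rule n2_controls_strong[OF \<open>e > 0\<close> R(1), of x]) blast
  have "\<forall>\<^sub>F n in sequentially. n2 (X n) < d" using assms(3) d(1) by (rule order_tendstoD)
  then obtain N where "\<forall>n\<ge>N. n2 (X n) < d" unfolding eventually_sequentially by blast
  then show "\<exists>N. \<forall>n\<ge>N. norm (X n x - 0) < e"
    using d(2) X(1) R(2) by (intro exI[of _ N]) simp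
qed

text \<open>Weighted Cauchy-Schwarz: the reciprocals of the weights \<open>2^(Suc l)\<close> sum to
  less than 1. The weights do not depend on the vectors, so the bound lifts to operators.\<close>

lemma norm_sum_square_le:
  fixes a :: "nat \<Rightarrow> 'h"
  shows "(norm (\<Sum>l<L. a l))\<^sup>2 \<le> (\<Sum>l<L. 2^(Suc l) * (norm (a l))\<^sup>2)"
proof (induction L arbitrary: a)
  case (Suc L)
  let ?s = "\<Sum>l<L. a (Suc l)"
  have "(norm (a 0 + ?s))\<^sup>2 \<le> 2 * (norm (a 0))\<^sup>2 + 2 * (norm ?s)\<^sup>2"
    using parallelogram[of "a 0" "- ?s"] by simp
  also have "\<dots> \<le> 2 * (norm (a 0))\<^sup>2 + 2 * (\<Sum>l<L. 2^(Suc l) * (norm (a (Suc l)))\<^sup>2)"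
    using Suc.IH[of "\<lambda>l. a (Suc l)"] by simp
  also have "\<dots> = (\<Sum>l<Suc L. 2^(Suc l) * (norm (a l))\<^sup>2)"
    by (subst sum.lessThan_Suc_shift) (simp add: sum_distrib_left mult_ac)
  finally show ?case by (subst sum.lessThan_Suc_shift)
qed simp

text \<open>Normality only speaks of increasing sequences. The squares of X L - X 0 are therefore
  dominated by the increasing weighted sums v L of squared steps, and the truncated supremum of
  these bounds the limit.\<close>

lemma n2_fatou:
  assumes X: "\<And>n. X n \<in> M" "\<And>n. norm (X n) \<le> R" and lim: "strong_tendsto X T" and e: "e > 0"
    and step: "\<And>n. n2 (X (Suc n) - X n) \<le> e * (1/2)^n"
  shows "n2 (T - X 0) \<le> 3 * e"
proof -
  have TM: "T \<in> M" by (rule vn_strong_limit[OF vn lim X(1)])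
  \<comment> \<open>r bounds the norm of every difference X L - X 0, so that dividing its square by
    r^2 gives a contraction.\<close>
  define r where "r = 2 * max R 1"
  have r: "r > 0" by (auto simp: r_def)
  define v where "v L = (1/r\<^sup>2) *\<^sub>R (\<Sum>l<L. (2^(Suc l)::real) *\<^sub>R (adj (X (Suc l) - X l) o\<^sub>L (X (Suc l) - X l)))" for L
  have vM: "v L \<in> M" for L unfolding v_def by (intro M_intros alg_sum[OF alg]) (simp_all add: X)
  have vp: "positive_operator (v L)" for L unfolding v_def
    by (intro positive_intros positive_sum positive_adj_comp) (simp_all add: X)
  have vmono: "v L \<le>\<^sub>O v (Suc L)" for L
  proof -
    have "v (Suc L) - v L = (1/r\<^sup>2) *\<^sub>R (2^(Suc L) *\<^sub>R (adj (X (Suc L) - X L) o\<^sub>L (X (Suc L) - X L)))"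
      by (simp add: v_def algebra_simps)
    then show ?thesis unfolding le_operator_def
      by (simp only:) (intro positive_intros positive_adj_comp; simp add: X)
  qed
  have "rtr (v L) = (1/r\<^sup>2) * (\<Sum>l<L. 2^(Suc l) * (n2 (X (Suc l) - X l))\<^sup>2)" for L
    unfolding v_def using X by (simp add: tr_scaleR alg_sum[OF alg] tr_sum n2_sq)
  moreover have "(\<Sum>l<L. 2^(Suc l) * (n2 (X (Suc l) - X l))\<^sup>2) \<le> 4 * e\<^sup>2" for L
  proof -
    have "(\<Sum>l<L. 2^(Suc l) * (n2 (X (Suc l) - X l))\<^sup>2) \<le> (\<Sum>l<L. 2^(Suc l) * (e * (1/2)^l)\<^sup>2)"
      by (intro sum_mono mult_left_mono power_mono step) (simp_all add: X)
    also have "\<dots> = (\<Sum>l<L. 2 * e\<^sup>2 * (1/2)^l)"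
      by (intro sum.cong refl) (simp add: power_mult_distrib power2_eq_square power_one_over field_simps)
    also have "\<dots> = 4 * e\<^sup>2 * (1 - (1/2)^L)"
      by (induction L) (simp_all add: algebra_simps)
    also have "\<dots> \<le> 4 * e\<^sup>2" using mult_left_mono[of "1 - (1/2::real)^L" 1 "4 * e\<^sup>2"] by simp
    finally show ?thesis .
  qed
  ultimately have vt: "rtr (v L) \<le> (1/r\<^sup>2) * (4 * e\<^sup>2)" for L
    using r by (simp add: mult_left_mono divide_right_mono)
  obtain k where k: "k \<in> M" "rtr (id_blinfun - k) \<le> (1/r\<^sup>2) * (4 * e\<^sup>2)" "positive_operator k"
    "\<And>y n. positive_operator y \<Longrightarrow> y \<le>\<^sub>O id_blinfun \<Longrightarrow> y \<le>\<^sub>O v n \<Longrightarrow> (1/2) *\<^sub>R y \<le>\<^sub>O id_blinfun - k"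
    by (rule truncated_supremum[where v = v, OF vM vp vmono vt]) blast
  have DL: "(1/2) *\<^sub>R ((1/r\<^sup>2) *\<^sub>R (adj (X L - X 0) o\<^sub>L (X L - X 0))) \<le>\<^sub>O id_blinfun - k" for L
  proof (rule k(4))
    let ?y = "(1/r\<^sup>2) *\<^sub>R (adj (X L - X 0) o\<^sub>L (X L - X 0))"
    have b: "X L - X 0 \<in> bounded_operators" using X by auto
    show yp: "positive_operator ?y" using b by (intro positive_intros positive_adj_comp) auto
    have y: "qform ?y x = (1/r\<^sup>2) * (norm ((X L - X 0) x))\<^sup>2" for x
      using b by (simp add: qform_simps qform_adj_comp)
    have "norm (X L - X 0) \<le> r"
      using norm_triangle_ineq4[of "X L" "X 0"] X(2)[of L] X(2)[of 0] by (simp add: r_def)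
    then have "norm ((X L - X 0) x) \<le> r * norm x" for x
      using norm_blinfun[of "X L - X 0" x] mult_right_mono[of _ _ "norm x"] by fastforce
    then have "(norm ((X L - X 0) x))\<^sup>2 \<le> r\<^sup>2 * (norm x)\<^sup>2" for x
      by (metis norm_ge_zero power_mono power_mult_distrib)
    then have "qform ?y x \<le> (norm x)\<^sup>2" for x unfolding y using r by (simp add: field_simps)
    then show "?y \<le>\<^sub>O id_blinfun"
      by (simp add: le_iff[OF positive_sa[OF yp]] qform_simps(6))
    have "qform ?y x \<le> qform (v L) x" for x
    proof -
      have "(X L - X 0) x = (\<Sum>l<L. (X (Suc l) - X l) x)"
        by (simp add: op_simps sum_lessThan_telescope[of "\<lambda>l. X l x"])
      then have "(norm ((X L - X 0) x))\<^sup>2 \<le> (\<Sum>l<L. 2^(Suc l) * (norm ((X (Suc l) - X l) x))\<^sup>2)"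
        using norm_sum_square_le by simp
      moreover have "qform (v L) x = (1/r\<^sup>2) * (\<Sum>l<L. 2^(Suc l) * (norm ((X (Suc l) - X l) x))\<^sup>2)"
      proof -
        have "qform (\<Sum>l<L. (2^(Suc l)::real) *\<^sub>R (adj (X (Suc l) - X l) o\<^sub>L (X (Suc l) - X l))) x
          = (\<Sum>l<L. 2^(Suc l) * (norm ((X (Suc l) - X l) x))\<^sup>2)" for L
          by (induction L) (simp_all add: qform_simps qform_adj_comp X)
        then show ?thesis by (simp add: v_def qform_simps)
      qed
      ultimately show ?thesis unfolding y using r by (simp add: divide_right_mono)
    qed
    then show "?y \<le>\<^sub>O v L" by (simp add: le_iff positive_sa yp vp)
  qed
  have "adj (T - X 0) o\<^sub>L (T - X 0) \<le>\<^sub>O (2 * r\<^sup>2) *\<^sub>R (id_blinfun - k)"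
  proof -
    have "(norm ((T - X 0) x))\<^sup>2 \<le> 2 * r\<^sup>2 * qform (id_blinfun - k) x" for x
    proof (rule LIMSEQ_le_const2)
      show "(\<lambda>n. (norm ((X n - X 0) x))\<^sup>2) \<longlonglongrightarrow> (norm ((T - X 0) x))\<^sup>2"
        by (intro tendsto_intros strong_tendstoD strong_tendsto_diff lim strong_tendsto_const)
      have "(norm ((X n - X 0) x))\<^sup>2 \<le> 2 * r\<^sup>2 * qform (id_blinfun - k) x" for n
      proof -
        have s: "selfadj (adj (X n - X 0) o\<^sub>L (X n - X 0))" using X by (intro selfadj_adj_comp) auto
        have "qform ((1/2) *\<^sub>R ((1/r\<^sup>2) *\<^sub>R (adj (X n - X 0) o\<^sub>L (X n - X 0)))) x \<le> qform (id_blinfun - k) x"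
          using DL[of n] k(3) s le_iff[OF selfadj_intros(5)[OF selfadj_intros(5)[OF s]] selfadj_intros(4)[OF selfadj_intros(2) positive_sa[OF k(3)]]]
          by blast
        then show ?thesis using r X by (simp add: qform_simps qform_adj_comp field_simps)
      qed
      then show "\<exists>N. \<forall>n\<ge>N. (norm ((X n - X 0) x))\<^sup>2 \<le> 2 * r\<^sup>2 * qform (id_blinfun - k) x" by blast
    qed
    moreover have "selfadj (adj (T - X 0) o\<^sub>L (T - X 0))" using X TM by (intro selfadj_adj_comp) auto
    ultimately show ?thesis
      using X TM positive_sa[OF k(3)] by (simp add: le_iff qform_simps(3) qform_adj_comp)
  qed
  then have "(n2 (T - X 0))\<^sup>2 \<le> 2 * r\<^sup>2 * rtr (id_blinfun - k)"
    using tr_mono[of "adj (T - X 0) o\<^sub>L (T - X 0)" "(2 * r\<^sup>2) *\<^sub>R (id_blinfun - k)"] X TM k(1)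
    by (simp add: n2_sq tr_scaleR)
  also have "\<dots> \<le> 2 * r\<^sup>2 * ((1/r\<^sup>2) * (4 * e\<^sup>2))" by (intro mult_left_mono k) simp
  \<comment> \<open>A factor 2 for the one half lost by truncation and a factor 4 from the geometric
    series; 3 exceeds the square root of 8.\<close>
  also have "\<dots> = 8 * e\<^sup>2" using r by simp
  also have "\<dots> \<le> (3 * e)\<^sup>2" by (simp add: power_mult_distrib)
  finally show ?thesis by (rule power2_le_imp_le) (use e in simp)
qed

definition n2_Cauchy :: "(nat \<Rightarrow> 'h operator) \<Rightarrow> bool"
  where "n2_Cauchy X \<longleftrightarrow> (\<forall>e>0. \<exists>N. \<forall>m\<ge>N. \<forall>n\<ge>N. n2 (X m - X n) < e)"

text \<open>\<open>n2_controls_strong\<close> makes the sequence strongly Cauchy. That the strong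
  limit is also the 2-norm limit follows from \<open>n2_fatou\<close> along a fast
  subsequence.\<close>

theorem n2_complete:
  assumes X: "\<And>n. X n \<in> M" "\<And>n. norm (X n) \<le> R" and C: "n2_Cauchy X"
  obtains T where "T \<in> M" "strong_tendsto X T" "(\<lambda>n. n2 (X n - T)) \<longlonglongrightarrow> 0"
proof -
  have R: "2 * max R 1 > 0" by simp
  have bd: "norm (X m - X n) \<le> 2 * max R 1" for m n
    using norm_triangle_ineq4[of "X m" "X n"] X(2)[of m] X(2)[of n] by linarith
  have "Cauchy (\<lambda>n. X n x)" for x
  proof (rule metric_CauchyI)
    fix e :: real assume "e > 0"
    obtain d where d: "d > 0" "\<And>T. T \<in> M \<Longrightarrow> norm T \<le> 2 * max R 1 \<Longrightarrow> n2 T < d \<Longrightarrow> norm (T x) < e"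
      by (rule n2_controls_strong[OF \<open>e > 0\<close> R, of x]) blast
    obtain N where N: "\<And>m n. m \<ge> N \<Longrightarrow> n \<ge> N \<Longrightarrow> n2 (X m - X n) < d"
      using C d(1) unfolding n2_Cauchy_def by blast
    have "dist (X m x) (X n x) < e" if "m \<ge> N" "n \<ge> N" for m n
      using d(2)[OF _ bd N[OF that]] X(1) by (simp add: dist_norm op_simps)
    then show "\<exists>N. \<forall>m\<ge>N. \<forall>n\<ge>N. dist (X m x) (X n x) < e" by blast
  qed
  from strong_limit_exists[OF X(2) this] obtain T where T: "strong_tendsto X T" by blast
  have TM: "T \<in> M" by (rule vn_strong_limit[OF vn T X(1)])
  have "(\<lambda>n. n2 (X n - T)) \<longlonglongrightarrow> 0"
  proof (rule LIMSEQ_I)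
    fix e :: real assume "e > 0"
    \<comment> \<open>3 (e/5) from \<open>n2_fatou\<close> and e/5 from the Cauchy bound together
      stay below e.\<close>
    have "\<exists>N. \<forall>m\<ge>N. \<forall>n\<ge>N. n2 (X m - X n) < e/5 * (1/2)^j" for j
      using C \<open>e > 0\<close> unfolding n2_Cauchy_def by (metis divide_pos_pos mult_pos_pos zero_less_numeral zero_less_power half_gt_zero zero_less_one)
    then obtain N where N: "\<And>j m n. m \<ge> N j \<Longrightarrow> n \<ge> N j \<Longrightarrow> n2 (X m - X n) < e/5 * (1/2)^j"
      by metis
    \<comment> \<open>Summing all earlier thresholds makes f increasing and at least N j; the
      summand j makes it tend to infinity.\<close>
    define f where "f j = j + (\<Sum>i\<le>j. N i)" for j
    have fN: "f j \<ge> N j" for j unfolding f_def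
      using member_le_sum[of j "{..j}" N] by simp
    have fmono: "f j \<le> f (Suc j)" for j by (simp add: f_def)
    have fj: "f j \<ge> j" for j by (simp add: f_def)
    have lim: "strong_tendsto (\<lambda>j. X (f j)) T"
      unfolding strong_tendsto_def
    proof
      fix x
      have "filterlim f sequentially sequentially"
        by (rule filterlim_at_top_mono[OF filterlim_ident]) (simp add: fj)
      from filterlim_compose[OF strong_tendstoD[OF T] this] show "(\<lambda>j. X (f j) x) \<longlonglongrightarrow> T x" .
    qed
    have "n2 (T - X (f 0)) \<le> 3 * (e/5)"
    proof (rule n2_fatou[where X = "\<lambda>j. X (f j)", OF X(1) X(2) lim])
      show "n2 (X (f (Suc n)) - X (f n)) \<le> e/5 * (1/2)^n" for n
        using N[OF order.trans[OF fN fmono] fN, of n] by simp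
    qed (use \<open>e > 0\<close> in simp)
    then have "n2 (X n - T) < e" if "n \<ge> f 0" for n
      using N[of 0 n "f 0"] fN[of 0] that n2_triangle_diff[of "X n" "X (f 0)" T] n2_commute[of T "X (f 0)"]
        X(1) TM \<open>e > 0\<close> by simp
    then show "\<exists>N. \<forall>n\<ge>N. norm (n2 (X n - T) - 0) < e" using X(1) TM by auto
  qed
  with that TM T show ?thesis by blast
qed

end

section \<open>Extreme points\<close>

context tracial_algebra begin

lemma n2_sq_add_diff:
  assumes "S \<in> M" "T \<in> M"
  shows "(n2 (S + T))\<^sup>2 + (n2 (S - T))\<^sup>2 = 2 * (n2 S)\<^sup>2 + 2 * (n2 T)\<^sup>2"
  using n2_sq_add[of S T] n2_sq_add[of S "- T"] assms by (simp add: n2_minus comp_simps tr_minus)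

lemma n2_sq_Lipschitz:
  assumes "x \<in> M" "y \<in> M" "n2 x \<le> R" "n2 y \<le> R"
  shows "\<bar>(n2 x)\<^sup>2 - (n2 y)\<^sup>2\<bar> \<le> 2 * R * n2 (x - y)"
proof -
  have "\<bar>n2 x - n2 y\<bar> \<le> n2 (x - y)"
    using n2_triangle[of "x - y" y] n2_triangle[of "y - x" x] n2_commute[of x y] assms by auto
  then have "\<bar>n2 x - n2 y\<bar> * \<bar>n2 x + n2 y\<bar> \<le> n2 (x - y) * (2 * R)"
    using assms by (intro mult_mono) auto
  moreover have "(n2 x)\<^sup>2 - (n2 y)\<^sup>2 = (n2 x - n2 y) * (n2 x + n2 y)"
    by (simp add: power2_eq_square algebra_simps)
  ultimately show ?thesis by (simp add: abs_mult mult_ac)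
qed

text \<open>
  A Borwein--Preiss argument: small quadratic perturbations of the strictly concave function
  \<open>- (n2 y)\<^sup>2\<close>, still strictly concave, are constructed so that they attain their infimum on \<open>K\<close>.
\<close>

lemma extreme_point_exists:
  assumes K: "K \<subseteq> M" "K \<noteq> {}" "\<And>x. x \<in> K \<Longrightarrow> norm x \<le> R"
    and closed: "\<And>X T. (\<And>n. X n \<in> K) \<Longrightarrow> strong_tendsto X T \<Longrightarrow> (\<lambda>n. n2 (X n - T)) \<longlonglongrightarrow> 0 \<Longrightarrow> T \<in> K"
  obtains x where "x \<in> K" "\<And>T. T \<in> M \<Longrightarrow> x + T \<in> K \<Longrightarrow> x - T \<in> K \<Longrightarrow> T = 0"
proof -
  have R: "R \<ge> 0" using K(2,3) norm_ge_zero order.trans by blast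
  \<comment> \<open>The \<open>\<delta> n\<close> sum to at most 1/2, so all penalties together
    cannot destroy the concavity of - (n2 y)^2. The accuracy \<open>\<epsilon> n\<close> is chosen
    to make successive near-minimisers \<open>(1/2)^n\<close> close.\<close>
  define \<delta> where "\<delta> n = (1/2::real)^(n + 2)" for n
  define \<epsilon> where "\<epsilon> n = \<delta> n * (1/4)^n" for n
  have pos: "\<delta> n > 0" "\<epsilon> n > 0" for n by (simp_all add: \<delta>_def \<epsilon>_def)
  have \<delta>_sum: "(\<Sum>j<n. \<delta> j) \<le> 1/2" for n
  proof -
    have "(\<Sum>j<n. \<delta> j) = 1/2 - (1/2)^(n + 1)" by (induction n) (simp_all add: \<delta>_def)
    then show ?thesis by simp
  qed
  have near_min: "\<exists>x'\<in>K. g x' \<le> g x \<and> (\<forall>y\<in>K. g x' \<le> g y + e)"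
    if bd: "\<And>y. y \<in> K \<Longrightarrow> b \<le> g y" and "e > 0" "x \<in> K" for g :: "'h operator \<Rightarrow> real" and b e x
  proof -
    have bdd: "bdd_below (g ` K)" using bd by (rule bdd_belowI2)
    obtain x1 where x1: "x1 \<in> K" "g x1 < Inf (g ` K) + e"
      using cINF_less_iff[OF K(2) bdd, of "Inf (g ` K) + e"] \<open>e > 0\<close> by auto
    have low: "Inf (g ` K) \<le> g y" if "y \<in> K" for y by (rule cINF_lower[OF bdd that])
    show ?thesis
    proof (cases "g x1 \<le> g x")
      case True
      then show ?thesis using x1 low by (intro bexI[of _ x1]) force+
    next
      case False
      then show ?thesis using x1 low \<open>x \<in> K\<close> by (intro bexI[of _ x]) force+
    qed
  qed
  define P where "P n s \<longleftrightarrow> snd s \<in> K \<and> (\<forall>y\<in>K. - (R\<^sup>2) \<le> fst s y) \<and> (\<forall>y\<in>K. fst s (snd s) \<le> fst s y + \<epsilon> n)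
     \<and> (n = 0 \<longrightarrow> fst s = (\<lambda>y. - ((n2 y)\<^sup>2)))"
    for n :: nat and s :: "('h operator \<Rightarrow> real) \<times> 'h operator"
  define Q where "Q n s s' \<longleftrightarrow> fst s' = (\<lambda>y. fst s y + \<delta> n * (n2 (y - snd s))\<^sup>2) \<and> fst s' (snd s') \<le> fst s' (snd s)"
    for n :: nat and s s' :: "('h operator \<Rightarrow> real) \<times> 'h operator"
  have n2R: "n2 y \<le> R" if "y \<in> K" for y using n2_le_norm[of y] K(1,3) that by force
  have "\<exists>s. \<forall>n. P n (s n) \<and> Q n (s n) (s (Suc n))"
  proof (rule dependent_nat_choice)
    obtain x where "x \<in> K" using K(2) by blast
    have bd: "- (R\<^sup>2) \<le> - ((n2 y)\<^sup>2)" if "y \<in> K" for y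
      using n2R[OF that] K(1) that by (simp add: power_mono subset_iff)
    from near_min[of "- (R\<^sup>2)" "\<lambda>y. - ((n2 y)\<^sup>2)", OF bd pos(2)[of 0] \<open>x \<in> K\<close>]
    obtain x' where x': "x' \<in> K" "\<And>y. y \<in> K \<Longrightarrow> - ((n2 x')\<^sup>2) \<le> - ((n2 y)\<^sup>2) + \<epsilon> 0" by blast
    show "\<exists>s. P 0 s"
      unfolding P_def using x' bd by (intro exI[of _ "(\<lambda>y. - ((n2 y)\<^sup>2), x')"]) auto
  next
    fix s n assume s: "P n s"
    define g where "g = (\<lambda>y. fst s y + \<delta> n * (n2 (y - snd s))\<^sup>2)"
    have bd: "- (R\<^sup>2) \<le> g y" if "y \<in> K" for y
      using s that pos(1)[of n] zero_le_power2[of "n2 (y - snd s)"] unfolding P_def g_def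
      by (meson add_increasing2 less_imp_le mult_nonneg_nonneg)
    from s have "snd s \<in> K" by (simp add: P_def)
    from near_min[of "- (R\<^sup>2)" g, OF bd pos(2)[of "Suc n"] this]
    obtain x' where "x' \<in> K" "g x' \<le> g (snd s)" "\<forall>y\<in>K. g x' \<le> g y + \<epsilon> (Suc n)" by blast
    then show "\<exists>s'. P (Suc n) s' \<and> Q n s s'"
      using bd unfolding P_def Q_def by (intro exI[of _ "(g, x')"]) (auto simp: g_def)
  qed
  then obtain s where sP: "\<And>n. P n (s n)" and sQ: "\<And>n. Q n (s n) (s (Suc n))" by blast
  define g X where "g n = fst (s n)" and "X n = snd (s n)" for n
  have XK: "X n \<in> K" and gmin: "y \<in> K \<Longrightarrow> g n (X n) \<le> g n y + \<epsilon> n"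
    and g0: "g 0 = (\<lambda>y. - ((n2 y)\<^sup>2))" for n y using sP unfolding P_def g_def X_def by auto
  have gSuc: "g (Suc n) = (\<lambda>y. g n y + \<delta> n * (n2 (y - X n))\<^sup>2)"
    and gdec: "g (Suc n) (X (Suc n)) \<le> g (Suc n) (X n)" for n
    using sQ[of n] unfolding Q_def g_def X_def by auto
  have XM: "X n \<in> M" for n using XK K(1) by blast
  have g: "g n y = (\<Sum>j<n. \<delta> j * (n2 (y - X j))\<^sup>2) - (n2 y)\<^sup>2" for n y
    by (induction n) (simp_all add: g0 gSuc)
  \<comment> \<open>The penalty just added vanishes at X n, so at X (n + 1) it is at most
    \<open>\<epsilon> n\<close>, by which X n may miss the minimum of g n.\<close>
  have dX: "n2 (X (Suc n) - X n) \<le> (1/2)^n" for n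
  proof -
    have "g (Suc n) (X (Suc n)) \<le> g n (X n)" using gdec[of n] by (simp add: gSuc n2_zero)
    moreover have "g n (X n) \<le> g n (X (Suc n)) + \<epsilon> n" by (rule gmin[OF XK])
    ultimately have "\<delta> n * (n2 (X (Suc n) - X n))\<^sup>2 \<le> \<delta> n * (1/4)^n" by (simp add: gSuc \<epsilon>_def)
    then have "(n2 (X (Suc n) - X n))\<^sup>2 \<le> (1/4)^n" using pos(1)[of n] by (simp add: mult_le_cancel_left)
    also have "(1/4::real)^n = ((1/2)^n)\<^sup>2" by (simp add: power2_eq_square flip: power_mult_distrib)
    finally show ?thesis by (rule power2_le_imp_le) simp
  qed
  have tail: "n2 (X m - X n) \<le> 2 * (1/2)^n" if "n \<le> m" for m n
  proof -
    have "n2 (X m - X n) \<le> 2 * (1/2)^n - 2 * (1/2)^m"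
      using that
    proof (induction rule: dec_induct)
      case (step m)
      then show ?case
        using n2_triangle_diff[of "X (Suc m)" "X m" "X n"] dX[of m] XM
        by simp
    qed (simp add: n2_zero)
    moreover have "(0::real) \<le> 2 * (1/2)^m" by simp
    ultimately show ?thesis by linarith
  qed
  have "n2_Cauchy X"
    unfolding n2_Cauchy_def
  proof (intro allI impI)
    fix e :: real assume "e > 0"
    have sq: "(n2 (X m - X n))\<^sup>2 \<le> (2 * (1/2)^n)\<^sup>2" if "n \<le> m" for m n
      using tail[OF that] XM by (intro power_mono) auto
    have "(\<lambda>n. (2 * (1/2::real)^n)\<^sup>2) \<longlonglongrightarrow> (2 * 0)\<^sup>2"
      by (intro tendsto_intros LIMSEQ_power_zero) simp
    then have "(\<lambda>n. (2 * (1/2::real)^n)\<^sup>2) \<longlonglongrightarrow> 0" by (simp only: mult_zero_right zero_power2)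
    from small_tails[OF sq this n2_commute[OF XM XM] \<open>e > 0\<close>]
    show "\<exists>N. \<forall>m\<ge>N. \<forall>n\<ge>N. n2 (X m - X n) < e" .
  qed
  from n2_complete[OF XM K(3)[OF XK] this] obtain x
    where x: "x \<in> M" "strong_tendsto X x" "(\<lambda>n. n2 (X n - x)) \<longlonglongrightarrow> 0" .
  have xK: "x \<in> K" by (rule closed[OF XK x(2,3)])
  \<comment> \<open>Half of the constant comes from the penalties, half from - (n2 y)^2. It is
    independent of n, so the limit x minimises g n up to an error tending to 0.\<close>
  have gLip: "g n x - g n (X n) \<le> 4 * R * n2 (X n - x)" for n
  proof -
    have n2R': "n2 (y - X j) \<le> 2 * R" if "y \<in> K" for y j
      using n2_triangle[of y "- X j"] n2R[OF that] n2R[OF XK, of j] that K(1) XM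
      by (force simp: n2_minus)
    have "(\<Sum>j<n. \<delta> j * (n2 (x - X j))\<^sup>2) - (\<Sum>j<n. \<delta> j * (n2 (X n - X j))\<^sup>2)
        = (\<Sum>j<n. \<delta> j * ((n2 (x - X j))\<^sup>2 - (n2 (X n - X j))\<^sup>2))"
      by (simp add: sum_subtractf right_diff_distrib)
    also have "\<dots> \<le> (\<Sum>j<n. \<delta> j * (4 * R * n2 (X n - x)))"
    proof (intro sum_mono mult_left_mono)
      fix j
      show "(n2 (x - X j))\<^sup>2 - (n2 (X n - X j))\<^sup>2 \<le> 4 * R * n2 (X n - x)"
        using n2_sq_Lipschitz[of "x - X j" "X n - X j" "2 * R"] x(1) XM n2R'[OF xK] n2R'[OF XK] n2_commute[of x "X n"]
        by simp
    qed (use pos less_imp_le in blast)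
    also have "\<dots> = (\<Sum>j<n. \<delta> j) * (4 * R * n2 (X n - x))" by (simp add: sum_distrib_right)
    also have "\<dots> \<le> 1/2 * (4 * R * n2 (X n - x))"
      using R x(1) XM by (intro mult_right_mono \<delta>_sum) simp
    finally have "(\<Sum>j<n. \<delta> j * (n2 (x - X j))\<^sup>2) - (\<Sum>j<n. \<delta> j * (n2 (X n - X j))\<^sup>2) \<le> 2 * R * n2 (X n - x)" by simp
    moreover have "(n2 (X n))\<^sup>2 - (n2 x)\<^sup>2 \<le> 2 * R * n2 (X n - x)"
      using n2_sq_Lipschitz[of "X n" x R] x(1) XM n2R[OF xK] n2R[OF XK] by simp
    ultimately show ?thesis unfolding g by simp
  qed
  have "T = 0" if T: "T \<in> M" "x + T \<in> K" "x - T \<in> K" for T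
  proof -
    \<comment> \<open>The second difference of g n in direction T is twice (sum of
      \<open>\<delta>\<close> - 1) times (n2 T)^2, hence at most - (n2 T)^2, while near-minimality
      at x bounds it below.\<close>
    have bound: "(n2 T)\<^sup>2 \<le> 2 * (4 * R * n2 (X n - x)) + 2 * \<epsilon> n" for n
    proof -
      have "(\<Sum>j<n. \<delta> j * (n2 (x + T - X j))\<^sup>2) + (\<Sum>j<n. \<delta> j * (n2 (x - T - X j))\<^sup>2)
        = (\<Sum>j<n. \<delta> j * (2 * (n2 (x - X j))\<^sup>2 + 2 * (n2 T)\<^sup>2))"
      proof (unfold sum.distrib[symmetric], intro sum.cong refl)
        fix j
        have e: "x + T - X j = (x - X j) + T" "x - T - X j = (x - X j) - T" by simp_all
        have "(n2 (x + T - X j))\<^sup>2 + (n2 (x - T - X j))\<^sup>2 = 2 * (n2 (x - X j))\<^sup>2 + 2 * (n2 T)\<^sup>2"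
          unfolding e by (rule n2_sq_add_diff) (use x XM T in auto)
        then show "\<delta> j * (n2 (x + T - X j))\<^sup>2 + \<delta> j * (n2 (x - T - X j))\<^sup>2 = \<delta> j * (2 * (n2 (x - X j))\<^sup>2 + 2 * (n2 T)\<^sup>2)"
          by (simp only: flip: distrib_left)
      qed
      also have "\<dots> = 2 * (\<Sum>j<n. \<delta> j * (n2 (x - X j))\<^sup>2) + 2 * ((\<Sum>j<n. \<delta> j) * (n2 T)\<^sup>2)"
        by (simp add: distrib_left sum.distrib sum_distrib_left sum_distrib_right mult_ac)
      finally have sums: "(\<Sum>j<n. \<delta> j * (n2 (x + T - X j))\<^sup>2) + (\<Sum>j<n. \<delta> j * (n2 (x - T - X j))\<^sup>2)
         = 2 * (\<Sum>j<n. \<delta> j * (n2 (x - X j))\<^sup>2) + 2 * ((\<Sum>j<n. \<delta> j) * (n2 T)\<^sup>2)" .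
      have "(\<Sum>j<n. \<delta> j) * (n2 T)\<^sup>2 \<le> 1/2 * (n2 T)\<^sup>2" by (intro mult_right_mono \<delta>_sum) simp
      then have "g n (x + T) + g n (x - T) \<le> 2 * g n x - (n2 T)\<^sup>2"
        unfolding g using sums n2_sq_add_diff[OF x(1) T(1)] by simp
      then show ?thesis using gmin[OF T(2), of n] gmin[OF T(3), of n] gLip[of n] by simp
    qed
    have "(\<lambda>n. 2 * (4 * R * n2 (X n - x)) + 2 * \<epsilon> n) \<longlonglongrightarrow> 2 * (4 * R * 0) + 2 * 0"
    proof (intro tendsto_intros x)
      have "\<epsilon> = (\<lambda>n. (1/4) * (1/8)^n)"
        by (rule ext) (simp add: \<epsilon>_def \<delta>_def power_add mult.assoc flip: power_mult_distrib)
      then show "\<epsilon> \<longlonglongrightarrow> 0"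
        by (simp only:) (intro tendsto_mult_right_zero LIMSEQ_power_zero, simp)
    qed
    from LIMSEQ_le_const[OF this] bound have "(n2 T)\<^sup>2 \<le> 2 * (4 * R * 0) + 2 * 0" by blast
    then have "(n2 T)\<^sup>2 \<le> 0" by simp
    then show "T = 0" using n2_eq_zero[OF T(1)] by simp
  qed
  with xK that show ?thesis by blast
qed

end

section \<open>Halving projections\<close>

lemma projection_le_id: "is_projection p \<Longrightarrow> p \<le>\<^sub>O id_blinfun"
proof -
  assume p: "is_projection p"
  have "is_projection (id_blinfun - p)"
    using projD[OF p] by (intro is_projectionI) (auto simp: comp_simps)
  then show ?thesis by (simp add: le_operator_def projD(6))
qed

text \<open>On y - p y the form of p vanishes, hence that of x, and
  \<open>positive_norm_square_le\<close> makes x itself vanish there.\<close>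

lemma comp_projection_of_le:
  assumes x: "positive_operator x" and p: "is_projection p" and le: "x \<le>\<^sub>O p"
  shows "x o\<^sub>L p = x" "p o\<^sub>L x = x"
proof -
  have sx: "selfadj x" by (rule positive_sa[OF x])
  have qp: "qform x y \<le> (norm (p y))\<^sup>2" for y using le by (simp add: le_iff sx projD[OF p])
  have np: "(norm (p y))\<^sup>2 \<le> 1 * (norm y)\<^sup>2" for y
  proof -
    have "qform p y \<le> (norm y)\<^sup>2"
      using projection_le_id[OF p] by (simp add: le_iff projD(3)[OF p] qform_simps(6))
    then show ?thesis unfolding projD(5)[OF p] by simp
  qed
  have "x (y - p y) = 0" for y
  proof -
    have "(norm (x (y - p y)))\<^sup>2 \<le> 1 * qform x (y - p y)"
      by (rule positive_norm_square_le[OF x]) (use qp np order.trans in blast)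
    also have "\<dots> \<le> 0" using qp[of "y - p y"] by (simp add: op_simps projD(4)[OF p])
    finally show ?thesis by simp
  qed
  then show 1: "x o\<^sub>L p = x" by (intro blinfun_eqI) (simp add: op_simps)
  show "p o\<^sub>L x = x" using arg_cong[OF 1, of adj] sx projD[OF p] by (simp add: adj_comp selfadj_def)
qed

lemma projection_diff:
  assumes "is_projection p" "is_projection q" "q \<le>\<^sub>O p" shows "is_projection (p - q)"
  using comp_projection_of_le[OF projD(6)[OF assms(2)] assms(1,3)] projD[OF assms(1)] projD[OF assms(2)]
  by (intro is_projectionI) (auto simp: comp_simps)

text \<open>The kernel of the expectation is expressed by the trace pairing with \<open>A\<close>,
  which passes to 2-norm limits. T is self-adjoint because x + t and x - t must remain
  positive.\<close>

locale masa_kernel = tracial_algebra M \<tau>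
  for M :: "'h::complex_hilbert operator set" and \<tau> :: "'h operator \<Rightarrow> complex" +
  fixes A :: "'h operator set"
  assumes A_M: "A \<subseteq> M" and A_id: "id_blinfun \<in> A"
    and kernel: "\<And>P. P \<in> M \<Longrightarrow> is_projection P \<Longrightarrow> P \<noteq> 0 \<Longrightarrow>
      \<exists>T\<in>M. selfadj T \<and> T \<noteq> 0 \<and> P o\<^sub>L T o\<^sub>L P = T \<and> (\<forall>a\<in>A. \<tau> (a o\<^sub>L T) = 0)"
begin

text \<open>This says that the conditional expectation of \<open>T\<close> onto \<open>A\<close> is the constant \<open>c\<close>.\<close>

definition const_expectation :: "real \<Rightarrow> 'h operator \<Rightarrow> bool"
  where "const_expectation c T \<longleftrightarrow> (\<forall>a\<in>A. \<tau> (a o\<^sub>L T) = of_real c * \<tau> a)"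

lemma const_expectation_trace: "const_expectation c T \<Longrightarrow> \<tau> T = of_real c"
  using A_id by (auto simp: const_expectation_def tr_id dest!: bspec[of A _ id_blinfun])

lemma half_projection:
  assumes p: "p \<in> M" "is_projection p" and c: "const_expectation c p"
  obtains q where "q \<in> M" "is_projection q" "q \<le>\<^sub>O p" "const_expectation (c/2) q"
proof -
  define K where "K = {x \<in> M. positive_operator x \<and> x \<le>\<^sub>O p \<and> const_expectation (c/2) x}"
  have AM: "a \<in> A \<Longrightarrow> a \<in> M" for a using A_M by blast
  have psa: "selfadj p" by (rule projD[OF p(2)])
  have "(1/2) *\<^sub>R p \<in> K"
  proof -
    have "const_expectation (c/2) ((1/2) *\<^sub>R p)"
      using c p AM by (auto simp: const_expectation_def comp_simps tr_scaleR)
    moreover have "positive_operator ((1/2) *\<^sub>R p)" by (intro positive_intros projD[OF p(2)]) simp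
    moreover have "(1/2) *\<^sub>R p \<le>\<^sub>O p"
      using positive_qform[OF projD(6)[OF p(2)]] by (simp add: le_iff psa qform_simps)
    ultimately show ?thesis using p(1) by (simp add: K_def)
  qed
  moreover have "norm x \<le> 1" if "x \<in> K" for x
  proof (rule norm_le_of_qform)
    show xp: "positive_operator x" using that by (simp add: K_def)
    have "x \<le>\<^sub>O id_blinfun" using le_trans_op[OF _ projection_le_id[OF p(2)]] that by (auto simp: K_def)
    then show "qform x y \<le> 1 * (norm y)\<^sup>2" for y
      by (simp add: le_iff positive_sa[OF xp] qform_simps)
  qed simp
  moreover have "T \<in> K" if X: "\<And>n. X n \<in> K" and s: "strong_tendsto X T" and z: "(\<lambda>n. n2 (X n - T)) \<longlonglongrightarrow> 0" for X T
  proof -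
    have XM: "X n \<in> M" for n using X by (simp add: K_def)
    have TM: "T \<in> M" by (rule vn_strong_limit[OF vn s XM])
    have "\<tau> (a o\<^sub>L T) = of_real (c/2) * \<tau> a" if a: "a \<in> A" for a
    proof -
      have "(\<lambda>n. \<tau> (a o\<^sub>L X n) - \<tau> (a o\<^sub>L T)) \<longlonglongrightarrow> 0"
      proof (rule Lim_null_comparison)
        have "norm (\<tau> (a o\<^sub>L X n) - \<tau> (a o\<^sub>L T)) \<le> norm a * n2 (X n - T)" for n
        proof -
          have "\<tau> (a o\<^sub>L X n) - \<tau> (a o\<^sub>L T) = \<tau> (a o\<^sub>L (X n - T))"
            using AM[OF a] XM TM by (simp add: comp_simps tr_diff)
          then show ?thesis
            using tr_le_n2[of "a o\<^sub>L (X n - T)"] n2_comp_left[of a "X n - T"] AM[OF a] XM TM by simp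
        qed
        then show "\<forall>\<^sub>F n in sequentially. norm (\<tau> (a o\<^sub>L X n) - \<tau> (a o\<^sub>L T)) \<le> norm a * n2 (X n - T)" by simp
        show "(\<lambda>n. norm a * n2 (X n - T)) \<longlonglongrightarrow> 0" by (rule tendsto_mult_right_zero[OF z])
      qed
      moreover have "\<tau> (a o\<^sub>L X n) = of_real (c/2) * \<tau> a" for n
        using X[of n] a by (simp add: K_def const_expectation_def)
      ultimately show ?thesis by (simp add: LIMSEQ_const_iff)
    qed
    then have "const_expectation (c/2) T" by (simp add: const_expectation_def)
    moreover have "positive_operator T" by (rule strong_tendsto_positive[OF s]) (use X in \<open>simp add: K_def\<close>)
    moreover have "T \<le>\<^sub>O p" by (rule strong_tendsto_le[OF s]) (use X in \<open>simp add: K_def\<close>)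
    ultimately show ?thesis using TM by (simp add: K_def)
  qed
  ultimately obtain x where xK: "x \<in> K" and ext: "\<And>T. T \<in> M \<Longrightarrow> x + T \<in> K \<Longrightarrow> x - T \<in> K \<Longrightarrow> T = 0"
    using extreme_point_exists[of K 1] unfolding K_def by blast
  then have x: "x \<in> M" "positive_operator x" "x \<le>\<^sub>O p" "const_expectation (c/2) x" by (auto simp: K_def)
  have xsa: "selfadj x" by (rule positive_sa[OF x(2)])
  note xp = comp_projection_of_le[OF x(2) p(2) x(3)]
  have x1: "x \<le>\<^sub>O id_blinfun" by (rule le_trans_op[OF x(3) projection_le_id[OF p(2)]])
  define g where "g = x - (x o\<^sub>L x)"
  have gM: "g \<in> M" using x by (simp add: g_def)
  have gsa: "selfadj g" unfolding g_def using xsa by (simp add: selfadj_comp)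
  have xx: "qform (x o\<^sub>L x) y = (norm (x y))\<^sup>2" for y
    using qform_adj_comp[of x y] xsa by (simp add: selfadj_def)
  have gp: "positive_operator g"
    unfolding positive_iff using gsa square_le_self[OF x(2) x1] by (simp add: g_def qform_simps xx)
  have gx: "qform g y \<le> qform x y" for y by (simp add: g_def qform_simps xx)
  \<comment> \<open>(p - x)^2 = p - x - g gives g <= p - x. Together with g <= x it leaves room
    below and above x for perturbations bounded by g.\<close>
  have gpx: "qform g y \<le> qform p y - qform x y" for y
  proof -
    have "(p - x) o\<^sub>L (p - x) = p - x - g" using xp projD[OF p(2)] by (simp add: comp_simps g_def)
    then have "positive_operator (p - x - g)" using positive_square[of "p - x"] psa xsa by simp
    from positive_qform[OF this, of y] show ?thesis by (simp add: qform_simps)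
  qed
  have "g = 0"
  proof (rule ccontr)
    assume "g \<noteq> 0"
    from positive_dominates_projection[OF vn gM gp this]
    obtain P e where P: "P \<in> M" "is_projection P" "P \<noteq> 0" "e > 0" "e *\<^sub>R P \<le>\<^sub>O g" .
    obtain T where T: "T \<in> M" "selfadj T" "T \<noteq> 0" "P o\<^sub>L T o\<^sub>L P = T" "\<And>a. a \<in> A \<Longrightarrow> \<tau> (a o\<^sub>L T) = 0"
      using kernel[OF P(1-3)] by blast
    \<comment> \<open>Norm e and support in P put t between - e P and e P, hence between - g and
      g.\<close>
    define t where "t = (e / norm T) *\<^sub>R T"
    have t: "t \<in> M" "selfadj t" "t \<noteq> 0" "norm t = e" using T P(4) by (simp_all add: t_def)
    have tA: "\<tau> (a o\<^sub>L t) = 0" if "a \<in> A" for a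
      using T(1,5) AM that by (simp add: t_def comp_simps tr_scaleR)
    have tq: "\<bar>qform t y\<bar> \<le> qform g y" for y
    proof -
      have "P o\<^sub>L t o\<^sub>L P = t" using T(4) by (simp add: t_def comp_simps)
      then have "qform t y = qform t (P y)" using qform_sandwich[OF projD(3)[OF P(2)], of t y] by simp
      then have "\<bar>qform t y\<bar> \<le> e * (norm (P y))\<^sup>2" using abs_qform_le[of t "P y"] t(4) by simp
      also have "\<dots> = qform (e *\<^sub>R P) y" by (simp add: qform_simps projD(5)[OF P(2)])
      also have "\<dots> \<le> qform g y" using P(5) gsa projD(3)[OF P(2)] by (simp add: le_iff)
      finally show ?thesis .
    qed
    have "x + s *\<^sub>R t \<in> K" if s: "s = 1 \<or> s = - 1" for s
    proof -
      have q: "\<bar>qform (s *\<^sub>R t) y\<bar> \<le> qform g y" for y using tq[of y] s by (auto simp: qform_simps)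
      have sap: "selfadj (x + s *\<^sub>R t)" using xsa t(2) by simp
      have "0 \<le> qform (x + s *\<^sub>R t) y" for y using q[of y] gx[of y] by (simp only: qform_simps(1))
      moreover have "qform (x + s *\<^sub>R t) y \<le> qform p y" for y
        using q[of y] gpx[of y] by (simp only: qform_simps(1))
      moreover have "const_expectation (c/2) (x + s *\<^sub>R t)"
        using x t(1) tA AM by (auto simp: const_expectation_def comp_simps tr_add tr_scaleR)
      ultimately show ?thesis using x t(1) sap psa by (simp add: K_def positive_iff le_iff)
    qed
    from this[of 1] this[of "-1"] ext[OF t(1)] t(3) show False by simp
  qed
  then have "x o\<^sub>L x = x" by (simp add: g_def)
  then have "is_projection x" by (rule is_projectionI[OF xsa])
  with that x show ?thesis by blast
qed

section \<open>The dyadic tree of projections\<close>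

definition half :: "nat \<Rightarrow> 'h operator \<Rightarrow> 'h operator"
  where "half n p = (SOME q. q \<in> M \<and> is_projection q \<and> q \<le>\<^sub>O p \<and> const_expectation ((1/2)^n / 2) q)"

text \<open>The children of node k are 2 k and 2 k + 1 on the next level. Level n repeats with
  period 2^n, so membership and expectation hold for every k, but orthogonality only for distinct k
  below 2^n.\<close>

primrec dyadic :: "nat \<Rightarrow> nat \<Rightarrow> 'h operator"
  where "dyadic 0 k = id_blinfun"
  | "dyadic (Suc n) k = (if even k then half n (dyadic n (k div 2))
      else dyadic n (k div 2) - half n (dyadic n (k div 2)))"

lemma half:
  assumes "p \<in> M" "is_projection p" "const_expectation ((1/2)^n) p"
  shows "half n p \<in> M \<and> is_projection (half n p) \<and> half n p \<le>\<^sub>O p \<and> const_expectation ((1/2)^n / 2) (half n p)"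
  unfolding half_def by (rule someI_ex) (use half_projection[OF assms] in blast)

lemma dyadic: "dyadic n k \<in> M \<and> is_projection (dyadic n k) \<and> const_expectation ((1/2)^n) (dyadic n k)"
proof (induction n arbitrary: k)
  case 0
  have "is_projection (id_blinfun :: 'h operator)" by (rule is_projectionI) auto
  then show ?case by (simp add: const_expectation_def)
next
  case (Suc n)
  let ?p = "dyadic n (k div 2)"
  have p: "?p \<in> M" "is_projection ?p" "const_expectation ((1/2)^n) ?p" using Suc by auto
  note h = half[OF p]
  have "const_expectation ((1/2)^n / 2) (?p - half n ?p)"
    using p h A_M by (auto simp: const_expectation_def comp_simps subset_iff tr_diff algebra_simps)
  then show ?case using h p projection_diff by auto
qed

lemmas dyadic_M = dyadic[THEN conjunct1]
lemmas dyadic_proj = dyadic[THEN conjunct2, THEN conjunct1]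
lemmas dyadic_expectation = dyadic[THEN conjunct2, THEN conjunct2]

lemma half_dyadic: "half n (dyadic n k) \<in> M" "is_projection (half n (dyadic n k))" "half n (dyadic n k) \<le>\<^sub>O dyadic n k"
  using half[OF dyadic_M dyadic_proj dyadic_expectation] by blast+

lemma dyadic_Suc_sum: "dyadic (Suc n) (2 * k) + dyadic (Suc n) (Suc (2 * k)) = dyadic n k"
  by simp

lemma half_dyadic_comp:
  "half n (dyadic n k) o\<^sub>L dyadic n k = half n (dyadic n k)"
  "dyadic n k o\<^sub>L half n (dyadic n k) = half n (dyadic n k)"
  using comp_projection_of_le[OF projD(6)[OF half_dyadic(2)] dyadic_proj half_dyadic(3)] by blast+

lemma dyadic_Suc_comp:
  "dyadic (Suc n) k o\<^sub>L dyadic n (k div 2) = dyadic (Suc n) k"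
  "dyadic n (k div 2) o\<^sub>L dyadic (Suc n) k = dyadic (Suc n) k"
  by (simp_all add: half_dyadic_comp comp_simps projD(2)[OF dyadic_proj])

text \<open>Siblings are q and p - q with q <= p. Otherwise the two parents can be inserted between
  the factors, and they are orthogonal by induction.\<close>

lemma dyadic_orthogonal: "j < 2^n \<Longrightarrow> k < 2^n \<Longrightarrow> j \<noteq> k \<Longrightarrow> dyadic n j o\<^sub>L dyadic n k = 0"
proof (induction n arbitrary: j k)
  case (Suc n)
  show ?case
  proof (cases "j div 2 = k div 2")
    case True
    then have "even j \<noteq> even k" using Suc.prems(3) by (metis dvd_mult_div_cancel odd_two_times_div_two_succ)
    then show ?thesis using True
      by (auto simp: comp_simps half_dyadic_comp projD(2)[OF half_dyadic(2)])
  next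
    case False
    then have 0: "dyadic n (j div 2) o\<^sub>L dyadic n (k div 2) = 0"
      using Suc.prems by (intro Suc.IH) auto
    have "dyadic (Suc n) j o\<^sub>L dyadic (Suc n) k
      = (dyadic (Suc n) j o\<^sub>L dyadic n (j div 2)) o\<^sub>L (dyadic n (k div 2) o\<^sub>L dyadic (Suc n) k)"
      by (simp only: dyadic_Suc_comp)
    also have "\<dots> = dyadic (Suc n) j o\<^sub>L (dyadic n (j div 2) o\<^sub>L dyadic n (k div 2)) o\<^sub>L dyadic (Suc n) k"
      by (simp only: comp_assoc)
    finally show ?thesis by (simp only: 0 comp.zero_left comp.zero_right)
  qed
qed simp

lemma sum_pairs: "(\<Sum>k<2 * m. f k) = (\<Sum>k<m. f (2 * k) + f (Suc (2 * k)))" for f :: "nat \<Rightarrow> 'h operator"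
  by (induction m) (simp_all add: algebra_simps)

section \<open>Step operators on the levels of the tree\<close>

text \<open>The analogue of a function that is constant on the dyadic intervals of length
  \<open>(1/2)^n\<close>.\<close>

definition step_operator :: "nat \<Rightarrow> (nat \<Rightarrow> complex) \<Rightarrow> 'h operator"
  where "step_operator n c = (\<Sum>k<2^n. c k *\<^sub>O dyadic n k)"

lemma scale_operator_simps:
  "c *\<^sub>O (S + T) = c *\<^sub>O S + c *\<^sub>O T" "(c + d) *\<^sub>O T = c *\<^sub>O T + d *\<^sub>O T"
  "c *\<^sub>O d *\<^sub>O T = (c * d) *\<^sub>O T" "c *\<^sub>O 0 = 0" "1 *\<^sub>O T = T"
  for S T :: "'h operator"
  by (auto intro!: blinfun_eqI simp: op_simps scaleC_add_right scaleC_add_left scaleC_scaleC)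

lemma scale_operator_sum: "c *\<^sub>O (sum f I) = (\<Sum>i\<in>I. c *\<^sub>O (f i :: 'h operator))"
  by (induction I rule: infinite_finite_induct) (simp_all add: scale_operator_simps)

lemma step_operator_M: "step_operator n c \<in> M"
  unfolding step_operator_def by (intro alg_sum[OF alg]) (simp add: dyadic_M)

text \<open>Both children inherit the coefficient of their parent. This is how two step operators
  are brought to a common level, where they multiply coefficientwise.\<close>

lemma step_operator_Suc: "step_operator n c = step_operator (Suc n) (\<lambda>k. c (k div 2))"
proof -
  have "step_operator (Suc n) (\<lambda>k. c (k div 2)) =
      (\<Sum>k<2^n. c k *\<^sub>O dyadic (Suc n) (2 * k) + c k *\<^sub>O dyadic (Suc n) (Suc (2 * k)))"
    unfolding step_operator_def power_Suc sum_pairs by simp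
  also have "\<dots> = step_operator n c"
    unfolding step_operator_def by (simp only: scale_operator_simps(1)[symmetric] dyadic_Suc_sum)
  finally show ?thesis ..
qed

lemma step_operator_refine: "n \<le> m \<Longrightarrow> \<exists>d. step_operator n c = step_operator m d"
  by (induction rule: dec_induct) (auto, metis step_operator_Suc)

lemma step_operator_one: "step_operator n (\<lambda>_. 1) = id_blinfun"
proof (induction n)
  case (Suc n) then show ?case using step_operator_Suc[of n "\<lambda>_. 1"] by simp
qed (simp add: step_operator_def scale_operator_simps)

lemma step_operator_add: "step_operator n c + step_operator n d = step_operator n (\<lambda>k. c k + d k)"
  by (simp add: step_operator_def scale_operator_simps sum.distrib)

lemma step_operator_scale: "a *\<^sub>O step_operator n c = step_operator n (\<lambda>k. a * c k)"
  by (simp add: step_operator_def scale_operator_sum scale_operator_simps)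

lemma step_operator_comp_dyadic:
  assumes "k < 2^n" shows "step_operator n c o\<^sub>L dyadic n k = c k *\<^sub>O dyadic n k"
proof -
  have "step_operator n c o\<^sub>L dyadic n k = (\<Sum>j<2^n. c j *\<^sub>O (dyadic n j o\<^sub>L dyadic n k))"
    by (simp add: step_operator_def comp.sum_left scale_operator_comp)
  also have "\<dots> = (\<Sum>j<2^n. if j = k then c k *\<^sub>O dyadic n k else 0)"
    using dyadic_orthogonal assms
    by (intro sum.cong refl) (auto simp: projD(2)[OF dyadic_proj] scale_operator_simps)
  finally show ?thesis using assms by simp
qed

lemma step_operator_comp: "step_operator n c o\<^sub>L step_operator n d = step_operator n (\<lambda>k. c k * d k)"
proof -
  have b: "step_operator n c \<in> bounded_operators" using step_operator_M by blast
  have "step_operator n c o\<^sub>L step_operator n d = (\<Sum>k<2^n. d k *\<^sub>O (step_operator n c o\<^sub>L dyadic n k))"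
    by (subst (2) step_operator_def) (simp add: comp.sum_right scale_operator_comp b)
  also have "\<dots> = step_operator n (\<lambda>k. c k * d k)"
    unfolding step_operator_def[of n "\<lambda>k. c k * d k"]
    by (intro sum.cong refl) (simp add: step_operator_comp_dyadic scale_operator_simps mult.commute)
  finally show ?thesis .
qed

lemma step_operator_adj: "adj (step_operator n c) = step_operator n (\<lambda>k. cnj (c k))"
proof -
  have b: "dyadic n k \<in> bounded_operators" "adj (dyadic n k) = dyadic n k" for k
    using projD(3)[OF dyadic_proj] by (auto simp: selfadj_def)
  show ?thesis
  proof (rule adj_eqI)
    fix x y
    show "cinner (step_operator n c x) y = cinner x (step_operator n (\<lambda>k. cnj (c k)) y)"
      using b by (simp add: step_operator_def blinfun.sum_left cinner.sum_left cinner.sum_right cinner_simps cinner_adj)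
  qed
qed

definition step_algebra :: "'h operator set"
  where "step_algebra = {step_operator n c | n c. True}"

lemma step_algebra_common:
  assumes "S \<in> step_algebra" "T \<in> step_algebra"
  obtains n c d where "S = step_operator n c" "T = step_operator n d"
proof -
  obtain i a j b where "S = step_operator i a" "T = step_operator j b" using assms by (auto simp: step_algebra_def)
  then show ?thesis
    using step_operator_refine[of i "max i j" a] step_operator_refine[of j "max i j" b] that by auto
qed

lemma step_algebra: "selfadjoint_subalgebra step_algebra" "abelian_algebra step_algebra"
  "id_blinfun \<in> step_algebra" "step_algebra \<subseteq> M"
proof -
  have intro: "step_operator n c \<in> step_algebra" for n c by (auto simp: step_algebra_def)
  show sub: "step_algebra \<subseteq> M" by (auto simp: step_algebra_def step_operator_M)
  show "id_blinfun \<in> step_algebra" using intro[of 0 "\<lambda>_. 1"] by (simp add: step_operator_one)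
  show "abelian_algebra step_algebra"
    unfolding abelian_algebra_def
    by (intro ballI) (erule (1) step_algebra_common, simp add: step_operator_comp mult.commute)
  have "0 \<in> step_algebra" using intro[of 0 "\<lambda>_. 0"] step_operator_scale[of 0 0 "\<lambda>_. 0"]
    by (simp add: step_operator_def) (metis blinfun_eqI scaleC_zero_left scale_operator_apply zero_blinfun.rep_eq)
  moreover have "S + T \<in> step_algebra \<and> S o\<^sub>L T \<in> step_algebra" if "S \<in> step_algebra" "T \<in> step_algebra" for S T
    using that by (rule step_algebra_common) (simp add: step_operator_add step_operator_comp intro)
  moreover have "c *\<^sub>O T \<in> step_algebra \<and> adj T \<in> step_algebra" if "T \<in> step_algebra" for c T
    using that by (auto simp: step_algebra_def step_operator_scale step_operator_adj) blast+
  ultimately show "selfadjoint_subalgebra step_algebra"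
    using sub M_bop unfolding selfadjoint_subalgebra_def by blast
qed

lemma dyadic_in_step_algebra: "k < 2^n \<Longrightarrow> dyadic n k \<in> step_algebra"
proof -
  assume k: "k < 2^n"
  have "step_operator n (\<lambda>j. if j = k then 1 else 0) = dyadic n k"
  proof -
    have "step_operator n (\<lambda>j. if j = k then 1 else 0) = (\<Sum>j<2^n. if j = k then dyadic n k else 0)"
      unfolding step_operator_def
      by (intro sum.cong refl) (auto intro!: blinfun_eqI)
    then show ?thesis using k by simp
  qed
  then show ?thesis unfolding step_algebra_def
    by (intro CollectI exI[of _ n] exI[of _ "\<lambda>j. if j = k then 1 else 0"]) simp
qed

lemma sum_dyadic: "(\<Sum>k<2^n. dyadic n k) = id_blinfun"
  using step_operator_one[of n] by (simp add: step_operator_def scale_operator_simps)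

lemma step_algebra_orthogonal:
  assumes a: "a \<in> A" and T: "T \<in> step_algebra"
  shows "\<tau> (a o\<^sub>L T) = \<tau> a * \<tau> T"
proof -
  obtain n c where T: "T = step_operator n c" using T by (auto simp: step_algebra_def)
  have aM: "a \<in> M" using a A_M by blast
  have t: "\<tau> (b o\<^sub>L T) = \<tau> b * (\<Sum>k<2^n. c k * of_real ((1/2)^n))" if b: "b \<in> A" for b
  proof -
    have bM: "b \<in> M" using b A_M by blast
    have "\<tau> (b o\<^sub>L T) = (\<Sum>k<2^n. c k * \<tau> (b o\<^sub>L dyadic n k))"
      unfolding T step_operator_def using bM
      by (simp add: comp.sum_right tr_sum dyadic_M scale_operator_comp tr_scale)
    then show ?thesis
      using dyadic_expectation b by (simp add: const_expectation_def sum_distrib_left mult_ac)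
  qed
  \<comment> \<open>The same formula at the identity identifies the sum as the trace of T.\<close>
  show ?thesis using t[OF a] t[OF A_id] by (simp add: tr_id)
qed

end

section \<open>Closures of abelian algebras\<close>

lemma scale_operator_diff: "c *\<^sub>O (S - T) = c *\<^sub>O S - c *\<^sub>O (T :: 'h::complex_hilbert operator)"
  by (rule blinfun_eqI) (simp add: op_simps scaleC_diff_right)

context tracial_algebra begin

text \<open>The part of \<open>M\<close> inside the L^2-closure of \<open>N\<close>. The
  approximants carry no common norm bound, so \<open>n2_complete\<close> does not apply to them
  directly.\<close>

definition n2_closure :: "'h operator set \<Rightarrow> 'h operator set"
  where "n2_closure N = {T \<in> M. \<forall>e>0. \<exists>S\<in>N. n2 (T - S) < e}"

lemma n2_scale: assumes "T \<in> M" shows "n2 (c *\<^sub>O T) = cmod c * n2 T"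
proof -
  have eq: "adj (c *\<^sub>O T) o\<^sub>L (c *\<^sub>O T) = (c * cnj c) *\<^sub>O (adj T o\<^sub>L T)"
    using assms by (intro blinfun_eqI) (simp add: adj_scale op_simps bop_scaleC scaleC_scaleC mult.commute)
  have "(n2 (c *\<^sub>O T))\<^sup>2 = Re ((c * cnj c) * \<tau> (adj T o\<^sub>L T))"
    using assms by (subst n2_sq) (simp_all only: eq tr_scale M_intros)
  also have "\<dots> = Re (of_real ((cmod c)\<^sup>2) * of_real ((n2 T)\<^sup>2))"
    by (simp only: complex_norm_square tr_adj_comp[OF assms])
  also have "\<dots> = (cmod c * n2 T)\<^sup>2"
    by (simp only: of_real_mult[symmetric] Re_complex_of_real power_mult_distrib)
  finally have "(n2 (c *\<^sub>O T))\<^sup>2 = (cmod c * n2 T)\<^sup>2" .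
  then show ?thesis using assms by simp
qed

lemma n2_closure_n2_closed:
  assumes N: "N \<subseteq> M" and T: "T \<in> M" "\<And>e. e > 0 \<Longrightarrow> \<exists>S\<in>n2_closure N. n2 (T - S) < e"
  shows "T \<in> n2_closure N"
proof -
  have "\<exists>S\<in>N. n2 (T - S) < e" if "e > 0" for e
  proof -
    obtain R where R: "R \<in> n2_closure N" "n2 (T - R) < e/2" using T(2)[of "e/2"] \<open>e > 0\<close> by auto
    then obtain S where S: "S \<in> N" "n2 (R - S) < e/2" using half_gt_zero[OF \<open>e > 0\<close>] unfolding n2_closure_def by blast
    have "n2 (T - S) < e"
      using n2_triangle_diff[of T R S] R S T(1) N by (auto simp: n2_closure_def)
    then show ?thesis using S by blast
  qed
  then show ?thesis using T(1) by (simp add: n2_closure_def)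
qed

lemma n2_closure_superset: "N \<subseteq> M \<Longrightarrow> N \<subseteq> n2_closure N"
  by (auto simp: n2_closure_def n2_zero intro!: bexI)

lemma n2_closure_alg:
  assumes N: "selfadjoint_subalgebra N" "N \<subseteq> M"
  shows "selfadjoint_subalgebra (n2_closure N)"
proof -
  note NM = subsetD[OF N(2)]
  have comp: "S o\<^sub>L T \<in> n2_closure N" if S: "S \<in> n2_closure N" and T: "T \<in> n2_closure N" for S T
  proof -
    have SM: "S \<in> M" and TM: "T \<in> M" using S T by (auto simp: n2_closure_def)
    have "\<exists>R\<in>N. n2 ((S o\<^sub>L T) - R) < e" if "e > 0" for e
    proof -
      \<comment> \<open>The order of choice matters: T' first, with accuracy set by the fixed S,
        then S' with accuracy set by the norm of T', since approximants are not uniformly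
        bounded.\<close>
      have "e / (2 * (norm S + 1)) > 0" using \<open>e > 0\<close> by (simp add: add_nonneg_pos)
      then obtain T' where T': "T' \<in> N" "n2 (T - T') < e / (2 * (norm S + 1))"
        using T unfolding n2_closure_def by blast
      have "e / (2 * (norm T' + 1)) > 0" using \<open>e > 0\<close> by (simp add: add_nonneg_pos)
      then obtain S' where S': "S' \<in> N" "n2 (S - S') < e / (2 * (norm T' + 1))"
        using S unfolding n2_closure_def by blast
      have small: "a * b < e / 2" if "b < e / (2 * c)" "c > 0" "a \<le> c" "b \<ge> 0" for a b c :: real
      proof -
        have "a * b \<le> c * b" using that by (simp add: mult_right_mono)
        also have "\<dots> < c * (e / (2 * c))" using that by (intro mult_strict_left_mono) auto
        also have "\<dots> = e / 2" using that by simp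
        finally show ?thesis .
      qed
      have "n2 (S o\<^sub>L (T - T')) < e / 2"
        using n2_comp_left[of S "T - T'"] small[OF T'(2), of "norm S"] SM TM NM[OF T'(1)]
        by (simp add: add_nonneg_pos)
      moreover have "n2 ((S - S') o\<^sub>L T') < e / 2"
        using n2_comp_right[of T' "S - S'"] small[OF S'(2), of "norm T'"] SM NM[OF S'(1)] NM[OF T'(1)]
        by (simp add: add_nonneg_pos)
      moreover have "(S o\<^sub>L T) - (S' o\<^sub>L T') = (S o\<^sub>L (T - T')) + ((S - S') o\<^sub>L T')" by (simp add: comp_simps)
      ultimately have "n2 ((S o\<^sub>L T) - (S' o\<^sub>L T')) < e"
        using n2_triangle[of "S o\<^sub>L (T - T')" "(S - S') o\<^sub>L T'"] SM TM NM[OF S'(1)] NM[OF T'(1)] by simp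
      then show ?thesis using algD(4)[OF N(1) S'(1) T'(1)] by blast
    qed
    then show ?thesis using SM TM by (simp add: n2_closure_def)
  qed
  have add: "S + T \<in> n2_closure N" if S: "S \<in> n2_closure N" and T: "T \<in> n2_closure N" for S T
  proof -
    have SM: "S \<in> M" and TM: "T \<in> M" using S T by (auto simp: n2_closure_def)
    have "\<exists>R\<in>N. n2 (S + T - R) < e" if "e > 0" for e
    proof -
      obtain S' T' where S': "S' \<in> N" "n2 (S - S') < e/2" and T': "T' \<in> N" "n2 (T - T') < e/2"
        using S T half_gt_zero[OF \<open>e > 0\<close>] unfolding n2_closure_def by blast
      have eq: "S + T - (S' + T') = (S - S') + (T - T')" by simp
      have "n2 (S + T - (S' + T')) < e"
        unfolding eq using n2_triangle[of "S - S'" "T - T'"] S' T' SM TM NM by simp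
      then show ?thesis using algD(3)[OF N(1) S'(1) T'(1)] by blast
    qed
    then show ?thesis using SM TM by (simp add: n2_closure_def)
  qed
  have scale: "c *\<^sub>O T \<in> n2_closure N" if T: "T \<in> n2_closure N" for c T
  proof -
    have TM: "T \<in> M" using T by (auto simp: n2_closure_def)
    have "\<exists>R\<in>N. n2 (c *\<^sub>O T - R) < e" if "e > 0" for e
    proof -
      have "e / (cmod c + 1) > 0" using \<open>e > 0\<close> by (simp add: add_nonneg_pos)
      then obtain T' where T': "T' \<in> N" "n2 (T - T') < e / (cmod c + 1)"
        using T unfolding n2_closure_def by blast
      have "n2 (c *\<^sub>O T - c *\<^sub>O T') = cmod c * n2 (T - T')"
        using n2_scale[of "T - T'" c] TM NM[OF T'(1)] by (simp add: scale_operator_diff)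
      also have "\<dots> \<le> (cmod c + 1) * n2 (T - T')" using TM NM[OF T'(1)] by (simp add: mult_right_mono)
      also have "\<dots> < e" using T'(2) by (simp add: pos_less_divide_eq add_nonneg_pos mult.commute)
      finally show ?thesis using algD(5)[OF N(1) T'(1)] by blast
    qed
    then show ?thesis using TM by (simp add: n2_closure_def)
  qed
  have adj: "adj T \<in> n2_closure N" if T: "T \<in> n2_closure N" for T
  proof -
    have TM: "T \<in> M" using T by (auto simp: n2_closure_def)
    have eq: "n2 (adj T - adj S) = n2 (T - S)" if "S \<in> N" for S
      using n2_adj[of "T - S"] TM NM[OF that] by (simp add: adj_diff)
    have "\<exists>R\<in>N. n2 (adj T - R) < e" if "e > 0" for e
    proof -
      obtain S where "S \<in> N" "n2 (T - S) < e" using T \<open>e > 0\<close> unfolding n2_closure_def by blast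
      then show ?thesis
        using eq algD(6)[OF N(1)] by (intro bexI[of _ "adj S"]) auto
    qed
    then show ?thesis using TM by (simp add: n2_closure_def)
  qed
  have zero: "0 \<in> n2_closure N" using n2_closure_superset[OF N(2)] algD(2)[OF N(1)] by blast
  have sub: "n2_closure N \<subseteq> bounded_operators" by (auto simp: n2_closure_def)
  show ?thesis
    unfolding selfadjoint_subalgebra_def by (intro conjI ballI allI sub zero comp add scale adj; assumption)
qed

lemma n2_closure_commute:
  assumes N: "N \<subseteq> M" and S: "S \<in> M" "\<And>R. R \<in> N \<Longrightarrow> S o\<^sub>L R = R o\<^sub>L S" and T: "T \<in> n2_closure N"
  shows "S o\<^sub>L T = T o\<^sub>L S"
proof -
  have TM: "T \<in> M" using T by (auto simp: n2_closure_def)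
  have "n2 ((S o\<^sub>L T) - (T o\<^sub>L S)) \<le> 0"
  proof (rule field_le_epsilon)
    fix e :: real assume "e > 0"
    then have "e / (2 * (norm S + 1)) > 0" by (simp add: add_nonneg_pos)
    then obtain R where R: "R \<in> N" "n2 (T - R) < e / (2 * (norm S + 1))"
      using T unfolding n2_closure_def by blast
    have RM: "R \<in> M" using R N by blast
    have "(S o\<^sub>L T) - (T o\<^sub>L S) = (S o\<^sub>L (T - R)) + ((R - T) o\<^sub>L S)"
      using S(2)[OF R(1)] by (simp add: comp_simps)
    then have "n2 ((S o\<^sub>L T) - (T o\<^sub>L S)) \<le> n2 (S o\<^sub>L (T - R)) + n2 ((R - T) o\<^sub>L S)"
      using n2_triangle[of "S o\<^sub>L (T - R)" "(R - T) o\<^sub>L S"] S TM RM by simp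
    also have "\<dots> \<le> norm S * n2 (T - R) + norm S * n2 (R - T)"
      using S TM RM by (intro add_mono n2_comp_left n2_comp_right) auto
    also have "\<dots> = 2 * norm S * n2 (T - R)" using n2_commute[of R T] TM RM by simp
    also have "\<dots> \<le> 2 * (norm S + 1) * n2 (T - R)" using TM RM by (intro mult_right_mono) auto
    also have "\<dots> < 2 * (norm S + 1) * (e / (2 * (norm S + 1)))"
      using R(2) by (intro mult_strict_left_mono) (auto simp: add_nonneg_pos)
    also have "\<dots> = e" by (simp add: add_nonneg_eq_0_iff)
    finally show "n2 ((S o\<^sub>L T) - (T o\<^sub>L S)) \<le> 0 + e" by simp
  qed
  then have "(S o\<^sub>L T) - (T o\<^sub>L S) = 0"
    using n2_nonneg[of "(S o\<^sub>L T) - (T o\<^sub>L S)"] S TM by (intro n2_eq_zero antisym) auto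
  then show ?thesis by simp
qed

lemma n2_closure_abelian:
  assumes N: "N \<subseteq> M" "abelian_algebra N"
  shows "abelian_algebra (n2_closure N)"
  unfolding abelian_algebra_def
proof (intro ballI)
  fix S T assume S: "S \<in> n2_closure N" and T: "T \<in> n2_closure N"
  have M: "S \<in> M" "T \<in> M" using S T by (auto simp: n2_closure_def)
  have "S o\<^sub>L R = R o\<^sub>L S" if "R \<in> N" for R
    using n2_closure_commute[OF N(1) _ _ S, of R] N that unfolding abelian_algebra_def by (metis subsetD)
  then show "S o\<^sub>L T = T o\<^sub>L S" by (rule n2_closure_commute[OF N(1) M(1) _ T])
qed

text \<open>
  Minimal elements of the bounded convex sets \<open>K F \<delta>\<close> for the 2-norm form a Cauchy net; this
  replaces weak compactness.
\<close>

lemma n2_closure_bounded_strong_closed: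
  fixes T :: "'h operator"
  assumes N: "selfadjoint_subalgebra N" "N \<subseteq> M"
    and T: "\<And>F \<delta>. finite F \<Longrightarrow> \<delta> > 0 \<Longrightarrow> \<exists>S\<in>n2_closure N. norm S \<le> 1 \<and> (\<forall>x\<in>F. norm (blinfun_apply S x - T x) \<le> \<delta>)"
  shows "T \<in> n2_closure N"
proof -
  let ?B = "n2_closure N"
  have BM: "S \<in> M" if "S \<in> ?B" for S using that by (simp add: n2_closure_def)
  note B = n2_closure_alg[OF N]
  define K where "K F \<delta> = {S\<in>?B. norm S \<le> 1 \<and> (\<forall>x\<in>F. norm (blinfun_apply S x - T x) \<le> \<delta>)}" for F and \<delta> :: real
  have K_mono: "K F \<delta> \<subseteq> K F' \<delta>'" if "F' \<subseteq> F" "\<delta> \<le> \<delta>'" for F F' \<delta> \<delta>'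
    using that by (force simp: K_def)
  have K_mid: "(1/2) *\<^sub>R (S + R) \<in> K F \<delta>" if S: "S \<in> K F \<delta>" and R: "R \<in> K F \<delta>" for S R F \<delta>
  proof -
    have "norm ((1/2) *\<^sub>R (S + R)) \<le> 1"
      using norm_triangle_ineq[of S R] S R by (simp add: K_def)
    moreover have "norm (((1/2) *\<^sub>R (S + R)) x - T x) \<le> \<delta>" if "x \<in> F" for x
    proof -
      have "((1/2) *\<^sub>R (S + R)) x - T x = (1/2) *\<^sub>R ((S x - T x) + (R x - T x))"
        by (simp add: op_simps algebra_simps flip: scaleR_add_left)
      then have "norm (((1/2) *\<^sub>R (S + R)) x - T x) \<le> (norm (blinfun_apply S x - T x) + norm (R x - T x)) / 2"
        using norm_triangle_ineq[of "S x - T x" "R x - T x"] by simp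
      moreover have "norm (blinfun_apply S x - T x) \<le> \<delta>" "norm (R x - T x) \<le> \<delta>" using S R that by (auto simp: K_def)
      ultimately show ?thesis by simp
    qed
    ultimately show ?thesis using S R algD(3,7)[OF B] by (simp add: K_def)
  qed
  \<comment> \<open>\<open>Sup D\<close> is the limit, along the net of shrinking sets
    \<open>K F \<delta>\<close>, of the infimum of (n2 S)^2 over them.\<close>
  define D where "D = {r. \<exists>F \<delta>. finite F \<and> \<delta> > 0 \<and> (\<forall>S\<in>K F \<delta>. r \<le> (n2 S)\<^sup>2)}"
  have D0: "0 \<in> D" unfolding D_def by (intro CollectI exI[of _ "{}"] exI[of _ 1]) simp
  have D1: "r \<le> 1" if "r \<in> D" for r
  proof -
    obtain F \<delta> where "finite F" "\<delta> > 0" "\<forall>S\<in>K F \<delta>. r \<le> (n2 S)\<^sup>2" using \<open>r \<in> D\<close> by (auto simp: D_def)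
    moreover from T[OF this(1,2)] obtain S where "S \<in> K F \<delta>" by (auto simp: K_def)
    ultimately have "r \<le> (n2 S)\<^sup>2" "n2 S \<le> 1" "S \<in> M"
      using n2_le_norm[of S] BM by (force simp: K_def)+
    then show ?thesis using power_le_one[of "n2 S" 2] by simp
  qed
  define d where "d = Sup D"
  have bdd: "bdd_above D" using D1 by (auto simp: bdd_above_def)
  define \<epsilon> where "\<epsilon> n = (1/2::real)^n" for n
  have small: "\<exists>S\<in>K F \<delta>. (n2 S)\<^sup>2 < d + \<epsilon> n" if "finite F" "\<delta> > 0" for F \<delta> n
  proof (rule ccontr)
    assume "\<not> ?thesis"
    then have "d + \<epsilon> n \<in> D" using that unfolding D_def by (auto simp: not_less)
    then have "d + \<epsilon> n \<le> d" unfolding d_def by (rule cSup_upper[OF _ bdd])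
    moreover have "\<epsilon> n > 0" by (simp add: \<epsilon>_def)
    ultimately show False by simp
  qed
  have "\<exists>F \<delta>. finite F \<and> \<delta> > 0 \<and> (\<forall>S\<in>K F \<delta>. d - \<epsilon> n \<le> (n2 S)\<^sup>2)" for n
  proof -
    have "d - \<epsilon> n < Sup D" by (simp add: d_def \<epsilon>_def)
    then obtain r where "r \<in> D" "d - \<epsilon> n < r" using less_cSup_iff[of D] D0 bdd by auto
    then show ?thesis unfolding D_def by (auto intro: less_imp_le less_le_trans) (meson less_imp_le order.trans)
  qed
  then obtain F \<delta> where F: "\<And>n. finite (F n)" "\<And>n. \<delta> n > 0" "\<And>n S. S \<in> K (F n) (\<delta> n) \<Longrightarrow> d - \<epsilon> n \<le> (n2 S)\<^sup>2"
    by metis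
  \<comment> \<open>Accumulating the stages makes the sets \<open>K (G n) (\<eta> n)\<close>
    decrease in n; the entry 1 / (n + 1) later makes \<open>Y n x\<close> tend to
    \<open>T x\<close>.\<close>
  define G \<eta> where "G n = (\<Union>i\<le>n. F i)" and "\<eta> n = Min (insert (1 / real (Suc n)) (\<delta> ` {..n}))" for n
  have G: "finite (G n)" "F n \<subseteq> G n" for n using F(1) by (auto simp: G_def)
  have \<eta>: "\<eta> n > 0" "\<eta> n \<le> \<delta> n" "\<eta> n \<le> 1 / real (Suc n)" for n
  proof -
    show "\<eta> n > 0" unfolding \<eta>_def using F(2) by (subst Min_gr_iff) auto
    show "\<eta> n \<le> \<delta> n" "\<eta> n \<le> 1 / real (Suc n)" unfolding \<eta>_def by (intro Min_le; simp)+
  qed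
  have G_mono: "G n \<subseteq> G m" and \<eta>_mono: "\<eta> m \<le> \<eta> n" if "n \<le> m" for n m
  proof -
    show "G n \<subseteq> G m" using that by (force simp: G_def)
    have "\<eta> m \<le> y" if "y \<in> insert (1 / real (Suc n)) (\<delta> ` {..n})" for y
    proof -
      have "1 / real (Suc m) \<le> 1 / real (Suc n)" using \<open>n \<le> m\<close> by (simp add: frac_le)
      then have "y \<ge> \<eta> m" if "y = 1 / real (Suc n)" using that \<eta>(3)[of m] by simp
      moreover have "y \<ge> \<eta> m" if "y = \<delta> i" "i \<le> n" for i
        unfolding \<eta>_def[of m] using that \<open>n \<le> m\<close> by (intro Min_le) auto
      ultimately show ?thesis using that by blast
    qed
    then show "\<eta> m \<le> \<eta> n" unfolding \<eta>_def[of n] by (intro Min.boundedI) auto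
  qed
  \<comment> \<open>The midpoint has squared 2-norm at least d - eps, so the parallelogram law
    leaves 2 (d + eps) + 2 (d + eps) - 4 (d - eps) = 8 eps.\<close>
  have near: "(n2 (u - v))\<^sup>2 \<le> 8 * \<epsilon> n"
    if u: "u \<in> K (G n) (\<eta> n)" "(n2 u)\<^sup>2 < d + \<epsilon> n" and v: "v \<in> K (G n) (\<eta> n)" "(n2 v)\<^sup>2 < d + \<epsilon> n" for u v n
  proof -
    have "(1/2) *\<^sub>R (u + v) \<in> K (F n) (\<delta> n)"
      using K_mid[OF u(1) v(1)] K_mono[OF G(2) \<eta>(2)] by blast
    from F(3)[OF this] have "d - \<epsilon> n \<le> (n2 ((1/2) *\<^sub>R (u + v)))\<^sup>2" .
    moreover have "u \<in> M" "v \<in> M" using u v BM by (auto simp: K_def)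
    ultimately show ?thesis using n2_parallelogram[of u v] u(2) v(2) by simp
  qed
  have \<epsilon>_mono: "\<epsilon> m \<le> \<epsilon> n" if "n \<le> m" for n m using that by (simp add: \<epsilon>_def power_decreasing)
  have "\<exists>S. S \<in> K (G n) (\<eta> n) \<and> (n2 S)\<^sup>2 < d + \<epsilon> n" for n
    using small[OF G(1)[of n] \<eta>(1)[of n], of n] by blast
  then obtain X where X: "\<And>n. X n \<in> K (G n) (\<eta> n)" "\<And>n. (n2 (X n))\<^sup>2 < d + \<epsilon> n"
    by metis
  have XM: "X n \<in> M" and X1: "norm (X n) \<le> 1" and XB: "X n \<in> ?B" for n using X(1)[of n] BM by (auto simp: K_def)
  have \<epsilon>_lim: "\<epsilon> \<longlonglongrightarrow> 0" unfolding \<epsilon>_def by (rule LIMSEQ_power_zero) simp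
  have "n2_Cauchy X"
    unfolding n2_Cauchy_def
  proof (intro allI impI)
    fix e :: real assume "e > 0"
    have "(n2 (X m - X n))\<^sup>2 \<le> 8 * \<epsilon> n" if "n \<le> m" for m n
    proof (rule near)
      show "X m \<in> K (G n) (\<eta> n)" using X(1)[of m] K_mono[OF G_mono[OF that] \<eta>_mono[OF that]] by blast
      show "(n2 (X m))\<^sup>2 < d + \<epsilon> n" using X(2)[of m] \<epsilon>_mono[OF that] by linarith
    qed (rule X)+
    from small_tails[OF this tendsto_mult_right_zero[OF \<epsilon>_lim] n2_commute[OF XM XM] \<open>e > 0\<close>]
    show "\<exists>N. \<forall>m\<ge>N. \<forall>n\<ge>N. n2 (X m - X n) < e" .
  qed
  from n2_complete[OF XM X1 this] obtain L
    where L: "L \<in> M" "strong_tendsto X L" "(\<lambda>n. n2 (X n - L)) \<longlonglongrightarrow> 0" .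
  have "L \<in> ?B"
  proof (rule n2_closure_n2_closed[OF N(2) L(1)])
    fix e :: real assume "e > 0"
    then obtain n where "n2 (X n - L) < e"
      using order_tendstoD(2)[OF L(3)] by (auto simp: eventually_sequentially)
    then show "\<exists>S\<in>?B. n2 (L - S) < e" using XB n2_commute[of L "X n"] L(1) XM by (intro bexI[of _ "X n"]) auto
  qed
  \<comment> \<open>A given x need not lie in any \<open>G n\<close>. A competing sequence Y that
    also approximates T at x is forced by \<open>near\<close> towards X in the 2-norm, hence
    strongly, so X n x tends to T x as well.\<close>
  moreover have "L = T"
  proof (rule blinfun_eqI)
    fix x
    have "\<exists>S. S \<in> K (insert x (G n)) (\<eta> n) \<and> (n2 S)\<^sup>2 < d + \<epsilon> n" for n
      using small[OF finite.insertI[OF G(1)[of n]] \<eta>(1)[of n], of x n] by blast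
    then obtain Y where Y: "\<And>n. Y n \<in> K (insert x (G n)) (\<eta> n)" "\<And>n. (n2 (Y n))\<^sup>2 < d + \<epsilon> n"
      by metis
    have YM: "Y n \<in> M" and Y1: "norm (Y n) \<le> 1" for n using Y(1)[of n] BM by (auto simp: K_def)
    have YK: "Y n \<in> K (G n) (\<eta> n)" for n using Y(1) K_mono[of "G n" "insert x (G n)"] by blast
    have XY: "n2 (X n - Y n) \<le> sqrt (8 * \<epsilon> n)" for n
      using near[OF X(1)[of n] X(2)[of n] YK[of n] Y(2)[of n]] by (simp add: real_le_rsqrt)
    have lim0: "(\<lambda>n. sqrt (8 * \<epsilon> n)) \<longlonglongrightarrow> sqrt (8 * 0)" by (intro tendsto_intros \<epsilon>_lim)
    have "(\<lambda>n. n2 (X n - Y n)) \<longlonglongrightarrow> 0"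
    proof (rule Lim_null_comparison)
      show "\<forall>\<^sub>F n in sequentially. norm (n2 (X n - Y n)) \<le> sqrt (8 * \<epsilon> n)"
        using XY XM YM by simp
    qed (use lim0 in simp)
    moreover have "norm (X n - Y n) \<le> 2" for n
      using norm_triangle_ineq4[of "X n" "Y n"] X1[of n] Y1[of n] by linarith
    ultimately have 1: "(\<lambda>n. (X n - Y n) x) \<longlonglongrightarrow> 0"
      using XM YM by (intro n2_tendsto_strong[where R = 2]) auto
    have 2: "(\<lambda>n. Y n x - T x) \<longlonglongrightarrow> 0"
    proof (rule Lim_null_comparison)
      have "norm (Y n x - T x) \<le> 1 / real (Suc n)" for n
        using Y(1)[of n] \<eta>(3)[of n] by (auto simp: K_def)
      then show "\<forall>\<^sub>F n in sequentially. norm (Y n x - T x) \<le> 1 / real (Suc n)" by simp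
      show "(\<lambda>n. 1 / real (Suc n)) \<longlonglongrightarrow> 0" using LIMSEQ_inverse_real_of_nat by (simp add: inverse_eq_divide)
    qed
    from tendsto_add[OF 1 2] have "(\<lambda>n. X n x - T x) \<longlonglongrightarrow> 0" by (simp add: op_simps)
    then have "(\<lambda>n. X n x) \<longlonglongrightarrow> T x" by (rule LIM_zero_cancel)
    then show "L x = T x" using strong_tendstoD[OF L(2)] LIMSEQ_unique by blast
  qed
  ultimately show ?thesis by simp
qed

section \<open>From bounded to arbitrary strong approximation\<close>

text \<open>In scalars, s / (1 + s^2) <= 1. The bound is independent of the norm of S, over which
  strong approximation gives no control.\<close>

lemma norm_comp_resolvent_le:
  assumes S: "S \<in> bounded_operators"
  shows "norm (S o\<^sub>L resolvent (adj S o\<^sub>L S)) \<le> 1"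
proof (rule norm_blinfun_bound)
  fix x
  let ?z = "adj S o\<^sub>L S" and ?v = "resolvent (adj S o\<^sub>L S) x"
  have z: "positive_operator ?z" by (rule positive_adj_comp[OF S])
  have "qform ?z ?v = Re (cinner (x - ?v) ?v)"
    using resolvent_apply[OF z, of x] unfolding qform_def by (metis add_diff_cancel_left')
  also have "\<dots> \<le> Re (cinner x ?v)" by (simp add: cinner_simps Re_cinner_self)
  also have "\<dots> \<le> norm x * norm ?v" using cmod_cinner_le complex_Re_le_cmod order.trans by blast
  also have "\<dots> \<le> norm x * norm x" by (intro mult_left_mono norm_resolvent_apply[OF z]) simp
  finally have "(norm (S ?v))\<^sup>2 \<le> (norm x)\<^sup>2" using qform_adj_comp[OF S, of ?v] by (simp add: power2_eq_square)
  then have "norm (S ?v) \<le> norm x" by (rule power2_le_imp_le) simp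
  then show "norm ((S o\<^sub>L resolvent ?z) x) \<le> 1 * norm x" by (simp add: op_simps)
qed simp

text \<open>This lets inverses and resolvents be formed inside the closure.\<close>

lemma norm_closed_n2_closure:
  assumes "N \<subseteq> M" shows "closed (n2_closure N)"
  unfolding closed_sequential_limits
proof (intro allI impI)
  fix X T assume a: "(\<forall>n. X n \<in> n2_closure N) \<and> X \<longlonglongrightarrow> T"
  then have XM: "X n \<in> M" for n by (simp add: n2_closure_def)
  then have TM: "T \<in> M" using a vn_closed[OF vn] by (auto simp: closed_sequential_limits)
  show "T \<in> n2_closure N"
  proof (rule n2_closure_n2_closed[OF assms TM])
    fix e :: real assume "e > 0"
    then obtain n where "\<forall>m\<ge>n. norm (X m - T) < e"
      using a unfolding lim_sequentially dist_norm by blast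
    then have "norm (X n - T) < e" by blast
    then have "n2 (T - X n) < e" using n2_le_norm[of "T - X n"] TM XM[of n] by (simp add: norm_minus_commute)
    then show "\<exists>S\<in>n2_closure N. n2 (T - S) < e" using a by blast
  qed
qed

text \<open>Membership in the strong closure through basic neighbourhoods; sequences would not
  suffice on a nonseparable space.\<close>

definition strongly_approximable :: "'h operator set \<Rightarrow> 'h operator \<Rightarrow> bool"
  where "strongly_approximable B T \<longleftrightarrow> (\<forall>F \<delta>. finite F \<and> \<delta> > 0 \<longrightarrow> (\<exists>S\<in>B. \<forall>x\<in>F. norm (blinfun_apply S x - T x) < \<delta>))"

text \<open>At a given x only the two vectors C x and x have to be approximated.\<close>

lemma strongly_approximable_commute:
  fixes T C :: "'h operator"
  assumes T: "strongly_approximable B T" and C: "\<And>S. S \<in> B \<Longrightarrow> S o\<^sub>L C = C o\<^sub>L S"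
  shows "T o\<^sub>L C = C o\<^sub>L T"
proof (rule blinfun_eqI)
  fix x
  have "norm (T (C x) - C (T x)) \<le> 0"
  proof (rule field_le_epsilon)
    fix e :: real assume "e > 0"
    define \<delta> where "\<delta> = e / (1 + norm C)"
    have \<delta>: "\<delta> > 0" "\<delta> * (1 + norm C) = e" using \<open>e > 0\<close> by (simp_all add: \<delta>_def add_pos_nonneg add_nonneg_eq_0_iff)
    obtain S where S: "S \<in> B" "\<forall>y\<in>{C x, x}. norm (S y - T y) < \<delta>"
      using T \<delta>(1) unfolding strongly_approximable_def by (metis finite.emptyI finite.insertI)
    have "S (C x) = C (S x)" using C[OF S(1)] by (metis blinfun_apply_blinfun_compose)
    then have "T (C x) - C (T x) = C (S x - T x) - (S (C x) - T (C x))" by (simp add: op_simps)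
    then have "norm (T (C x) - C (T x)) \<le> norm (C (S x - T x)) + norm (S (C x) - T (C x))"
      by (metis norm_triangle_ineq4)
    also have "\<dots> \<le> norm C * \<delta> + \<delta>"
      using S(2) norm_blinfun[of C "S x - T x"] mult_left_mono[of "norm (blinfun_apply S x - T x)" \<delta> "norm C"] by fastforce
    also have "\<dots> = e" using \<delta>(2) by (simp add: algebra_simps)
    finally show "norm (T (C x) - C (T x)) \<le> 0 + e" by simp
  qed
  then show "(T o\<^sub>L C) x = (C o\<^sub>L T) x" by simp
qed

text \<open>For approximants S of T, the inverses of 1 + S^* S are contractions in the closure and
  tend strongly to the inverse of 1 + T^* T, so \<open>n2_closure_bounded_strong_closed\<close>
  applies to the latter. Inverting it inside the closure recovers T^* T.\<close>

lemma adj_comp_in_n2_closure: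
  assumes N: "selfadjoint_subalgebra N" "N \<subseteq> M" "abelian_algebra N" "id_blinfun \<in> N"
    and TM: "T \<in> M" and T: "strongly_approximable (n2_closure N) T"
  shows "adj T o\<^sub>L T \<in> n2_closure N"
proof -
  let ?B = "n2_closure N"
  note B = n2_closure_alg[OF N(1,2)]
  have idB: "id_blinfun \<in> ?B" using n2_closure_superset[OF N(2)] N(4) by blast
  have BC: "S o\<^sub>L R = R o\<^sub>L S" if "S \<in> ?B" "R \<in> ?B" for S R
    using n2_closure_abelian[OF N(2,3)] that by (simp add: abelian_algebra_def)
  have Tb: "T \<in> bounded_operators" using TM by blast
  have TC: "T o\<^sub>L C = C o\<^sub>L T" if "C \<in> ?B" for C
    by (rule strongly_approximable_commute[OF T]) (rule BC[OF _ that])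
  have aTC: "S o\<^sub>L adj T = adj T o\<^sub>L S" if "S \<in> ?B" for S
  proof -
    have "adj (T o\<^sub>L adj S) = adj (adj S o\<^sub>L T)" using TC[OF algD(6)[OF B that]] by simp
    then show ?thesis using Tb algD(1)[OF B that] by (simp add: adj_comp adj_adj)
  qed
  \<comment> \<open>Commutation passes from the closure to T, then to its adjoint, and once more to
    T: so T is normal.\<close>
  have aTT: "T o\<^sub>L adj T = adj T o\<^sub>L T" by (rule strongly_approximable_commute[OF T aTC])
  \<comment> \<open>The adjoint is not strongly continuous, but T - S is normal, so approximating T
    at a vector also approximates its adjoint there.\<close>
  have normal: "norm (adj (T - S) x) = norm ((T - S) x)" if S: "S \<in> ?B" for S x
  proof -
    have b: "T - S \<in> bounded_operators" using Tb algD(1)[OF B S] by simp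
    have "adj S o\<^sub>L T = T o\<^sub>L adj S" using TC[OF algD(6)[OF B S]] by simp
    moreover have "S o\<^sub>L adj S = adj S o\<^sub>L S" by (rule BC[OF S algD(6)[OF B S]])
    ultimately have "(T - S) o\<^sub>L adj (T - S) = adj (T - S) o\<^sub>L (T - S)"
      using aTT aTC[OF S] Tb algD(1)[OF B S] by (simp add: adj_diff comp_simps)
    then have "(norm (adj (T - S) x))\<^sup>2 = (norm ((T - S) x))\<^sup>2"
      using qform_adj_comp[OF b, of x] qform_adj_comp[OF bop_adj[OF b], of x] by (simp add: adj_adj[OF b])
    then show ?thesis by simp
  qed
  define zT where "zT = adj T o\<^sub>L T"
  have zT: "positive_operator zT" unfolding zT_def by (rule positive_adj_comp[OF Tb])
  have RB: "resolvent zT \<in> ?B"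
  proof (rule n2_closure_bounded_strong_closed[OF N(1,2)])
    fix F :: "'h set" and \<delta> :: real assume F: "finite F" "\<delta> > 0"
    define w where "w x = resolvent zT x" for x
    have "finite ((\<lambda>x. T (w x)) ` F \<union> w ` F)" using F by simp
    then obtain S where S: "S \<in> ?B" "\<forall>y\<in>(\<lambda>x. T (w x)) ` F \<union> w ` F. norm (S y - T y) < \<delta>/2"
      using T F(2) unfolding strongly_approximable_def by (metis half_gt_zero)
    have Sb: "S \<in> bounded_operators" by (rule algD(1)[OF B S(1)])
    define z where "z = adj S o\<^sub>L S"
    have z: "positive_operator z" unfolding z_def by (rule positive_adj_comp[OF Sb])
    have "z \<in> ?B" unfolding z_def using algD(4,6)[OF B] S(1) by blast
    then have "resolvent z \<in> ?B"
      using resolvent_in_algebra[OF B idB norm_closed_n2_closure[OF N(2)] _ z] by blast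
    moreover have "norm (resolvent z x - resolvent zT x) \<le> \<delta>" if x: "x \<in> F" for x
    proof -
      \<comment> \<open>The resolvent identity, evaluated at x.\<close>
      have e: "resolvent z x - w x = resolvent z (zT (w x) - z (w x))"
      proof -
        have "resolvent z (w x + z (w x)) = w x"
          using arg_cong[OF resolvent(1)[OF z], of "\<lambda>R. R (w x)"] by (simp add: op_simps)
        moreover have "x = w x + zT (w x)" using resolvent_apply[OF zT, of x] by (simp add: w_def)
        ultimately show ?thesis by (metis (no_types) add_diff_cancel_left blinfun.diff_right)
      qed
      \<comment> \<open>This splitting puts the adjoint of T - S on the vector T w, where normality
        helps, and leaves the adjoint of S next to the resolvent of z, where the product is a
        contraction.\<close>
      have "zT (w x) - z (w x) = adj (T - S) (T (w x)) + adj S ((T - S) (w x))"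
        using Tb Sb by (simp add: zT_def z_def op_simps adj_diff)
      then have e2: "resolvent z x - w x = resolvent z (adj (T - S) (T (w x))) + (resolvent z o\<^sub>L adj S) ((T - S) (w x))"
        unfolding e by (simp add: op_simps)
      have "norm (resolvent z (adj (T - S) (T (w x)))) \<le> norm ((T - S) (T (w x)))"
        using norm_resolvent_apply[OF z] by (simp add: normal[OF S(1), symmetric])
      moreover have "norm ((T - S) (T (w x))) \<le> \<delta>/2"
        using S(2) x by (simp add: op_simps norm_minus_commute less_imp_le)
      moreover have "norm ((resolvent z o\<^sub>L adj S) ((T - S) (w x))) \<le> \<delta>/2"
      proof -
        have "resolvent z o\<^sub>L adj S = adj (S o\<^sub>L resolvent z)"
          using resolvent(5,6)[OF z] Sb by (simp add: adj_comp selfadj_def)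
        then have n1: "norm (resolvent z o\<^sub>L adj S) \<le> 1"
          using norm_adj_le[of "S o\<^sub>L resolvent z"] norm_comp_resolvent_le[OF Sb] resolvent(5)[OF z] Sb
          unfolding z_def by fastforce
        have "norm ((resolvent z o\<^sub>L adj S) ((T - S) (w x))) \<le> 1 * norm ((T - S) (w x))"
          by (rule order.trans[OF norm_blinfun mult_right_mono[OF n1 norm_ge_zero]])
        moreover have "norm ((T - S) (w x)) \<le> \<delta>/2"
          using S(2) x by (simp add: op_simps norm_minus_commute less_imp_le)
        ultimately show ?thesis by simp
      qed
      ultimately show ?thesis
        using norm_triangle_ineq[of "resolvent z (adj (T - S) (T (w x)))" "(resolvent z o\<^sub>L adj S) ((T - S) (w x))"]
        unfolding e2[unfolded w_def] by (simp add: w_def)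
    qed
    ultimately show "\<exists>S\<in>?B. norm S \<le> 1 \<and> (\<forall>x\<in>F. norm (blinfun_apply S x - resolvent zT x) \<le> \<delta>)"
      using norm_resolvent[OF z] by blast
  qed
  \<comment> \<open>T is bounded, so the inverse of 1 + T^* T is bounded below and can in turn be
    inverted in the closure.\<close>
  have lower: "qform (resolvent zT) x \<ge> (1 / (1 + norm zT)\<^sup>2) * (norm x)\<^sup>2" for x
  proof -
    let ?v = "resolvent zT x"
    have "norm x \<le> norm ?v + norm (zT ?v)"
      using resolvent_apply[OF zT, of x] norm_triangle_ineq[of ?v "zT ?v"] by simp
    also have "\<dots> \<le> (1 + norm zT) * norm ?v" using norm_blinfun[of zT ?v] by (simp add: distrib_right)
    finally have "(norm x)\<^sup>2 \<le> ((1 + norm zT) * norm ?v)\<^sup>2" by (rule power_mono) simp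
    then have "(norm x)\<^sup>2 / (1 + norm zT)\<^sup>2 \<le> (norm ?v)\<^sup>2"
      using pos_divide_le_eq[of "(1 + norm zT)\<^sup>2"] norm_ge_zero[of zT]
      by (simp add: power_mult_distrib mult.commute add_pos_nonneg)
    then show ?thesis using resolvent(4)[OF zT, of x] by simp
  qed
  have "1 / (1 + norm zT)\<^sup>2 > 0"
    using norm_ge_zero[of zT] by (intro divide_pos_pos zero_less_power) linarith+
  from inverse_in_algebra[OF B idB norm_closed_n2_closure[OF N(2)] RB resolvent(6)[OF zT] this lower]
  obtain c where c: "c \<in> ?B" "c o\<^sub>L resolvent zT = id_blinfun" by blast
  have "c = id_blinfun + zT" by (rule two_sided_inverse_unique[OF c(2) resolvent(1)[OF zT]])
  then have "zT = c - id_blinfun" by simp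
  then show ?thesis using algD(8)[OF B c(1) idB] by (simp add: zT_def)
qed

text \<open>For T in the strong closure the previous lemma only yields T^* T. Applying it to T + c
  for scalars c and polarising recovers T.\<close>

theorem n2_closure_von_neumann:
  assumes N: "selfadjoint_subalgebra N" "N \<subseteq> M" "abelian_algebra N" "id_blinfun \<in> N"
  shows "von_neumann_algebra (n2_closure N)"
proof -
  let ?B = "n2_closure N" and ?I = "id_blinfun :: 'h operator"
  note B = n2_closure_alg[OF N(1,2)]
  have idB: "?I \<in> ?B" using n2_closure_superset[OF N(2)] N(4) by blast
  have "strong_operator_topology closure_of ?B \<subseteq> ?B"
  proof
    fix T assume T: "T \<in> strong_operator_topology closure_of ?B"
    have "?B \<subseteq> M" by (auto simp: n2_closure_def)
    then have "strong_operator_topology closure_of ?B \<subseteq> strong_operator_topology closure_of M"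
      by (rule closure_of_mono)
    also have "\<dots> = M" using vn by (intro closure_of_closedin) (simp add: von_neumann_algebra_def)
    finally have TM: "T \<in> M" using T by blast
    have app: "strongly_approximable ?B T"
      unfolding strongly_approximable_def
    proof (intro allI impI)
      fix F :: "'h set" and \<delta> :: real assume F: "finite F \<and> \<delta> > 0"
      let ?U = "{f. \<forall>i\<in>F. blinfun_apply f (id i) \<in> ball (T i) \<delta>}"
      have "openin strong_operator_topology ?U" using F by (intro strong_operator_topology_basis) auto
      moreover have "T \<in> ?U" using F by simp
      ultimately have "\<exists>S. S \<in> ?B \<and> S \<in> ?U" using T unfolding in_closure_of by (elim conjE allE[of _ ?U]) simp
      then obtain S where "S \<in> ?B" "S \<in> ?U" by (elim exE conjE)
      then show "\<exists>S\<in>?B. \<forall>x\<in>F. norm (blinfun_apply S x - T x) < \<delta>"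
        by (intro bexI[of _ S]) (auto simp: dist_norm norm_minus_commute)
    qed
    have shift: "adj (T + c *\<^sub>O ?I) o\<^sub>L (T + c *\<^sub>O ?I) \<in> ?B" for c
    proof (rule adj_comp_in_n2_closure[OF N])
      show "T + c *\<^sub>O ?I \<in> M" using TM by simp
      show "strongly_approximable ?B (T + c *\<^sub>O ?I)"
        unfolding strongly_approximable_def
      proof (intro allI impI)
        fix F :: "'h set" and \<delta> :: real assume "finite F \<and> \<delta> > 0"
        then obtain S where S: "S \<in> ?B" "\<forall>x\<in>F. norm (blinfun_apply S x - T x) < \<delta>"
          using app unfolding strongly_approximable_def by blast
        then have "\<forall>x\<in>F. norm ((S + c *\<^sub>O ?I) x - (T + c *\<^sub>O ?I) x) < \<delta>" by (simp add: op_simps)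
        then show "\<exists>S\<in>?B. \<forall>x\<in>F. norm (blinfun_apply S x - (T + c *\<^sub>O ?I) x) < \<delta>"
          using algD(3,5)[OF B] S(1) idB by blast
      qed
    qed
    have TT: "adj T o\<^sub>L T \<in> ?B" by (rule adj_comp_in_n2_closure[OF N TM app])
    have polar: "c *\<^sub>O adj T + cnj c *\<^sub>O T \<in> ?B" for c
    proof -
      have "c *\<^sub>O adj T + cnj c *\<^sub>O T = (adj (T + c *\<^sub>O ?I) o\<^sub>L (T + c *\<^sub>O ?I)) - (adj T o\<^sub>L T) - (c * cnj c) *\<^sub>O ?I"
        using TM by (intro blinfun_eqI)
          (simp add: op_simps adj_add adj_scale scaleC_add_right scaleC_scaleC bop_scaleC mult.commute)
      then show ?thesis using shift[of c] TT idB algD[OF B] by simp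
    qed
    \<comment> \<open>c = 1 and c = i give T^* + T and i (T^* - T), from which the adjoint
      cancels.\<close>
    have "T = (1/2) *\<^sub>O ((1 *\<^sub>O adj T + cnj 1 *\<^sub>O T) + \<i> *\<^sub>O (\<i> *\<^sub>O adj T + cnj \<i> *\<^sub>O T))"
      by (rule blinfun_eqI)
        (simp add: op_simps scaleC_add_right scaleC_diff_right scaleC_scaleC scaleC_minus_left flip: scaleC_add_left)
    then show "T \<in> ?B" using polar[of 1] polar[of \<i>] algD(3,5)[OF B] by metis
  qed
  then have "closedin strong_operator_topology ?B"
    using closure_of_subset_eq[of ?B strong_operator_topology] by (simp add: strong_operator_topology_topspace)
  then show ?thesis using B idB by (simp add: von_neumann_algebra_def)
qed

end

section \<open>Orthogonality and diffuseness\<close>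

context masa_kernel begin

text \<open>The defect of orthogonality is linear in T, vanishes on step operators and is bounded by
  a multiple of the 2-norm.\<close>

lemma n2_closure_step_orthogonal: "orthogonal_algebras \<tau> A (n2_closure step_algebra)"
  unfolding orthogonal_algebras_def
proof (intro ballI)
  fix a T assume a: "a \<in> A" and T: "T \<in> n2_closure step_algebra"
  have aM: "a \<in> M" and TM: "T \<in> M" using a T A_M by (auto simp: n2_closure_def)
  have "cmod (\<tau> (a o\<^sub>L T) - \<tau> a * \<tau> T) \<le> 0"
  proof (rule field_le_epsilon)
    fix e :: real assume "e > 0"
    define \<delta> where "\<delta> = e / (norm a + cmod (\<tau> a) + 1)"
    have pos: "norm a + cmod (\<tau> a) + 1 > 0" by (simp add: add_nonneg_pos)
    have "\<delta> > 0" using \<open>e > 0\<close> pos by (simp add: \<delta>_def)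
    then obtain S where S: "S \<in> step_algebra" "n2 (T - S) < \<delta>" using T unfolding n2_closure_def by blast
    have SM: "S \<in> M" using S step_algebra(4) by blast
    have "\<tau> (a o\<^sub>L T) - \<tau> a * \<tau> T = \<tau> (a o\<^sub>L (T - S)) - \<tau> a * \<tau> (T - S)"
      using step_algebra_orthogonal[OF a S(1)] aM SM TM by (simp add: comp_simps tr_diff algebra_simps)
    then have "cmod (\<tau> (a o\<^sub>L T) - \<tau> a * \<tau> T) \<le> cmod (\<tau> (a o\<^sub>L (T - S))) + cmod (\<tau> a * \<tau> (T - S))"
      by (metis norm_triangle_ineq4)
    also have "\<dots> \<le> norm a * n2 (T - S) + cmod (\<tau> a) * n2 (T - S)"
    proof (rule add_mono)
      show "cmod (\<tau> (a o\<^sub>L (T - S))) \<le> norm a * n2 (T - S)"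
        using tr_le_n2[of "a o\<^sub>L (T - S)"] n2_comp_left[of a "T - S"] aM SM TM by simp
      show "cmod (\<tau> a * \<tau> (T - S)) \<le> cmod (\<tau> a) * n2 (T - S)"
        using tr_le_n2[of "T - S"] SM TM by (simp add: norm_mult mult_left_mono)
    qed
    also have "\<dots> \<le> (norm a + cmod (\<tau> a) + 1) * n2 (T - S)"
      using SM TM by (simp add: distrib_right)
    also have "\<dots> \<le> (norm a + cmod (\<tau> a) + 1) * \<delta>"
      using S(2) pos by (intro mult_left_mono) auto
    also have "\<dots> = e" using pos by (simp add: \<delta>_def)
    finally show "cmod (\<tau> (a o\<^sub>L T) - \<tau> a * \<tau> T) \<le> 0 + e" by simp
  qed
  then show "\<tau> (a o\<^sub>L T) = \<tau> a * \<tau> T" by simp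
qed

text \<open>On each level some dyadic p has Q p nonzero. As p commutes with Q, minimality gives Q p
  = Q, hence Q <= p and the trace of Q is at most \<open>(1/2)^n\<close>.\<close>

lemma n2_closure_step_diffuse: "diffuse (n2_closure step_algebra)"
  unfolding diffuse_def
proof
  let ?B = "n2_closure step_algebra"
  assume "\<exists>Q. minimal_projection ?B Q"
  then obtain Q where Q: "Q \<in> ?B" "is_projection Q" "Q \<noteq> 0"
    "\<And>R. R \<in> ?B \<Longrightarrow> is_projection R \<Longrightarrow> R \<le>\<^sub>O Q \<Longrightarrow> R = 0 \<or> R = Q"
    unfolding minimal_projection_def by blast
  have QM: "Q \<in> M" using Q(1) by (simp add: n2_closure_def)
  have "rtr Q \<le> (1/2)^n" for n
  proof -
    have "(\<Sum>k<2^n. Q o\<^sub>L dyadic n k) = Q"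
      using sum_dyadic[of n] by (simp flip: comp.sum_right)
    then obtain k where k: "k < 2^n" "Q o\<^sub>L dyadic n k \<noteq> 0"
      using Q(3) by (metis (no_types, lifting) lessThan_iff sum.neutral)
    let ?p = "dyadic n k"
    have p: "?p \<in> ?B" "is_projection ?p"
      using dyadic_in_step_algebra[OF k(1)] n2_closure_superset[OF step_algebra(4)] dyadic_proj by blast+
    have comm: "Q o\<^sub>L ?p = ?p o\<^sub>L Q"
      using n2_closure_abelian[OF step_algebra(4,2)] Q(1) p(1) by (simp add: abelian_algebra_def)
    have Qp: "is_projection (Q o\<^sub>L ?p)"
    proof (rule is_projectionI)
      show "selfadj (Q o\<^sub>L ?p)" by (rule selfadj_comp[OF projD(3)[OF Q(2)] projD(3)[OF p(2)] comm])
      have "(Q o\<^sub>L ?p) o\<^sub>L (Q o\<^sub>L ?p) = (Q o\<^sub>L Q) o\<^sub>L (?p o\<^sub>L ?p)" by (metis comm comp_assoc)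
      then show "(Q o\<^sub>L ?p) o\<^sub>L (Q o\<^sub>L ?p) = Q o\<^sub>L ?p" using projD(2)[OF Q(2)] projD(2)[OF p(2)] by simp
    qed
    have "Q - (Q o\<^sub>L ?p) = Q o\<^sub>L (id_blinfun - ?p) o\<^sub>L Q"
      using projD(2)[OF Q(2)] comm by (simp add: comp_simps comp_assoc)
    then have "Q o\<^sub>L ?p \<le>\<^sub>O Q"
      using positive_sandwich[OF projD(3)[OF Q(2)]] projection_le_id[OF p(2)] by (simp add: le_operator_def)
    moreover have "Q o\<^sub>L ?p \<in> ?B"
      using algD(4)[OF n2_closure_alg[OF step_algebra(1,4)]] Q(1) p(1) by blast
    ultimately have Qeq: "Q o\<^sub>L ?p = Q" using Q(4)[OF _ Qp] k(2) by blast
    have "?p - Q = ?p o\<^sub>L (id_blinfun - Q) o\<^sub>L ?p"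
      using projD(2)[OF p(2)] comm Qeq by (simp add: comp_simps comp_assoc)
    then have "Q \<le>\<^sub>O ?p"
      using positive_sandwich[OF projD(3)[OF p(2)]] projection_le_id[OF Q(2)] by (simp add: le_operator_def)
    then have "rtr Q \<le> rtr ?p" by (rule tr_mono[OF QM dyadic_M])
    then show ?thesis using const_expectation_trace[OF dyadic_expectation[of n k]] by simp
  qed
  moreover have "(\<lambda>n. (1/2::real)^n) \<longlonglongrightarrow> 0" by (rule LIMSEQ_power_zero) simp
  ultimately have "rtr Q \<le> 0" by (metis LIMSEQ_le_const)
  then show False using tr_faithful[OF QM projD(6)[OF Q(2)]] Q(3) by blast
qed

end

section \<open>Reduction of the theorem to the kernel condition\<close>

text \<open>Maximality in \<open>masa\<close> is among self-adjoint subalgebras that need not be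
  unital. Adding the scalars to \<open>A\<close> keeps it abelian and so cannot enlarge it.\<close>

lemma masa_contains_id:
  assumes M: "von_neumann_algebra M" and A: "masa M A"
  shows "id_blinfun \<in> A"
proof -
  let ?I = "id_blinfun :: 'a operator"
  define C where "C = {T + c *\<^sub>O ?I | T c. T \<in> A}"
  have A': "A \<subseteq> M" "selfadjoint_subalgebra A" "abelian_algebra A" using A by (auto simp: masa_def)
  note a = algD[OF A'(2)]
  have intro: "T + c *\<^sub>O ?I \<in> C" if "T \<in> A" for T c using that by (auto simp: C_def)
  have zero: "T + 0 *\<^sub>O ?I = T" for T by (rule blinfun_eqI) (simp add: op_simps)
  have AC: "A \<subseteq> C" using intro[of _ 0] by (force simp: zero)
  have CM: "C \<subseteq> M" using A'(1) algD[OF vnD(1)[OF M]] vnD(2)[OF M] by (auto simp: C_def)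
  have prod: "(S + c *\<^sub>O ?I) o\<^sub>L (T + d *\<^sub>O ?I) = ((S o\<^sub>L T) + d *\<^sub>O S + c *\<^sub>O T) + (c * d) *\<^sub>O ?I"
    if "S \<in> A" "T \<in> A" for S T c d
    using a(1)[OF that(1)] by (intro blinfun_eqI) (simp add: op_simps bop_scaleC scaleC_add_right scaleC_scaleC)
  have "S + T \<in> C \<and> S o\<^sub>L T \<in> C" if ST: "S \<in> C" "T \<in> C" for S T
  proof -
    obtain S' c T' d where e: "S' \<in> A" "T' \<in> A" "S = S' + c *\<^sub>O ?I" "T = T' + d *\<^sub>O ?I"
      using ST by (auto simp: C_def)
    have 1: "S + T = (S' + T') + (c + d) *\<^sub>O ?I" unfolding e
      by (rule blinfun_eqI) (simp add: op_simps scaleC_add_left)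
    have "S + T \<in> C" unfolding 1 by (rule intro) (use e a in simp)
    moreover have "S o\<^sub>L T \<in> C" unfolding e(3,4) prod[OF e(1,2)] by (rule intro) (use e a in simp)
    ultimately show ?thesis by blast
  qed
  moreover have "c *\<^sub>O T \<in> C \<and> adj T \<in> C" if T: "T \<in> C" for c T
  proof -
    obtain T' d where e: "T' \<in> A" "T = T' + d *\<^sub>O ?I" using T by (auto simp: C_def)
    have "c *\<^sub>O T = c *\<^sub>O T' + (c * d) *\<^sub>O ?I" unfolding e
      by (rule blinfun_eqI) (simp add: op_simps scaleC_add_right scaleC_scaleC)
    moreover have "adj T = adj T' + cnj d *\<^sub>O ?I" using e a(1) by (simp add: adj_add adj_scale)
    ultimately show ?thesis using e(1) intro a by simp
  qed
  moreover have "C \<subseteq> bounded_operators" using CM algD(1)[OF vnD(1)[OF M]] by blast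
  ultimately have "selfadjoint_subalgebra C"
    unfolding selfadjoint_subalgebra_def using AC a(2) by blast
  moreover have "abelian_algebra C"
    unfolding abelian_algebra_def
  proof (intro ballI)
    fix S T assume "S \<in> C" "T \<in> C"
    then obtain S' c T' d where e: "S' \<in> A" "T' \<in> A" "S = S' + c *\<^sub>O ?I" "T = T' + d *\<^sub>O ?I"
      by (auto simp: C_def)
    then show "S o\<^sub>L T = T o\<^sub>L S"
      using A'(3) by (simp add: prod abelian_algebra_def mult.commute algebra_simps)
  qed
  ultimately have "C = A" using A AC CM unfolding masa_def by blast
  moreover have "?I \<in> C"
  proof -
    have "0 + 1 *\<^sub>O ?I = ?I" by (rule blinfun_eqI) (simp add: op_simps)
    then show ?thesis using intro[OF a(2), of 1] by simp
  qed
  ultimately show ?thesis by simp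
qed

theorem theorem27:
  fixes M A :: "'h::complex_hilbert operator set"
    and \<tau> :: "'h operator \<Rightarrow> complex"
    and E :: "'h operator \<Rightarrow> 'h operator"
  assumes "type_II1_factor M"
    and "normalized_trace M \<tau>"
    and "masa M A"
    and "conditional_expectation M A E"
    and "trace_preserving M \<tau> E"
    and "\<And>P. P \<in> M \<Longrightarrow> is_projection P \<Longrightarrow> P \<noteq> 0 \<Longrightarrow>
           \<exists>T \<in> compression P M. T \<noteq> 0 \<and> E T = 0"
  shows "\<exists>B. von_neumann_algebra B \<and> B \<subseteq> M \<and> abelian_algebra B \<and> diffuse B \<and>
           orthogonal_algebras \<tau> A B"
proof -
  have vn: "von_neumann_algebra M" using assms(1) by (simp add: type_II1_factor_def factor_def)
  interpret tracial_algebra M \<tau> by unfold_locales (rule vn assms(2))+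
  have A: "A \<subseteq> M" "selfadjoint_subalgebra A" using assms(3) by (auto simp: masa_def)
  have idA: "id_blinfun \<in> A" by (rule masa_contains_id[OF vn assms(3)])
  have Ebim: "E (R o\<^sub>L T o\<^sub>L S) = R o\<^sub>L E T o\<^sub>L S" if "R \<in> A" "S \<in> A" "T \<in> M" for R S T
    using assms(4) that by (simp add: conditional_expectation_def)
  \<comment> \<open>The bimodule property with right factor 1 gives E (a T) = a E T = 0, and the
    trace is preserved.\<close>
  have orth: "\<tau> (a o\<^sub>L T) = 0" if "a \<in> A" "T \<in> M" "E T = 0" for a T
  proof -
    have "E (a o\<^sub>L T) = 0" using Ebim[OF that(1) idA that(2)] that(3) by (simp add: comp_simps)
    moreover have "\<tau> (E (a o\<^sub>L T)) = \<tau> (a o\<^sub>L T)"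
      using assms(5) that A(1) by (auto simp: trace_preserving_def)
    ultimately show ?thesis by (simp add: tr_zero)
  qed
  have "\<exists>T\<in>M. selfadj T \<and> T \<noteq> 0 \<and> P o\<^sub>L T o\<^sub>L P = T \<and> (\<forall>a\<in>A. \<tau> (a o\<^sub>L T) = 0)"
    if P: "P \<in> M" "is_projection P" "P \<noteq> 0" for P
  proof -
    obtain R where R: "R \<in> M" "P o\<^sub>L R o\<^sub>L P \<noteq> 0" "E (P o\<^sub>L R o\<^sub>L P) = 0"
      using assms(6)[OF P] by (auto simp: compression_def)
    define T where "T = P o\<^sub>L R o\<^sub>L P"
    have TM: "T \<in> M" using P R by (simp add: T_def)
    have Pb: "P \<in> bounded_operators" "adj P = P" "P o\<^sub>L P = P" using P(2) by (auto simp: is_projection_def)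
    have PT: "P o\<^sub>L T o\<^sub>L P = T" by (simp add: T_def comp_assoc Pb) (simp add: Pb flip: comp_assoc)
    have PaT: "P o\<^sub>L adj T o\<^sub>L P = adj T"
      using arg_cong[OF PT, of adj] TM Pb by (simp add: adj_comp comp_assoc)
    have aT: "\<tau> (a o\<^sub>L T) = 0" if "a \<in> A" for a using orth[OF that TM] R(3) by (simp add: T_def)
    \<comment> \<open>Conjugating the trace reduces this to \<open>aT\<close> at the adjoint of a,
      which lies in A again.\<close>
    have aTa: "\<tau> (a o\<^sub>L adj T) = 0" if a: "a \<in> A" for a
    proof -
      have aM: "a \<in> M" using a A by blast
      have "a o\<^sub>L adj T = adj (T o\<^sub>L adj a)" using aM TM by (simp add: adj_comp adj_adj)
      then have "\<tau> (a o\<^sub>L adj T) = cnj (\<tau> (T o\<^sub>L adj a))" using aM TM by (simp add: tr_adj)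
      also have "\<dots> = cnj (\<tau> (adj a o\<^sub>L T))" using tr_commute[of T "adj a"] aM TM by simp
      finally show ?thesis using aT[OF algD(6)[OF A(2) a]] by simp
    qed
    \<comment> \<open>Twice the real part and minus twice the imaginary part of T; they cannot both
      vanish.\<close>
    define T1 T2 where "T1 = T + adj T" and "T2 = \<i> *\<^sub>O (T - adj T)"
    have selfadj: "selfadj T1" "selfadj T2"
    proof -
      show "selfadj T1" using TM by (simp add: T1_def selfadj_def adj_add adj_adj add.commute)
      show "selfadj T2" using TM unfolding T2_def selfadj_def
        by (simp add: adj_diff adj_adj adj_scale)
          (rule blinfun_eqI, simp add: op_simps scaleC_diff_right scaleC_minus_left)
    qed
    have T12: "T1 \<in> M" "T2 \<in> M" using TM by (auto simp: T1_def T2_def)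
    have P12: "P o\<^sub>L T1 o\<^sub>L P = T1" "P o\<^sub>L T2 o\<^sub>L P = T2"
      using PT PaT Pb(1) by (simp_all add: T1_def T2_def comp_simps scale_operator_comp)
    have a12: "\<tau> (a o\<^sub>L T1) = 0" "\<tau> (a o\<^sub>L T2) = 0" if a: "a \<in> A" for a
    proof -
      have aM: "a \<in> M" using a A by blast
      then show "\<tau> (a o\<^sub>L T1) = 0" "\<tau> (a o\<^sub>L T2) = 0"
        using TM aT[OF a] aTa[OF a] by (simp_all add: T1_def T2_def comp_simps scale_operator_comp tr_add tr_scale tr_diff)
    qed
    have "T1 \<noteq> 0 \<or> T2 \<noteq> 0"
    proof (rule ccontr)
      assume "\<not> ?thesis"
      then have 0: "T1 = 0" "T2 = 0" by auto
      have "T = (1/2) *\<^sub>O (T1 + (- \<i>) *\<^sub>O T2)" unfolding T1_def T2_def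
        by (rule blinfun_eqI) (simp add: op_simps scaleC_add_right scaleC_diff_right scaleC_scaleC flip: scaleC_add_left)
      then have "T = 0" unfolding 0 by (metis add.right_neutral blinfun_eqI scaleC_zero_right scale_operator_apply zero_blinfun.rep_eq)
      then show False using R(2) by (simp add: T_def)
    qed
    then show ?thesis using selfadj T12 P12 a12 by blast
  qed
  then interpret masa_kernel M \<tau> A
    by unfold_locales (use A idA in auto)
  have "n2_closure step_algebra \<subseteq> M" by (auto simp: n2_closure_def)
  then show ?thesis
    using n2_closure_von_neumann[OF step_algebra(1,4,2,3)] n2_closure_abelian[OF step_algebra(4,2)]
      n2_closure_step_diffuse n2_closure_step_orthogonal by blast
qed

end
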